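(* For every integer $m\geq 1$, let $G_m=\langle s_0,s_1,\ldots,s_m\mid s_is_{i-1}s_i^{-1}=s_{i-1}^2\ \text{for all } i=1,\ldots,m\rangle$ be the $m$-th iterated Baumslag-Solitar group. Then its conjugator length function satisfies $\mathrm{CL}_{G_m}(n)\simeq E(m-1,n)$.
   Context: Conjugator length: let $H=\langle S\mid R\rangle$ be a finitely presented group with a fixed finite presentation, and let $|h|_H$ denote the minimal length of a word on $S$ (letters from $S$ and their inverses) representing $h\in H$. For words $u,v$ on $S$ representing conjugate elements of $H$, $c(u,v)$ is the smallest value of $|\gamma|_H$ over all $\gamma\in H$ conjugating $u$ to $v$. The conjugator length function $\mathrm{CL}_H(n)$ is the maximum of $c(u,v)$ over all conjugate pairs $(u,v)$ with $|u|_H+|v|_H\leq n$. Equivalence: for $f,g:\mathbb{N}\to\mathbb{N}$, write $f(n)\preceq g(n)$ if there exists $C>0$ such that $f(n)\leq C g(Cn+C)+Cn+C$ for all $n\in\mathbb{N}$, and $f(n)\simeq g(n)$ if $f\preceq g$ and $g\preceq f$. Iterated exponential: $E(0,n)=n$ and $E(m,n)=2^{E(m-1,n)}$ for $m\geq 1$. *)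

theory Defs
  imports "HOL-Algebra.Group"
begin

text \<open>A letter \<open>(s, True)\<close> stands for the generator \<open>s\<close>, and \<open>(s, False)\<close> for its formal inverse.
  Words are not assumed to be reduced.\<close>

type_synonym 'a word = "('a \<times> bool) list"

definition words :: "'a set \<Rightarrow> 'a word set" where
  "words S = lists (S \<times> UNIV)"

text \<open>A set of relations \<open>R\<close> consists of pairs \<open>(l, r)\<close>, standing for the relation \<open>l = r\<close>; a relator
  \<open>r\<close> is the pair \<open>(r, [])\<close>. The following is the congruence on words generated by free reduction
  and the relations, so its classes are the elements of the group \<open>\<langle>S | R\<rangle>\<close>. Relations that are not
  between words on \<open>S\<close> are ignored.\<close>

inductive_set pres_rel :: "'a set \<Rightarrow> ('a word \<times> 'a word) set \<Rightarrow> ('a word \<times> 'a word) set"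
  for S :: "'a set" and R :: "('a word \<times> 'a word) set" where
  refl: "w \<in> words S \<Longrightarrow> (w, w) \<in> pres_rel S R"
| sym: "(v, w) \<in> pres_rel S R \<Longrightarrow> (w, v) \<in> pres_rel S R"
| trans: "(u, v) \<in> pres_rel S R \<Longrightarrow> (v, w) \<in> pres_rel S R \<Longrightarrow> (u, w) \<in> pres_rel S R"
| cancel: "u \<in> words S \<Longrightarrow> v \<in> words S \<Longrightarrow> s \<in> S \<Longrightarrow>
    (u @ [(s, b), (s, \<not> b)] @ v, u @ v) \<in> pres_rel S R"
| rel: "u \<in> words S \<Longrightarrow> v \<in> words S \<Longrightarrow> (l, r) \<in> R \<Longrightarrow> l \<in> words S \<Longrightarrow> r \<in> words S \<Longrightarrow>
    (u @ l @ v, u @ r @ v) \<in> pres_rel S R"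

definition word_class :: "'a set \<Rightarrow> ('a word \<times> 'a word) set \<Rightarrow> 'a word \<Rightarrow> 'a word set" where
  "word_class S R w = pres_rel S R `` {w}"

definition presented_group :: "'a set \<Rightarrow> ('a word \<times> 'a word) set \<Rightarrow> 'a word set monoid" where
  "presented_group S R =
     \<lparr>carrier = words S // pres_rel S R,
      mult = (\<lambda>A B. \<Union>a\<in>A. \<Union>b\<in>B. word_class S R (a @ b)),
      one = word_class S R []\<rparr>"

definition inv_word :: "'a word \<Rightarrow> 'a word" where
  "inv_word w = rev (map (\<lambda>(s, b). (s, \<not> b)) w)"

lemma words_Nil [simp]: "[] \<in> words S"
  by (simp add: words_def)

lemma words_append [simp]: "u @ v \<in> words S \<longleftrightarrow> u \<in> words S \<and> v \<in> words S"
  by (auto simp: words_def)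

lemma words_Cons [simp]: "x # v \<in> words S \<longleftrightarrow> fst x \<in> S \<and> v \<in> words S"
  by (cases x) (auto simp: words_def)

lemma inv_word_words [simp]: "w \<in> words S \<Longrightarrow> inv_word w \<in> words S"
  by (auto simp: words_def inv_word_def)

lemma pres_rel_words: "(u, v) \<in> pres_rel S R \<Longrightarrow> u \<in> words S \<and> v \<in> words S"
  by (induction rule: pres_rel.induct) auto

lemma equiv_pres_rel: "equiv (words S) (pres_rel S R)"
proof (rule equivI)
  show "pres_rel S R \<subseteq> words S \<times> words S"
    using pres_rel_words by fast
  show "refl_on (words S) (pres_rel S R)"
    by (auto intro!: refl_onI pres_rel.refl)
  show "Relation.sym (pres_rel S R)"
    by (auto intro: symI pres_rel.sym)
  show "Relation.trans (pres_rel S R)"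
    by (blast intro: transI pres_rel.trans)
qed

lemma pres_rel_context:
  assumes "(u, v) \<in> pres_rel S R" "x \<in> words S" "y \<in> words S"
  shows "(x @ u @ y, x @ v @ y) \<in> pres_rel S R"
  using assms
proof (induction rule: pres_rel.induct)
  case (refl w)
  then show ?case by (simp add: pres_rel.refl)
next
  case (sym v w)
  then show ?case by (blast intro: pres_rel.sym)
next
  case (trans u v w)
  then show ?case by (blast intro: pres_rel.trans)
next
  case (cancel u v s b)
  then show ?case using pres_rel.cancel[of "x @ u" S "v @ y" s b R] by simp
next
  case (rel u v l r)
  then show ?case using pres_rel.rel[of "x @ u" S "v @ y" l r R] by simp
qed

lemma pres_rel_append:
  assumes "(u, u') \<in> pres_rel S R" "(v, v') \<in> pres_rel S R"
  shows "(u @ v, u' @ v') \<in> pres_rel S R"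
proof -
  have "(u @ v, u' @ v) \<in> pres_rel S R"
    using pres_rel_context[OF assms(1), of "[]" v] pres_rel_words[OF assms(2)] by simp
  moreover have "(u' @ v, u' @ v') \<in> pres_rel S R"
    using pres_rel_context[OF assms(2), of u' "[]"] pres_rel_words[OF assms(1)] by simp
  ultimately show ?thesis by (rule pres_rel.trans)
qed

lemma word_class_eq_iff:
  assumes "u \<in> words S" "v \<in> words S"
  shows "word_class S R u = word_class S R v \<longleftrightarrow> (u, v) \<in> pres_rel S R"
  using equiv_pres_rel[of S R] assms unfolding word_class_def
  by (simp add: eq_equiv_class_iff)

lemma word_class_self: "w \<in> words S \<Longrightarrow> w \<in> word_class S R w"
  by (simp add: word_class_def pres_rel.refl)

lemma carrier_presented_group: "carrier (presented_group S R) = word_class S R ` words S"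
  by (auto simp: presented_group_def word_class_def quotient_def)

lemma one_presented_group: "\<one>\<^bsub>presented_group S R\<^esub> = word_class S R []"
  by (simp add: presented_group_def)

lemma mult_presented_group:
  assumes "u \<in> words S" "v \<in> words S"
  shows "word_class S R u \<otimes>\<^bsub>presented_group S R\<^esub> word_class S R v = word_class S R (u @ v)"
proof -
  have eq: "word_class S R (a @ b) = word_class S R (u @ v)"
    if "a \<in> word_class S R u" "b \<in> word_class S R v" for a b
  proof -
    have "(u, a) \<in> pres_rel S R" "(v, b) \<in> pres_rel S R"
      using that by (auto simp: word_class_def)
    from pres_rel_append[OF this] have *: "(u @ v, a @ b) \<in> pres_rel S R" .
    then show ?thesis
      using word_class_eq_iff[of "u @ v" S "a @ b" R] pres_rel_words[OF *] by blast
  qed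
  have "(\<Union>a\<in>word_class S R u. \<Union>b\<in>word_class S R v. word_class S R (a @ b)) =
      (\<Union>a\<in>word_class S R u. \<Union>b\<in>word_class S R v. word_class S R (u @ v))"
    using eq by (intro SUP_cong[OF HOL.refl]) blast
  also have "\<dots> = word_class S R (u @ v)"
    using word_class_self[OF assms(1), of R] word_class_self[OF assms(2), of R] by blast
  finally show ?thesis
    by (simp add: presented_group_def)
qed

lemma inv_word_left:
  assumes "w \<in> words S"
  shows "(inv_word w @ w, []) \<in> pres_rel S R"
  using assms
proof (induction w)
  case Nil
  show ?case by (simp add: inv_word_def pres_rel.refl)
next
  case (Cons x w)
  obtain s b where x: "x = (s, b)" by (cases x)
  have w: "s \<in> S" "w \<in> words S" using Cons.prems x by auto
  have "(inv_word w @ [(s, \<not> b), (s, \<not> \<not> b)] @ w, inv_word w @ w) \<in> pres_rel S R"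
    using w by (intro pres_rel.cancel) auto
  then have "(inv_word (x # w) @ (x # w), inv_word w @ w) \<in> pres_rel S R"
    by (simp add: inv_word_def x)
  then show ?case using Cons.IH[OF w(2)] by (rule pres_rel.trans)
qed

lemma group_presented_group: "group (presented_group S R)"
proof (rule groupI)
  fix x y z
  assume "x \<in> carrier (presented_group S R)" "y \<in> carrier (presented_group S R)"
    "z \<in> carrier (presented_group S R)"
  then show "x \<otimes>\<^bsub>presented_group S R\<^esub> y \<otimes>\<^bsub>presented_group S R\<^esub> z =
      x \<otimes>\<^bsub>presented_group S R\<^esub> (y \<otimes>\<^bsub>presented_group S R\<^esub> z)"
    by (auto simp: carrier_presented_group mult_presented_group)
next
  fix x
  assume "x \<in> carrier (presented_group S R)"
  then obtain w where w: "w \<in> words S" "x = word_class S R w"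
    by (auto simp: carrier_presented_group)
  have "word_class S R (inv_word w @ w) = word_class S R []"
    using inv_word_left[OF w(1), of R] w by (simp add: word_class_eq_iff)
  then have "word_class S R (inv_word w) \<otimes>\<^bsub>presented_group S R\<^esub> x = \<one>\<^bsub>presented_group S R\<^esub>"
    using w by (simp add: mult_presented_group one_presented_group)
  then show "\<exists>y\<in>carrier (presented_group S R). y \<otimes>\<^bsub>presented_group S R\<^esub> x = \<one>\<^bsub>presented_group S R\<^esub>"
    using w by (auto simp: carrier_presented_group)
qed (auto simp: carrier_presented_group mult_presented_group one_presented_group)

text \<open>An element of a presented group is the set of all words representing it.\<close>

definition word_length :: "'a word set \<Rightarrow> nat" where
  "word_length h = (LEAST k. \<exists>w\<in>h. length w = k)"

definition conjugates :: "'a set \<Rightarrow> ('a word \<times> 'a word) set \<Rightarrow> 'a word \<Rightarrow> 'a word \<Rightarrow> 'a word set \<Rightarrow> bool"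
  where
  "conjugates S R u v \<gamma> \<longleftrightarrow> \<gamma> \<in> carrier (presented_group S R) \<and>
     \<gamma> \<otimes>\<^bsub>presented_group S R\<^esub> word_class S R u \<otimes>\<^bsub>presented_group S R\<^esub> inv\<^bsub>presented_group S R\<^esub> \<gamma>
       = word_class S R v"

definition conj_pairs :: "'a set \<Rightarrow> ('a word \<times> 'a word) set \<Rightarrow> ('a word \<times> 'a word) set" where
  "conj_pairs S R = {(u, v). u \<in> words S \<and> v \<in> words S \<and> (\<exists>\<gamma>. conjugates S R u v \<gamma>)}"

definition conj_dist :: "'a set \<Rightarrow> ('a word \<times> 'a word) set \<Rightarrow> 'a word \<Rightarrow> 'a word \<Rightarrow> nat" where
  "conj_dist S R u v = (LEAST k. \<exists>\<gamma>. conjugates S R u v \<gamma> \<and> word_length \<gamma> = k)"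

text \<open>For finite \<open>S\<close> the maximum below is over a finite nonempty set
  (\<open>CL_set_finite\<close> and \<open>CL_set_nonempty\<close>).\<close>

definition CL :: "'a set \<Rightarrow> ('a word \<times> 'a word) set \<Rightarrow> nat \<Rightarrow> nat" where
  "CL S R n = Max {conj_dist S R u v | u v. (u, v) \<in> conj_pairs S R \<and>
     word_length (word_class S R u) + word_length (word_class S R v) \<le> n}"

lemma word_length_attained:
  assumes "w \<in> words S"
  obtains w' where "w' \<in> words S" "word_class S R w' = word_class S R w"
    "length w' = word_length (word_class S R w)"
proof -
  have "\<exists>k. \<exists>w'\<in>word_class S R w. length w' = k"
    using word_class_self[OF assms] by blast
  then have "\<exists>w'\<in>word_class S R w. length w' = word_length (word_class S R w)"
    unfolding word_length_def by (rule LeastI_ex)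
  then obtain w' where w': "(w, w') \<in> pres_rel S R" "length w' = word_length (word_class S R w)"
    by (auto simp: word_class_def)
  have "w' \<in> words S"
    using pres_rel_words[OF w'(1)] by blast
  moreover have "word_class S R w' = word_class S R w"
    using word_class_eq_iff[OF assms calculation, of R] w'(1) by blast
  ultimately show ?thesis
    using that w'(2) by blast
qed

lemma CL_set_finite:
  assumes "finite S"
  shows "finite {conj_dist S R u v | u v. (u, v) \<in> conj_pairs S R \<and>
     word_length (word_class S R u) + word_length (word_class S R v) \<le> n}" (is "finite ?A")
proof -
  let ?W = "{w. set w \<subseteq> S \<times> (UNIV :: bool set) \<and> length w \<le> n}"
  have "finite ?W" using assms by (intro finite_lists_length_le) auto
  moreover have "?A \<subseteq> (\<lambda>(u, v). conj_dist S R u v) ` (?W \<times> ?W)"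
  proof
    fix x assume "x \<in> ?A"
    then obtain u v where uv: "x = conj_dist S R u v" "u \<in> words S" "v \<in> words S"
      "word_length (word_class S R u) + word_length (word_class S R v) \<le> n"
      by (auto simp: conj_pairs_def)
    obtain u' where u': "u' \<in> words S" "word_class S R u' = word_class S R u"
      "length u' = word_length (word_class S R u)" using word_length_attained[OF uv(2)] .
    obtain v' where v': "v' \<in> words S" "word_class S R v' = word_class S R v"
      "length v' = word_length (word_class S R v)" using word_length_attained[OF uv(3)] .
    have "x = conj_dist S R u' v'"
      using uv(1) u'(2) v'(2) by (simp add: conj_dist_def conjugates_def)
    moreover have "u' \<in> ?W" "v' \<in> ?W"
      using u' v' uv(4) by (auto simp: words_def)
    ultimately show "x \<in> (\<lambda>(u, v). conj_dist S R u v) ` (?W \<times> ?W)" by blast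
  qed
  ultimately show ?thesis
    using finite_cartesian_product[of ?W ?W] finite_imageI finite_subset by blast
qed

lemma CL_set_nonempty:
  "{conj_dist S R u v | u v. (u, v) \<in> conj_pairs S R \<and>
     word_length (word_class S R u) + word_length (word_class S R v) \<le> n} \<noteq> {}"
proof -
  interpret group "presented_group S R" by (rule group_presented_group)
  have "conjugates S R [] [] \<one>\<^bsub>presented_group S R\<^esub>"
    unfolding conjugates_def one_presented_group[symmetric] by simp
  moreover have "word_length (word_class S R []) = 0"
    using word_class_self[of "[]" S R] unfolding word_length_def
    by (intro Least_eq_0) (auto intro: bexI[of _ "[]"])
  ultimately have "([], []) \<in> conj_pairs S R \<and>
      word_length (word_class S R []) + word_length (word_class S R []) \<le> n"
    by (auto simp: conj_pairs_def)
  then show ?thesis by blast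
qed

definition growth_le :: "(nat \<Rightarrow> nat) \<Rightarrow> (nat \<Rightarrow> nat) \<Rightarrow> bool" (infix "\<preceq>" 50) where
  "f \<preceq> g \<longleftrightarrow> (\<exists>C>0. \<forall>n. f n \<le> C * g (C * n + C) + C * n + C)"

definition growth_equiv :: "(nat \<Rightarrow> nat) \<Rightarrow> (nat \<Rightarrow> nat) \<Rightarrow> bool" (infix "\<simeq>" 50) where
  "f \<simeq> g \<longleftrightarrow> f \<preceq> g \<and> g \<preceq> f"

fun E :: "nat \<Rightarrow> nat \<Rightarrow> nat" where
  "E 0 n = n"
| "E (Suc m) n = 2 ^ E m n"

definition BS_gens :: "nat \<Rightarrow> nat set" where
  "BS_gens m = {0..m}"

definition BS_rels :: "nat \<Rightarrow> (nat word \<times> nat word) set" where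
  "BS_rels m = {([(i, True), (i - 1, True), (i, False)], [(i - 1, True), (i - 1, True)]) | i. i \<in> {1..m}}"

end

theory Submission
  imports Defs Complex_Main "HOL-Library.Countable_Set"
begin

text \<open>
  All finite towers embed in the group \<open>tower\<close> with generators indexed by the natural numbers, and the
  tower of height \<open>m + 1\<close> is an HNN extension of the tower of height \<open>m\<close>, the stable letter conjugating
  \<open>gen m\<close> to its square.

  Upper bound, by induction on the height. Pinching and cyclic reduction replace two conjugate elements
  of length at most \<open>n\<close> by cyclically reduced ones of size at most \<open>2 ^ (C n)\<close>. If these lie in the base,
  they are conjugate there, or conjugate there to powers of \<open>gen m\<close> that differ by a power of the stable
  letter; the induction hypothesis at \<open>2 ^ (C n)\<close> gives one more exponential. Otherwise, by Collins' lemma,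
  some power of \<open>gen m\<close> conjugates one to a cyclic permutation of the other, and its exponent is
  bounded since an equation \<open>s^p b = c s^q\<close> in the base, with \<open>s = gen m\<close> and \<open>b\<close> not a power of \<open>s\<close>,
  bounds \<open>p\<close> linearly in the lengths of \<open>b\<close> and \<open>c\<close>. The induction starts at \<open>BS(1,2)\<close>, where
  conjugacy is arithmetic modulo \<open>2 ^ k - 1\<close>.

  Lower bound. With \<open>N = E (m - 1) n\<close>, the elements \<open>s\<^sub>1\<^sup>2\<close> and \<open>s\<^sub>0^(4^N - 1) s\<^sub>1\<^sup>2\<close> have length linear in
  \<open>n\<close>. An affine action on functions shows that a conjugator of length \<open>L\<close> between them writes
  \<open>(4^N - 1) / 3\<close>, binary \<open>10101...\<close>, as a sum of at most \<open>L\<close> signed powers of 2, so \<open>N / 4 \<le> L\<close>.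

  Groups are written additively, to make use of the class \<open>group_add\<close>, which does not assume commutativity.
\<close>

section \<open>Powers in additively written groups\<close>

text \<open>Two points shape the argument. Every fact that separates elements (exponent sums, the
  embedding of the presented groups, Britton's lemma, the lower bound) comes from an action, and as
  \<open>tower\<close> has infinitely many generators, an action of finitely many of them has to be
  extended upwards. This works because all free bijections with infinitely many orbits look like the
  same shift: a given one can be identified with a translation in a copy of BS(1,2), where a
  bijection conjugating it to its square is at hand. Secondly, each level may cost only one
  exponential, and reduced forms already use it up. So the bound on p in s^p b = c s^q has to be
  linear although the subgroups are distorted. It is linear because, if s^p is not visible in c, it
  survives only as the exponent of a power r^(2^n y) of the next lower generator r, with y nonzero
  and n equal to p up to a linear term. This power is short, and the subgroup below is at most
  exponentially distorted, so n is linear.\<close>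

definition zpow :: "'a::group_add \<Rightarrow> int \<Rightarrow> 'a" where
  "zpow g k = (if k \<ge> 0 then (((+) g) ^^ nat k) 0 else (((+) (- g)) ^^ nat (- k)) 0)"

lemma zpow_0 [simp]: "zpow g 0 = 0"
  by (simp add: zpow_def)

lemma zpow_1 [simp]: "zpow g 1 = g"
  by (simp add: zpow_def)

lemma zpow_add_1: "zpow g (k + 1) = g + zpow g k"
proof (cases "k \<ge> 0")
  case True
  then have "nat (k + 1) = Suc (nat k)" by simp
  then show ?thesis using True by (simp add: zpow_def)
next
  case False
  then have *: "nat (- k) = Suc (nat (- (k + 1)))" by simp
  show ?thesis
  proof (cases "k = -1")
    case True
    then show ?thesis by (simp add: zpow_def)
  next
    case neq: False
    then show ?thesis using False * by (simp add: zpow_def)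
  qed
qed

lemma zpow_diff_1: "zpow g (k - 1) = - g + zpow g k"
  using zpow_add_1[of g "k - 1"] by (simp flip: add.assoc)

lemma zpow_add: "zpow g (j + k) = zpow g j + zpow g k"
proof (induction j rule: int_induct[where k = 0])
  case (step1 i)
  have "zpow g (i + 1 + k) = zpow g ((i + k) + 1)" by (simp add: algebra_simps)
  also have "\<dots> = g + (zpow g i + zpow g k)"
    using step1 by (simp only: zpow_add_1)
  also have "\<dots> = zpow g (i + 1) + zpow g k"
    by (simp only: zpow_add_1 add.assoc[of g "zpow g i"])
  finally show ?case .
next
  case (step2 i)
  have "i - 1 + k = (i + k) - 1" by simp
  then show ?case
    using step2 by (simp only: zpow_diff_1 add.assoc)
qed simp

lemma zpow_minus: "zpow g (- k) = - zpow g k"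
  using zpow_add[of g "- k" k] by (simp add: eq_neg_iff_add_eq_0)

lemma zpow_minus_1 [simp]: "zpow g (- 1) = - g"
  by (simp add: zpow_minus)

lemma zpow_diff: "zpow g (j - k) = zpow g j - zpow g k"
  using zpow_add[of g j "- k"] by (simp add: zpow_minus)

lemma zpow_2: "zpow g 2 = g + g"
  using zpow_add[of g 1 1] by simp

lemma zpow_commute: "zpow g j + zpow g k = zpow g k + zpow g j"
  by (simp add: add.commute flip: zpow_add)

lemma zpow_hom:
  fixes f :: "'a::group_add \<Rightarrow> 'b::group_add"
  assumes "\<And>x y. f (x + y) = f x + f y"
  shows "f (zpow g k) = zpow (f g) k"
proof -
  have f0: "f 0 = 0"
    using assms[of 0 0] add_left_cancel[of "f 0" "f 0" 0] by simp
  have fm: "f (- x) = - f x" for x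
    using assms[of "- x" x] f0 by (simp add: eq_neg_iff_add_eq_0)
  show ?thesis
  proof (induction k rule: int_induct[where k = 0])
    case (step1 i)
    then show ?case by (simp only: zpow_add_1 assms)
  next
    case (step2 i)
    then show ?case by (simp only: zpow_diff_1 assms fm)
  qed (simp add: f0)
qed

lemma conj_zpow: "x + zpow g k - x = zpow (x + g - x) k" for x :: "'a::group_add"
  using zpow_hom[of "\<lambda>y. x + y - x" g k]
  by (simp add: diff_conv_add_uminus add.assoc del: add_uminus_conv_diff)

lemma zpow_zpow: "zpow (zpow g j) k = zpow g (j * k)"
proof (induction k rule: int_induct[where k = 0])
  case (step1 i)
  have "j * (i + 1) = j + j * i" by (simp add: algebra_simps)
  then show ?case using step1 by (simp only: zpow_add_1[of "zpow g j"] zpow_add[of g j])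
next
  case (step2 i)
  have "j * (i - 1) = - j + j * i" by (simp add: algebra_simps)
  then show ?case using step2 by (simp only: zpow_diff_1 zpow_add zpow_minus)
qed simp

lemma conj_zpow_double:
  fixes s t :: "'a::group_add"
  assumes "t + s = s + s + t"
  shows "t + zpow s k = zpow s (2 * k) + t"
proof -
  have "t + s - t = zpow s 2"
    using assms by (simp add: zpow_2)
  then have "t + zpow s k - t = zpow s (2 * k)"
    by (simp add: conj_zpow zpow_zpow)
  then show ?thesis by (metis diff_add_cancel)
qed

section \<open>The group of all bijections of a type\<close>

text \<open>Made an instance of \<open>group_add\<close>, so that an action of the tower is a
  homomorphism \<open>tower_hom\<close> into this group.\<close>

typedef 'a bijection = "{f :: 'a \<Rightarrow> 'a. bij f}"
  morphisms app Bijection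
  by (auto intro: bij_id)

setup_lifting type_definition_bijection

instantiation bijection :: (type) group_add
begin

lift_definition zero_bijection :: "'a bijection" is id by simp
lift_definition plus_bijection :: "'a bijection \<Rightarrow> 'a bijection \<Rightarrow> 'a bijection" is "(\<circ>)"
  by (rule bij_comp)
lift_definition uminus_bijection :: "'a bijection \<Rightarrow> 'a bijection" is "inv_into UNIV"
  by (rule bij_imp_bij_inv)
definition minus_bijection :: "'a bijection \<Rightarrow> 'a bijection \<Rightarrow> 'a bijection" where
  "minus_bijection f g = f + - g"

instance
proof
  fix a b c :: "'a bijection"
  show "a + b + c = a + (b + c)"
    by (simp add: app_inject[symmetric] plus_bijection.rep_eq comp_assoc)
  show "0 + a = a" "a + 0 = a"
    by (simp_all add: app_inject[symmetric] plus_bijection.rep_eq zero_bijection.rep_eq)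
  show "- a + a = 0"
    using app[of a] by (simp add: app_inject[symmetric] plus_bijection.rep_eq zero_bijection.rep_eq
        uminus_bijection.rep_eq bij_is_inj)
  show "a + - b = a - b" by (simp add: minus_bijection_def)
qed

end

lemma bij_app: "bij (app f)"
  using app by auto

lemma app_0 [simp]: "app 0 x = x"
  by (simp add: zero_bijection.rep_eq)

lemma app_plus [simp]: "app (f + g) x = app f (app g x)"
  by (simp add: plus_bijection.rep_eq)

lemma app_uminus_app [simp]: "app (- f) (app f x) = x"
  using app_plus[of "- f" f x] by simp

lemma app_app_uminus [simp]: "app f (app (- f) x) = x"
  using app_plus[of f "- f" x] by simp

lemma app_Bijection: "bij f \<Longrightarrow> app (Bijection f) = f"
  by (simp add: Bijection_inverse)

lemma bijection_eqI: "(\<And>x. app f x = app g x) \<Longrightarrow> f = g"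
  by (simp add: app_inject[symmetric] ext)

lemma app_minus_eq_iff: "app (- f) x = y \<longleftrightarrow> x = app f y"
  by (metis app_app_uminus app_uminus_app)

lemma bijI_inverse:
  assumes "\<And>x. g (f x) = x" "\<And>x. f (g x) = x"
  shows "bij f"
  using assms by (intro o_bij[of g]) auto

section \<open>The infinite tower\<close>

definition tower_rels :: "(nat word \<times> nat word) set" where
  "tower_rels = {([(Suc i, True), (i, True), (Suc i, False)], [(i, True), (i, True)]) | i. True}"

quotient_type tower = "nat word" / "\<lambda>u v. (u, v) \<in> pres_rel UNIV tower_rels"
  morphisms repw val
proof (rule equivpI)
  show "reflp (\<lambda>u v. (u, v) \<in> pres_rel UNIV tower_rels)"
    by (intro reflpI pres_rel.refl) (simp add: words_def)
  show "symp (\<lambda>u v. (u, v) \<in> pres_rel UNIV tower_rels)"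
    by (rule sympI) (rule pres_rel.sym)
  show "transp (\<lambda>u v. (u, v) \<in> pres_rel UNIV tower_rels)"
    by (rule transpI) (rule pres_rel.trans)
qed

lemma words_UNIV [simp]: "w \<in> words UNIV"
  by (simp add: words_def)

lemma val_eq_iff: "val u = val v \<longleftrightarrow> (u, v) \<in> pres_rel UNIV tower_rels"
  by (rule tower.abs_eq_iff)

lemma val_repw [simp]: "val (repw g) = g"
  by (rule Quotient3_abs_rep[OF Quotient3_tower])

lemma inv_word_inv_word [simp]: "inv_word (inv_word w) = w"
  by (induction w) (auto simp: inv_word_def rev_map)

lemma inv_word_right: "w \<in> words S \<Longrightarrow> (w @ inv_word w, []) \<in> pres_rel S R"
  using inv_word_left[of "inv_word w"] by simp

lemma pres_rel_inv_word:
  assumes "(u, v) \<in> pres_rel S R"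
  shows "(inv_word u, inv_word v) \<in> pres_rel S R"
proof -
  have uv: "u \<in> words S" "v \<in> words S" using pres_rel_words[OF assms] by auto
  have "(inv_word u @ v @ inv_word v, inv_word u @ []) \<in> pres_rel S R"
    by (intro pres_rel_append pres_rel.refl inv_word_right uv inv_word_words)
  moreover have "(inv_word u @ u @ inv_word v, inv_word u @ v @ inv_word v) \<in> pres_rel S R"
    by (intro pres_rel_append pres_rel.refl assms uv inv_word_words)
  moreover have "((inv_word u @ u) @ inv_word v, [] @ inv_word v) \<in> pres_rel S R"
    by (intro pres_rel_append pres_rel.refl inv_word_left uv inv_word_words)
  ultimately show ?thesis
    by simp (metis pres_rel.sym pres_rel.trans)
qed

instantiation tower :: group_add
begin

lift_definition zero_tower :: tower is "[]" .

lift_definition plus_tower :: "tower \<Rightarrow> tower \<Rightarrow> tower" is "(@)"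
  by (rule pres_rel_append)

lift_definition uminus_tower :: "tower \<Rightarrow> tower" is inv_word
  by (rule pres_rel_inv_word)

definition minus_tower :: "tower \<Rightarrow> tower \<Rightarrow> tower" where
  "minus_tower g h = g + - h"

lemma val_Nil: "val [] = 0"
  by (simp add: zero_tower_def)

lemma val_append: "val (u @ v) = val u + val v"
  by (simp add: plus_tower.abs_eq)

lemma val_inv_word: "val (inv_word u) = - val u"
  by (simp add: uminus_tower.abs_eq)

lemma tower_exhaust: obtains w where "g = val w"
  using val_repw by metis

instance
proof
  fix a b c :: tower
  obtain u v w where abc: "a = val u" "b = val v" "c = val w"
    by (metis tower_exhaust)
  show "a + b + c = a + (b + c)" "0 + a = a" "a + 0 = a"
    unfolding abc by (simp_all flip: val_append val_Nil)
  show "- a + a = 0"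
    unfolding abc by (simp add: inv_word_left val_eq_iff flip: val_append val_Nil val_inv_word)
  show "a + - b = a - b" by (simp add: minus_tower_def)
qed

end

definition gen :: "nat \<Rightarrow> tower" where
  "gen i = val [(i, True)]"

section \<open>Homomorphisms out of the infinite tower\<close>

fun word_eval :: "(nat \<Rightarrow> 'h::group_add) \<Rightarrow> nat word \<Rightarrow> 'h" where
  "word_eval f [] = 0"
| "word_eval f ((i, b) # w) = (if b then f i else - f i) + word_eval f w"

lemma word_eval_append [simp]: "word_eval f (u @ v) = word_eval f u + word_eval f v"
  by (induction f u rule: word_eval.induct) (simp_all add: add.assoc)

text \<open>The condition ranges over all indices; \<open>tower_family_extension\<close> supplies
  the members that an action of a finite tower lacks.\<close>

definition tower_family :: "(nat \<Rightarrow> 'h::group_add) \<Rightarrow> bool" where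
  "tower_family f \<longleftrightarrow> (\<forall>i. f (Suc i) + f i = f i + f i + f (Suc i))"

lemma word_eval_pres_rel:
  assumes "tower_family f" "(u, v) \<in> pres_rel UNIV tower_rels"
  shows "word_eval f u = word_eval f v"
  using assms(2)
proof (induction rule: pres_rel.induct)
  case (cancel u v s b)
  then show ?case by (simp flip: add.assoc)
next
  case (rel u v l r)
  then obtain i where "l = [(Suc i, True), (i, True), (Suc i, False)]" "r = [(i, True), (i, True)]"
    by (auto simp: tower_rels_def)
  moreover have "f (Suc i) + f i - f (Suc i) = f i + f i"
    using assms(1) by (simp add: tower_family_def)
  ultimately have "word_eval f l = word_eval f r"
    by (simp add: add_diff_eq)
  then show ?case by simp
qed auto

definition tower_hom :: "(nat \<Rightarrow> 'h::group_add) \<Rightarrow> tower \<Rightarrow> 'h" where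
  "tower_hom f g = word_eval f (repw g)"

lemma tower_hom_val:
  assumes "tower_family f"
  shows "tower_hom f (val w) = word_eval f w"
proof -
  have "(repw (val w), w) \<in> pres_rel UNIV tower_rels"
    by (simp flip: val_eq_iff)
  then show ?thesis
    unfolding tower_hom_def by (rule word_eval_pres_rel[OF assms])
qed

lemma tower_hom_add:
  assumes "tower_family f"
  shows "tower_hom f (g + h) = tower_hom f g + tower_hom f h"
proof -
  obtain u v where "g = val u" "h = val v" by (metis tower_exhaust)
  then show ?thesis
    using assms by (simp add: tower_hom_val flip: val_append)
qed

lemma tower_hom_gen: "tower_family f \<Longrightarrow> tower_hom f (gen i) = f i"
  by (simp add: gen_def tower_hom_val)

lemma tower_hom_0: "tower_family f \<Longrightarrow> tower_hom f 0 = 0"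
  using tower_hom_val[of f "[]"] by (simp add: val_Nil)

lemma tower_hom_uminus: "tower_family f \<Longrightarrow> tower_hom f (- g) = - tower_hom f g"
  using tower_hom_add[of f "- g" g] by (simp add: tower_hom_0 eq_neg_iff_add_eq_0)

lemma val_singleton: "val [(i, b)] = (if b then gen i else - gen i)"
proof -
  have "val (inv_word [(i, True)]) = - gen i"
    by (simp add: gen_def val_inv_word)
  then show ?thesis
    by (auto simp: gen_def inv_word_def)
qed

lemma val_Cons: "val ((i, b) # w) = (if b then gen i else - gen i) + val w"
  using val_append[of "[(i, b)]" w] by (simp add: val_singleton)

lemma gen_rel: "gen (Suc i) + gen i = gen i + gen i + gen (Suc i)"
proof -
  have "([] @ [(Suc i, True), (i, True), (Suc i, False)] @ [], [] @ [(i, True), (i, True)] @ [])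
      \<in> pres_rel UNIV tower_rels"
    by (intro pres_rel.rel) (auto simp: tower_rels_def)
  then have "gen (Suc i) + (gen i - gen (Suc i)) = gen i + gen i"
    unfolding append_Nil append_Nil2 by (simp add: val_Cons val_Nil flip: val_eq_iff)
  then have "gen i + gen i + gen (Suc i) = gen (Suc i) + (gen i - gen (Suc i)) + gen (Suc i)"
    by simp
  also have "\<dots> = gen (Suc i) + gen i"
    by (simp only: add.assoc diff_add_cancel)
  finally show ?thesis by simp
qed

section \<open>Extending actions to the infinite tower\<close>

text \<open>A bijection is free if the integers act freely through its powers, with infinitely many orbits.\<close>

definition free_bij :: "'a bijection \<Rightarrow> bool" where
  "free_bij f \<longleftrightarrow> (\<exists>h :: 'a \<Rightarrow> nat \<times> int. bij h \<and> (\<forall>x. h (app f x) = (fst (h x), snd (h x) + 1)))"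

text \<open>Each orbit meets the zero level of \<open>c\<close> exactly once, so an enumeration of
  that level numbers the orbits, and \<open>c\<close> gives the position inside an orbit.\<close>

lemma free_bij_height:
  fixes f :: "'a::countable bijection" and c :: "'a \<Rightarrow> int"
  assumes c: "\<And>x. c (app f x) = c x + 1" and inf: "infinite {x. c x = 0}"
  shows "free_bij f"
proof -
  let ?Y = "{x. c x = 0}"
  have cz: "c (app (zpow f k) x) = c x + k" for k x
  proof (induction k rule: int_induct[where k = 0])
    case (step1 i)
    then show ?case by (simp add: zpow_add_1 c)
  next
    case (step2 i)
    have "c (app (- f) y) = c y - 1" for y
      using c[of "app (- f) y"] by simp
    then show ?case using step2 by (simp add: zpow_diff_1)
  qed simp
  let ?e = "to_nat_on ?Y"
  have e: "bij_betw ?e ?Y UNIV"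
    using inf by (simp add: to_nat_on_infinite)
  define h where "h x = (?e (app (zpow f (- c x)) x), c x)" for x
  define g where "g p = app (zpow f (snd p)) (from_nat_into ?Y (fst p))" for p
  have cy: "c (from_nat_into ?Y n) = 0" for n
    using from_nat_into[of ?Y n] infinite_imp_nonempty[OF inf] by simp
  have "bij h"
  proof (rule bijI_inverse[of g])
    fix x
    have "from_nat_into ?Y (?e (app (zpow f (- c x)) x)) = app (zpow f (- c x)) x"
      using inf by (intro from_nat_into_to_nat_on) (auto simp: cz)
    then show "g (h x) = x"
      by (simp add: h_def g_def flip: app_plus zpow_add)
  next
    fix p
    show "h (g p) = p"
      using inf by (simp add: h_def g_def cz cy to_nat_on_from_nat_into_infinite prod_eq_iff
          flip: app_plus zpow_add)
  qed
  moreover have "h (app f x) = (fst (h x), snd (h x) + 1)" for x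
  proof -
    have "app (zpow f (- c (app f x))) (app f x) = app (zpow f (- c x)) x"
      using app_plus[of "zpow f (- c (app f x))" f x] zpow_add[of f "- c (app f x)" 1]
      by (simp add: c)
    then show ?thesis by (simp add: h_def c)
  qed
  ultimately show ?thesis
    unfolding free_bij_def by blast
qed

text \<open>The regular action of the Baumslag-Solitar group \<open>BS(1,2)\<close> on a set of affine maps of the
  rationals supplies the next generator.\<close>

lemma free_bij_step:
  fixes f :: "'a bijection"
  assumes "free_bij f"
  obtains g where "free_bij g" "g + f = f + f + g"
proof -
  define a :: "(rat \<times> int) bijection" where "a = Bijection (\<lambda>(x, k). (x + 1, k))"
  define t :: "(rat \<times> int) bijection" where "t = Bijection (\<lambda>(x, k). (2 * x, k + 1))"
  have a: "app a (x, k) = (x + 1, k)" for x k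
    unfolding a_def by (subst app_Bijection, rule bijI_inverse[of "\<lambda>(x, k). (x - 1, k)"]) auto
  have t: "app t (x, k) = (2 * x, k + 1)" for x k
    unfolding t_def by (subst app_Bijection, rule bijI_inverse[of "\<lambda>(x, k). (x / 2, k - 1)"]) auto
  have "range (\<lambda>k. (0, k)) \<subseteq> {x :: rat \<times> int. \<lfloor>fst x\<rfloor> = 0}" by auto
  moreover have "infinite (range (\<lambda>k :: int. (0 :: rat, k)))"
    by (simp add: finite_image_iff inj_on_def)
  ultimately have "infinite {x :: rat \<times> int. \<lfloor>fst x\<rfloor> = 0}"
    using finite_subset by blast
  then have "free_bij a"
    by (intro free_bij_height[of "\<lambda>x. \<lfloor>fst x\<rfloor>"]) (auto simp: a)
  then obtain ha :: "rat \<times> int \<Rightarrow> nat \<times> int" where ha: "bij ha" "\<And>x. ha (app a x) = (fst (ha x), snd (ha x) + 1)"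
    unfolding free_bij_def by blast
  have "range (\<lambda>n. (of_nat n, 0)) \<subseteq> {x :: rat \<times> int. snd x = 0}" by auto
  moreover have "infinite (range (\<lambda>n. (of_nat n :: rat, 0 :: int)))"
    by (rule range_inj_infinite) (auto intro: injI)
  ultimately have "infinite {x :: rat \<times> int. snd x = 0}"
    using finite_subset by blast
  then have "free_bij t"
    by (intro free_bij_height[of snd]) (auto simp: t)
  then obtain ht :: "rat \<times> int \<Rightarrow> nat \<times> int" where ht: "bij ht" "\<And>x. ht (app t x) = (fst (ht x), snd (ht x) + 1)"
    unfolding free_bij_def by blast
  obtain hf :: "'a \<Rightarrow> nat \<times> int" where hf: "bij hf" "\<And>x. hf (app f x) = (fst (hf x), snd (hf x) + 1)"
    using assms unfolding free_bij_def by blast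
  \<comment> \<open>Both \<open>f\<close> and \<open>a\<close> are copies of the shift on pairs, so
    \<open>h\<close> identifies \<open>f\<close> with \<open>a\<close>; then \<open>g\<close> is
    \<open>t\<close> pulled back along \<open>h\<close>.\<close>
  define h where "h = inv_into UNIV ha \<circ> hf"
  have h: "bij h"
    unfolding h_def by (intro bij_comp hf bij_imp_bij_inv ha)
  have ha_h: "ha (h x) = hf x" for x
    using ha(1) by (simp add: h_def bij_is_surj surj_f_inv_f)
  have hfa: "h (app f x) = app a (h x)" for x
    by (rule injD[OF bij_is_inj[OF ha(1)]]) (simp add: ha_h ha hf)
  define g where "g = Bijection (inv_into UNIV h \<circ> app t \<circ> h)"
  have "app g = inv_into UNIV h \<circ> app t \<circ> h"
    unfolding g_def by (intro app_Bijection bij_comp h bij_imp_bij_inv bij_app)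
  then have hg: "h (app g x) = app t (h x)" for x
    using h by (simp add: bij_is_surj surj_f_inv_f)
  have "free_bij g"
    unfolding free_bij_def
    by (intro exI[of _ "ht \<circ> h"] conjI bij_comp h ht) (simp add: hg ht)
  moreover have "g + f = f + f + g"
  proof (rule bijection_eqI)
    fix x
    have "h (app (g + f) x) = h (app (f + f + g) x)"
      by (cases "h x") (simp add: hg hfa a t)
    then show "app (g + f) x = app (f + f + g) x"
      using bij_is_inj[OF h] by (simp add: inj_eq)
  qed
  ultimately show ?thesis by (rule that)
qed

text \<open>The integer coordinate, moved by \<open>F j\<close> alone among the first generators,
  makes \<open>F j\<close> free, and \<open>free_bij_step\<close> then yields the generators above
  \<open>j\<close> one after the other. The relation below \<open>j\<close> survives because
  \<open>F j\<close> occurs once on each side of it.\<close>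

theorem tower_family_extension:
  fixes f :: "nat \<Rightarrow> 'a::countable bijection"
  assumes "infinite (UNIV :: 'a set)"
    and rel: "\<And>i. i < j \<Longrightarrow> f (Suc i) + f i = f i + f i + f (Suc i)"
  obtains F :: "nat \<Rightarrow> ('a \<times> int) bijection" where "tower_family F"
    "\<And>i x k. i < j \<Longrightarrow> app (F i) (x, k) = (app (f i) x, k)"
    "\<And>x k. app (F j) (x, k) = (app (f j) x, k + 1)"
proof -
  define F0 where "F0 i = Bijection (\<lambda>(x, k :: int). (app (f i) x, k))" for i
  have F0: "app (F0 i) (x, k) = (app (f i) x, k)" for i x k
    unfolding F0_def by (subst app_Bijection, rule bijI_inverse[of "\<lambda>(x, k). (app (- f i) x, k)"]) auto
  define Fj where "Fj = Bijection (\<lambda>(x, k :: int). (app (f j) x, k + 1))"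
  have Fj: "app Fj (x, k) = (app (f j) x, k + 1)" for x k
    unfolding Fj_def by (subst app_Bijection, rule bijI_inverse[of "\<lambda>(x, k). (app (- f j) x, k - 1)"]) auto
  have "range (\<lambda>x. (x, 0)) \<subseteq> {x :: 'a \<times> int. snd x = 0}" by auto
  moreover have "infinite (range (\<lambda>x :: 'a. (x, 0 :: int)))"
    using assms(1) by (simp add: finite_image_iff inj_on_def)
  ultimately have "infinite {x :: 'a \<times> int. snd x = 0}"
    using finite_subset by blast
  then have free: "free_bij Fj"
    by (intro free_bij_height[of snd]) (auto simp: Fj)
  define P where "P n g \<longleftrightarrow> free_bij g \<and> (n = (0::nat) \<longrightarrow> g = Fj)" for n g
  have "\<exists>G. \<forall>n. P n (G n) \<and> G (Suc n) + G n = G n + G n + G (Suc n)"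
  proof (rule dependent_nat_choice)
    show "\<exists>x. P 0 x" using free by (auto simp: P_def)
    show "\<exists>y. P (Suc n) y \<and> y + x = x + x + y" if "P n x" for x n
      using that free_bij_step[of x] by (metis P_def nat.distinct(1))
  qed
  then obtain G where G: "G 0 = Fj" "\<And>n. G (Suc n) + G n = G n + G n + G (Suc n)"
    by (auto simp: P_def)
  define F where "F i = (if i < j then F0 i else G (i - j))" for i
  have "F (Suc i) + F i = F i + F i + F (Suc i)" for i
  proof -
    consider "Suc i < j" | "Suc i = j" | "i \<ge> j" by linarith
    then show ?thesis
    proof cases
      case 3
      then show ?thesis using G(2)[of "i - j"] by (simp add: F_def Suc_diff_le)
    next
      case 1
      have "app (f (Suc i)) (app (f i) x) = app (f i) (app (f i) (app (f (Suc i)) x))" for x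
        using rel[of i] 1 by (metis Suc_lessD app_plus)
      then show ?thesis using 1
        by (intro bijection_eqI) (auto simp: F_def F0)
    next
      case 2
      have "app (f (Suc i)) (app (f i) x) = app (f i) (app (f i) (app (f (Suc i)) x))" for x
        using rel[of i] 2 by (metis lessI app_plus)
      then show ?thesis using 2
        by (intro bijection_eqI) (auto simp: F_def F0 G Fj)
    qed
  qed
  then have "tower_family F"
    by (simp add: tower_family_def)
  moreover have "app (F j) (x, k) = (app (f j) x, k + 1)" for x k
    by (simp add: F_def G Fj)
  moreover have "app (F i) (x, k) = (app (f i) x, k)" if "i < j" for i x k
    using that by (simp add: F_def F0)
  ultimately show ?thesis using that by blast
qed

section \<open>The finite towers inside the infinite one\<close>

definition H :: "nat \<Rightarrow> tower set" where
  "H m = val ` words (BS_gens m)"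

definition len :: "nat \<Rightarrow> tower \<Rightarrow> nat" where
  "len m g = (LEAST k. \<exists>w\<in>words (BS_gens m). val w = g \<and> length w = k)"

lemma H_0 [simp]: "0 \<in> H m"
  unfolding H_def by (rule image_eqI[of _ _ "[]"]) (simp_all add: val_Nil)

lemma H_add [simp]: "g \<in> H m \<Longrightarrow> h \<in> H m \<Longrightarrow> g + h \<in> H m"
  unfolding H_def by (auto simp flip: val_append)

lemma H_uminus [simp]: "g \<in> H m \<Longrightarrow> - g \<in> H m"
  unfolding H_def by (auto simp flip: val_inv_word)

lemma H_diff [simp]: "g \<in> H m \<Longrightarrow> h \<in> H m \<Longrightarrow> g - h \<in> H m"
  using H_add[of g m "- h"] by simp

lemma H_gen [simp]: "i \<le> m \<Longrightarrow> gen i \<in> H m"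
  unfolding H_def gen_def by (auto simp: BS_gens_def)

lemma H_zpow [simp]: "g \<in> H m \<Longrightarrow> zpow g k \<in> H m"
  by (induction k rule: int_induct[where k = 0]) (simp_all add: zpow_add_1 zpow_diff_1)

lemma BS_gens_mono: "m \<le> n \<Longrightarrow> w \<in> words (BS_gens m) \<Longrightarrow> w \<in> words (BS_gens n)"
  by (fastforce simp: words_def BS_gens_def)

lemma H_mono: "m \<le> n \<Longrightarrow> g \<in> H m \<Longrightarrow> g \<in> H n"
  unfolding H_def using BS_gens_mono by blast

lemma H_Suc [simp]: "g \<in> H m \<Longrightarrow> g \<in> H (Suc m)"
  by (rule H_mono[of m]) auto

lemma len_attained:
  assumes "g \<in> H m"
  obtains w where "w \<in> words (BS_gens m)" "val w = g" "length w = len m g"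
proof -
  have "\<exists>k. \<exists>w\<in>words (BS_gens m). val w = g \<and> length w = k"
    using assms by (auto simp: H_def)
  then have "\<exists>w\<in>words (BS_gens m). val w = g \<and> length w = len m g"
    unfolding len_def by (rule LeastI_ex)
  then show ?thesis using that by blast
qed

lemma len_le: "w \<in> words (BS_gens m) \<Longrightarrow> len m (val w) \<le> length w"
  unfolding len_def by (rule Least_le) blast

lemma len_0 [simp]: "len m 0 = 0"
  using len_le[of "[]" m] by (simp add: val_Nil)

lemma len_add:
  assumes "g \<in> H m" "h \<in> H m"
  shows "len m (g + h) \<le> len m g + len m h"
proof -
  obtain u v where "u \<in> words (BS_gens m)" "val u = g" "length u = len m g"
    "v \<in> words (BS_gens m)" "val v = h" "length v = len m h"
    using assms by (metis len_attained)
  then show ?thesis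
    using len_le[of "u @ v" m] by (auto simp: val_append)
qed

lemma length_inv_word: "length (inv_word u) = length u"
  by (simp add: inv_word_def)

lemma len_uminus_le:
  assumes "g \<in> H m"
  shows "len m (- g) \<le> len m g"
proof -
  obtain u where "u \<in> words (BS_gens m)" "val u = g" "length u = len m g"
    using assms by (metis len_attained)
  then show ?thesis
    using len_le[of "inv_word u" m] by (auto simp: val_inv_word length_inv_word)
qed

lemma len_uminus [simp]: "g \<in> H m \<Longrightarrow> len m (- g) = len m g"
  using len_uminus_le[of g m] len_uminus_le[of "- g" m] by simp

lemma len_diff: "g \<in> H m \<Longrightarrow> h \<in> H m \<Longrightarrow> len m (g - h) \<le> len m g + len m h"
  using len_add[of g m "- h"] by simp

lemma len_gen: "i \<le> m \<Longrightarrow> len m (gen i) \<le> 1"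
  using len_le[of "[(i, True)]" m] by (simp add: gen_def BS_gens_def)

lemma len_mono:
  assumes "m \<le> n" "g \<in> H m"
  shows "len n g \<le> len m g"
proof -
  obtain u where "u \<in> words (BS_gens m)" "val u = g" "length u = len m g"
    using assms by (metis len_attained)
  then show ?thesis
    using len_le[of u n] BS_gens_mono[OF assms(1)] by metis
qed

lemma len_zpow:
  assumes "g \<in> H m"
  shows "len m (zpow g k) \<le> nat \<bar>k\<bar> * len m g"
proof -
  have *: "len m (zpow g (int n)) \<le> n * len m g" for n
  proof (induction n)
    case (Suc n)
    have "len m (zpow g (int (Suc n))) = len m (g + zpow g (int n))"
      by (simp add: add.commute flip: zpow_add_1)
    also have "\<dots> \<le> len m g + len m (zpow g (int n))"
      using assms by (intro len_add) auto
    finally show ?case using Suc by simp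
  qed simp
  show ?thesis
  proof (cases "k \<ge> 0")
    case True
    then show ?thesis using *[of "nat k"] by simp
  next
    case False
    then have "zpow g k = - zpow g (int (nat (- k)))"
      by (simp add: zpow_minus)
    then show ?thesis using *[of "nat (- k)"] False assms by simp
  qed
qed

lemma len_zpow_gen: "i \<le> m \<Longrightarrow> len m (zpow (gen i) k) \<le> nat \<bar>k\<bar>"
  using order.trans[OF len_zpow[of "gen i" m k] mult_le_mono2[OF len_gen[of i m]]] by simp

text \<open>In the full tower \<open>gen m\<close> is conjugate to its square, so no homomorphism to
  the integers sends it to 1. On \<open>H m\<close> there is one: extend the trivial action and read
  off the integer coordinate, which only \<open>gen m\<close> moves.\<close>

lemma exponent_sum_exists:
  "\<exists>e :: tower \<Rightarrow> int. (\<forall>g\<in>H m. \<forall>h\<in>H m. e (g + h) = e g + e h) \<and> e (gen m) = 1 \<and>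
     (\<forall>g\<in>H m. \<bar>e g\<bar> \<le> int (len m g))"
proof -
  obtain F :: "nat \<Rightarrow> (nat \<times> int) bijection" where F: "tower_family F"
    "\<And>i x k. i < m \<Longrightarrow> app (F i) (x, k) = (app 0 x, k)"
    "\<And>x k. app (F m) (x, k) = (app 0 x, k + 1)"
    using tower_family_extension[of m "\<lambda>_. 0"] by (metis add_0 infinite_UNIV_nat)
  define e where "e g = snd (app (tower_hom F g) (0, 0))" for g
  have act: "\<exists>j. (\<forall>x k. app (tower_hom F (val w)) (x, k) = (x, k + j)) \<and> \<bar>j\<bar> \<le> int (length w)"
    if "w \<in> words (BS_gens m)" for w
    using that
  proof (induction w)
    case Nil
    then show ?case by (simp add: val_Nil tower_hom_0 F)
  next
    case (Cons a w)
    obtain i b where a: "a = (i, b)" by (cases a)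
    obtain j where j: "\<forall>x k. app (tower_hom F (val w)) (x, k) = (x, k + j)" "\<bar>j\<bar> \<le> int (length w)"
      using Cons by auto
    have i: "i \<le> m" using Cons.prems a by (simp add: BS_gens_def)
    have step: "\<exists>d. (\<forall>x k. app (if b then F i else - F i) (x, k) = (x, k + d)) \<and> \<bar>d\<bar> \<le> 1"
      using i F(2)[of i] F(3)
      by (intro exI[of _ "if i = m then if b then 1 else - 1 else 0"])
        (auto simp: app_minus_eq_iff le_less)
    then obtain d where d: "\<forall>x k. app (if b then F i else - F i) (x, k) = (x, k + d)" "\<bar>d\<bar> \<le> 1"
      by blast
    have "tower_hom F (val (a # w)) = (if b then F i else - F i) + tower_hom F (val w)"
      by (simp add: a tower_hom_val F)
    then show ?case using d j
      by (intro exI[of _ "d + j"]) (simp add: algebra_simps)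
  qed
  have act': "app (tower_hom F g) (x, k) = (x, k + e g)" and bound: "\<bar>e g\<bar> \<le> int (len m g)"
    if g: "g \<in> H m" for g x k
  proof -
    obtain w where w: "w \<in> words (BS_gens m)" "val w = g" "length w = len m g"
      using len_attained[OF g] .
    then show "app (tower_hom F g) (x, k) = (x, k + e g)" "\<bar>e g\<bar> \<le> int (len m g)"
      using act[OF w(1)] by (auto simp: e_def)
  qed
  have "e (g + h) = e g + e h" if "g \<in> H m" "h \<in> H m" for g h
    using act'[OF that(1)] act'[OF that(2)] unfolding e_def[of "g + h"]
    by (simp add: tower_hom_add F)
  moreover have "e (gen m) = 1"
    by (simp add: e_def tower_hom_gen F)
  ultimately show ?thesis using bound by blast
qed

definition exponent_sum :: "nat \<Rightarrow> tower \<Rightarrow> int" where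
  "exponent_sum m = (SOME e. (\<forall>g\<in>H m. \<forall>h\<in>H m. e (g + h) = e g + e h) \<and> e (gen m) = 1 \<and>
     (\<forall>g\<in>H m. \<bar>e g\<bar> \<le> int (len m g)))"

lemma
  shows exponent_sum_add: "g \<in> H m \<Longrightarrow> h \<in> H m \<Longrightarrow>
      exponent_sum m (g + h) = exponent_sum m g + exponent_sum m h"
    and exponent_sum_gen: "exponent_sum m (gen m) = 1"
    and exponent_sum_le: "g \<in> H m \<Longrightarrow> \<bar>exponent_sum m g\<bar> \<le> int (len m g)"
  using someI_ex[OF exponent_sum_exists[of m]] unfolding exponent_sum_def[symmetric] by blast+

lemma exponent_sum_0 [simp]: "exponent_sum m 0 = 0"
  using exponent_sum_add[of 0 m 0] by simp

lemma exponent_sum_uminus: "g \<in> H m \<Longrightarrow> exponent_sum m (- g) = - exponent_sum m g"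
  using exponent_sum_add[of "- g" m g] by simp

lemma exponent_sum_zpow [simp]: "exponent_sum m (zpow (gen m) k) = k"
proof (induction k rule: int_induct[where k = 0])
  case (step1 i)
  then show ?case by (simp add: zpow_add_1 exponent_sum_add exponent_sum_gen)
next
  case (step2 i)
  then show ?case by (simp add: zpow_diff_1 exponent_sum_add exponent_sum_uminus exponent_sum_gen)
qed simp

lemma zpow_gen_eq_iff [simp]: "zpow (gen m) j = zpow (gen m) k \<longleftrightarrow> j = k"
  by (metis exponent_sum_zpow)

lemma zpow_gen_eq_0_iff [simp]: "zpow (gen m) j = 0 \<longleftrightarrow> j = 0"
  using zpow_gen_eq_iff[of m j 0] by (simp del: zpow_gen_eq_iff)

subsection \<open>The presented groups are subgroups of the infinite tower\<close>

abbreviation (input) "BS_class m \<equiv> word_class (BS_gens m) (BS_rels m)"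
abbreviation (input) "BS_CL m \<equiv> CL (BS_gens m) (BS_rels m)"

lemma pres_rel_mono:
  assumes "(u, v) \<in> pres_rel S R" "S \<subseteq> S'" "R \<subseteq> R'"
  shows "(u, v) \<in> pres_rel S' R'"
proof -
  have words: "w \<in> words S'" if "w \<in> words S" for w
    using that assms(2) by (fastforce simp: words_def)
  show ?thesis
    using assms(1)
  proof (induction rule: pres_rel.induct)
    case (refl w)
    then show ?case by (simp add: words pres_rel.refl)
  next
    case (sym v w)
    then show ?case by (blast intro: pres_rel.sym)
  next
    case (trans u v w)
    then show ?case by (blast intro: pres_rel.trans)
  next
    case (cancel u v s b)
    then show ?case using assms(2) by (intro pres_rel.cancel words) auto
  next
    case (rel u v l r)
    then show ?case using assms(3) by (intro pres_rel.rel words) auto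
  qed
qed

lemma BS_rels_subset: "BS_rels m \<subseteq> tower_rels"
proof
  fix x
  assume "x \<in> BS_rels m"
  then obtain i where "x = ([(i, True), (i - 1, True), (i, False)], [(i - 1, True), (i - 1, True)])"
    "i \<in> {1..m}"
    by (auto simp: BS_rels_def)
  then show "x \<in> tower_rels"
    unfolding tower_rels_def by (auto intro!: exI[of _ "i - 1"])
qed

text \<open>The presented group acts on its own elements, each represented by a canonical word, by
  left multiplication. Extended to the tower, this action shows that words with equal values move
  the canonical form of the empty word to the same place.\<close>

lemma val_eq_imp_pres_rel:
  assumes "u \<in> words (BS_gens m)" "v \<in> words (BS_gens m)" "val u = val v"
  shows "(u, v) \<in> pres_rel (BS_gens m) (BS_rels m)"
proof -
  let ?W = "words (BS_gens m)"
  define eq where "eq u v \<longleftrightarrow> (u, v) \<in> pres_rel (BS_gens m) (BS_rels m)" for u v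
  have eq_refl: "eq w w" if "w \<in> ?W" for w
    using that by (simp add: eq_def pres_rel.refl)
  have eq_sym: "eq w w'" if "eq w' w" for w w'
    using that by (simp add: eq_def pres_rel.sym)
  have eq_trans: "eq w w''" if "eq w w'" "eq w' w''" for w w' w''
    using that unfolding eq_def by (rule pres_rel.trans)
  define can where "can w = (SOME w'. eq w w')" for w
  have can: "eq w (can w)" if "w \<in> ?W" for w
    unfolding can_def using eq_refl[OF that] by (rule someI)
  have can_words: "can w \<in> ?W" if "w \<in> ?W" for w
    using can[OF that] pres_rel_words by (auto simp: eq_def)
  have can_eqI: "can w = can w'" if "eq w w'" for w w'
  proof -
    have "eq w = eq w'" using eq_trans[OF that] eq_trans[OF eq_sym[OF that]] by blast
    then show ?thesis by (simp add: can_def)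
  qed
  have can_eqD: "eq w w'" if "can w = can w'" "w \<in> ?W" "w' \<in> ?W" for w w'
    using eq_trans[OF can[OF that(2)] eq_sym[OF can[OF that(3), folded that(1)]]] .
  have can_can: "can (can w) = can w" if "w \<in> ?W" for w
    using can_eqI[OF eq_sym[OF can[OF that]]] .
  \<comment> \<open>Words that are not canonical stay fixed, so that \<open>act\<close> is a
    bijection of the whole type of words.\<close>
  define act where "act a w = (if w \<in> can ` ?W then can (a # w) else w)" for a w
  have act_can: "act a (can w) = can (a # w)" if "fst a \<in> BS_gens m" "w \<in> ?W" for a w
  proof -
    have "eq ([a] @ can w) ([a] @ w)"
      unfolding eq_def
      by (rule pres_rel_append) (use that eq_sym[OF can[OF that(2)]] in \<open>auto simp: eq_def intro: pres_rel.refl\<close>)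
    then show ?thesis using that by (auto simp: act_def intro: can_eqI)
  qed
  have cancel: "act (i, b) (act (i, \<not> b) w) = w" if "i \<in> BS_gens m" for i b w
  proof (cases "w \<in> can ` ?W")
    case True
    then obtain w' where w': "w = can w'" "w' \<in> ?W" by auto
    have "eq ([] @ [(i, b), (i, \<not> b)] @ w') ([] @ w')"
      unfolding eq_def using that w' by (intro pres_rel.cancel) auto
    then have "can ((i, b) # (i, \<not> b) # w') = can w'"
      by (auto intro: can_eqI)
    then show ?thesis
      using that w' by (simp add: act_can)
  qed (simp add: act_def)
  define f where "f i = Bijection (act (i, True))" for i
  have f: "app (f i) = act (i, True)" "app (- f i) = act (i, False)" if "i \<le> m" for i
  proof -
    have i: "i \<in> BS_gens m" using that by (simp add: BS_gens_def)
    show 1: "app (f i) = act (i, True)"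
      unfolding f_def using cancel[OF i, of True] cancel[OF i, of False]
      by (intro app_Bijection bijI_inverse[of "act (i, False)"]) auto
    show "app (- f i) = act (i, False)"
      using cancel[OF i, of True] by (auto simp: app_minus_eq_iff 1)
  qed
  have rel: "f (Suc i) + f i = f i + f i + f (Suc i)" if "i < m" for i
  proof (rule bijection_eqI)
    fix w
    show "app (f (Suc i) + f i) w = app (f i + f i + f (Suc i)) w"
    proof (cases "w \<in> can ` ?W")
      case True
      then obtain w' where w': "w = can w'" "w' \<in> ?W" by auto
      have i: "i \<in> BS_gens m" "Suc i \<in> BS_gens m" using that by (auto simp: BS_gens_def)
      have 1: "eq ([(Suc i, True), (i, True)] @ [(Suc i, False), (Suc i, True)] @ w')
          ([(Suc i, True), (i, True)] @ w')"
        using pres_rel.cancel[of "[(Suc i, True), (i, True)]" "BS_gens m" w' "Suc i" False] i w'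
        by (simp add: eq_def)
      have "([(Suc i, True), (i, True), (Suc i, False)], [(i, True), (i, True)]) \<in> BS_rels m"
        unfolding BS_rels_def using that by (intro CollectI exI[of _ "Suc i"]) auto
      then have 2: "eq ([] @ [(Suc i, True), (i, True), (Suc i, False)] @ ((Suc i, True) # w'))
          ([] @ [(i, True), (i, True)] @ ((Suc i, True) # w'))"
        unfolding eq_def using i w' by (intro pres_rel.rel) auto
      have "eq ([(Suc i, True), (i, True)] @ w') ([(i, True), (i, True), (Suc i, True)] @ w')"
        using eq_trans[OF eq_sym[OF 1]] 2 by simp
      then have "can ((Suc i, True) # (i, True) # w') = can ((i, True) # (i, True) # (Suc i, True) # w')"
        by (auto intro: can_eqI)
      then show ?thesis
        using that i w' by (simp add: f act_can)
    next
      case False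
      then show ?thesis using that by (simp add: f act_def)
    qed
  qed
  obtain F :: "nat \<Rightarrow> (nat word \<times> int) bijection" where F: "tower_family F"
    "\<And>i x k. i < m \<Longrightarrow> app (F i) (x, k) = (app (f i) x, k)"
    "\<And>x k. app (F m) (x, k) = (app (f m) x, k + 1)"
    using tower_family_extension[of m f, OF infinite_UNIV_listI rel] by blast
  have F': "fst (app (F i) p) = act (i, True) (fst p)" "fst (app (- F i) p) = act (i, False) (fst p)"
    if "i \<le> m" for i p
  proof -
    have i: "i \<in> BS_gens m" using that by (simp add: BS_gens_def)
    show 1: "fst (app (F i) p) = act (i, True) (fst p)" for p
      using that F(2)[of i "fst p" "snd p"] F(3)[of "fst p" "snd p"] by (auto simp: f le_less)
    show "fst (app (- F i) p) = act (i, False) (fst p)"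
      using 1[of "app (- F i) p"] cancel[OF i, of False "fst (app (- F i) p)"] by simp
  qed
  have "fst (app (tower_hom F (val w)) (can [], 0)) = can w" if "w \<in> ?W" for w
    using that
  proof (induction w)
    case Nil
    then show ?case by (simp add: val_Nil tower_hom_0 F)
  next
    case (Cons a w)
    obtain i b where a: "a = (i, b)" by (cases a)
    then have "i \<le> m" using Cons.prems by (simp add: BS_gens_def)
    then show ?case
      using Cons a F'[of i] by (cases b) (simp_all add: tower_hom_val F act_can)
  qed
  then have "can u = can v"
    using assms by metis
  then show ?thesis
    using can_eqD assms by (simp add: eq_def)
qed

lemma pres_rel_BS_iff:
  "(u, v) \<in> pres_rel (BS_gens m) (BS_rels m) \<longleftrightarrow>
    u \<in> words (BS_gens m) \<and> v \<in> words (BS_gens m) \<and> val u = val v"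
proof
  assume *: "(u, v) \<in> pres_rel (BS_gens m) (BS_rels m)"
  show "u \<in> words (BS_gens m) \<and> v \<in> words (BS_gens m) \<and> val u = val v"
    using pres_rel_words[OF *] pres_rel_mono[OF * subset_UNIV BS_rels_subset]
    by (simp add: val_eq_iff)
qed (blast intro: val_eq_imp_pres_rel)

lemma word_length_BS:
  "w \<in> words (BS_gens m) \<Longrightarrow> word_length (BS_class m w) = len m (val w)"
  unfolding word_length_def len_def
  by (intro arg_cong[where f = Least] ext) (auto simp: word_class_def pres_rel_BS_iff)

lemma conjugates_BS_iff:
  assumes "u \<in> words (BS_gens m)" "v \<in> words (BS_gens m)"
  shows "conjugates (BS_gens m) (BS_rels m) u v \<gamma> \<longleftrightarrow>
    (\<exists>c\<in>words (BS_gens m). \<gamma> = BS_class m c \<and> val c + val u = val v + val c)"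
proof -
  let ?G = "presented_group (BS_gens m) (BS_rels m)"
  let ?cl = "BS_class m"
  interpret group ?G by (rule group_presented_group)
  have cl: "?cl w \<in> carrier ?G" if "w \<in> words (BS_gens m)" for w
    using that by (auto simp: carrier_presented_group)
  have "?cl c \<otimes>\<^bsub>?G\<^esub> ?cl u \<otimes>\<^bsub>?G\<^esub> inv\<^bsub>?G\<^esub> ?cl c = ?cl v \<longleftrightarrow> val c + val u = val v + val c"
    if "c \<in> words (BS_gens m)" for c
  proof -
    have "?cl c \<otimes>\<^bsub>?G\<^esub> ?cl u \<otimes>\<^bsub>?G\<^esub> inv\<^bsub>?G\<^esub> ?cl c = ?cl v \<longleftrightarrow>
        ?cl c \<otimes>\<^bsub>?G\<^esub> ?cl u = ?cl v \<otimes>\<^bsub>?G\<^esub> ?cl c"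
      using cl[OF that] cl[OF assms(1)] cl[OF assms(2)]
      by (metis inv_closed inv_solve_right m_closed)
    also have "\<dots> \<longleftrightarrow> val c + val u = val v + val c"
      using that assms by (simp add: mult_presented_group word_class_eq_iff pres_rel_BS_iff val_append)
    finally show ?thesis .
  qed
  then show ?thesis
    unfolding conjugates_def by (auto simp: carrier_presented_group)
qed

lemma conj_dist_BS:
  assumes "u \<in> words (BS_gens m)" "v \<in> words (BS_gens m)"
  shows "conj_dist (BS_gens m) (BS_rels m) u v =
    (LEAST k. \<exists>c\<in>H m. c + val u = val v + c \<and> len m c = k)"
  unfolding conj_dist_def
  by (intro arg_cong[where f = Least] ext)
    (auto simp: conjugates_BS_iff[OF assms] H_def word_length_BS)

lemma conj_pairs_BS:
  "(u, v) \<in> conj_pairs (BS_gens m) (BS_rels m) \<longleftrightarrow>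
    u \<in> words (BS_gens m) \<and> v \<in> words (BS_gens m) \<and> (\<exists>c\<in>H m. c + val u = val v + c)"
proof (cases "u \<in> words (BS_gens m) \<and> v \<in> words (BS_gens m)")
  case True
  then have "(\<exists>\<gamma>. conjugates (BS_gens m) (BS_rels m) u v \<gamma>) \<longleftrightarrow> (\<exists>c\<in>H m. c + val u = val v + c)"
    using conjugates_BS_iff[of u m v] by (auto simp: H_def)
  then show ?thesis by (auto simp: conj_pairs_def)
qed (auto simp: conj_pairs_def)

lemma CL_BS_le:
  assumes "\<And>g h c. g \<in> H m \<Longrightarrow> h \<in> H m \<Longrightarrow> c \<in> H m \<Longrightarrow> c + g = h + c \<Longrightarrow>
    len m g + len m h \<le> n \<Longrightarrow> \<exists>c'\<in>H m. c' + g = h + c' \<and> len m c' \<le> K"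
  shows "BS_CL m n \<le> K"
  unfolding CL_def
proof (rule Max.boundedI[OF CL_set_finite CL_set_nonempty])
  show "finite (BS_gens m)" by (simp add: BS_gens_def)
next
  fix x
  assume "x \<in> {conj_dist (BS_gens m) (BS_rels m) u v |u v. (u, v) \<in> conj_pairs (BS_gens m) (BS_rels m) \<and>
    word_length (BS_class m u) +
    word_length (BS_class m v) \<le> n}"
  then obtain u v c where uv: "u \<in> words (BS_gens m)" "v \<in> words (BS_gens m)" "c \<in> H m"
    "c + val u = val v + c" "len m (val u) + len m (val v) \<le> n"
    "x = conj_dist (BS_gens m) (BS_rels m) u v"
    by (auto simp: conj_pairs_BS word_length_BS)
  then obtain c' where c': "c' \<in> H m" "c' + val u = val v + c'" "len m c' \<le> K"
    using assms[of "val u" "val v" c] by (auto simp: H_def)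
  have "x \<le> len m c'"
    unfolding uv(6) conj_dist_BS[OF uv(1,2)] using c' by (intro Least_le) blast
  then show "x \<le> K" using c' by simp
qed

lemma CL_BS_ge:
  assumes "g \<in> H m" "h \<in> H m" "c \<in> H m" "c + g = h + c" "len m g + len m h \<le> n"
    and "\<And>c. c \<in> H m \<Longrightarrow> c + g = h + c \<Longrightarrow> K \<le> len m c"
  shows "K \<le> BS_CL m n"
proof -
  obtain u v where uv: "u \<in> words (BS_gens m)" "v \<in> words (BS_gens m)" "g = val u" "h = val v"
    using assms(1,2) by (auto simp: H_def)
  let ?P = "\<lambda>k. \<exists>c\<in>H m. c + val u = val v + c \<and> len m c = k"
  have "\<exists>k. ?P k"
    using assms(3,4) uv by blast
  then have "?P (Least ?P)"
    by (rule LeastI_ex)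
  then have "K \<le> conj_dist (BS_gens m) (BS_rels m) u v"
    unfolding conj_dist_BS[OF uv(1,2)] using assms(6) uv by metis
  also have "\<dots> \<le> BS_CL m n"
    unfolding CL_def
  proof (rule Max_ge[OF CL_set_finite])
    show "finite (BS_gens m)" by (simp add: BS_gens_def)
    have "(u, v) \<in> conj_pairs (BS_gens m) (BS_rels m)"
      using assms uv by (auto simp: conj_pairs_BS)
    moreover have "word_length (BS_class m u) +
        word_length (BS_class m v) \<le> n"
      using assms uv by (simp add: word_length_BS)
    ultimately show "conj_dist (BS_gens m) (BS_rels m) u v \<in> {conj_dist (BS_gens m) (BS_rels m) u v |u v.
      (u, v) \<in> conj_pairs (BS_gens m) (BS_rels m) \<and> word_length (BS_class m u) +
      word_length (BS_class m v) \<le> n}"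
      by blast
  qed
  finally show ?thesis .
qed

section \<open>Normal forms in an HNN extension\<close>

text \<open>Required by \<open>tower_family_extension\<close> for the action on normal forms, whose
  type contains \<open>tower\<close>.\<close>

instance tower :: countable
proof
  show "\<exists>f :: tower \<Rightarrow> nat. inj f"
    by (rule exI[of _ "to_nat \<circ> repw"], intro inj_compose) (auto intro: inj_on_inverseI[of _ val])
qed

type_synonym syllables = "(tower \<times> bool) list"

text \<open>The comments in this locale write t for the stable letter \<open>gen (Suc m)\<close> and
  s for \<open>gen m\<close>, so that t s = s^2 t. The associated subgroups of the HNN extension
  \<open>H (Suc m)\<close> of \<open>H m\<close> are generated by s and s^2.\<close>

locale hnn_level =
  fixes m :: nat
begin

definition stable :: "bool \<Rightarrow> tower" where
  "stable e = (if e then gen (Suc m) else - gen (Suc m))"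

fun ev :: "syllables \<Rightarrow> tower" where
  "ev [] = 0"
| "ev ((b, e) # ws) = b + stable e + ev ws"

text \<open>The base elements that pass through \<open>stable e\<close> from left to right, coming
  out as their \<open>carry e\<close> (\<open>edge_stable\<close>): s^(2k) t = t s^k and s^k t^-1 =
  t^-1 s^(2k). On \<open>edge True\<close> the division in \<open>carry\<close> is exact.\<close>

definition edge :: "bool \<Rightarrow> tower set" where
  "edge e = {zpow (gen m) k | k. e \<longrightarrow> even k}"

definition carry :: "bool \<Rightarrow> tower \<Rightarrow> tower" where
  "carry e p = zpow (gen m) (if e then exponent_sum m p div 2 else 2 * exponent_sum m p)"

text \<open>Excludes a pinch, that is, opposite stable letters around an element of the edge group;
  \<open>pinch\<close> evaluates it in the base. The element between the two letters is the one
  stored in the second syllable.\<close>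

definition admissible :: "tower \<times> bool \<Rightarrow> tower \<times> bool \<Rightarrow> bool" where
  "admissible x y \<longleftrightarrow> \<not> (snd x \<noteq> snd y \<and> fst y \<in> edge (snd y))"

definition reduced :: "syllables \<Rightarrow> bool" where
  "reduced ws \<longleftrightarrow> successively admissible ws"

definition base :: "syllables \<Rightarrow> bool" where
  "base ws \<longleftrightarrow> fst ` set ws \<subseteq> H m"

lemma stable_Not: "stable (\<not> e) = - stable e"
  by (simp add: stable_def)

lemma stable_mem [simp]: "stable e \<in> H (Suc m)"
  by (simp add: stable_def)

lemma edge_mem: "p \<in> edge e \<Longrightarrow> p \<in> H m"
  by (auto simp: edge_def)

lemma edge_0 [simp]: "0 \<in> edge e"
  unfolding edge_def by (auto intro!: exI[of _ 0])

lemma edge_add [intro]: "p \<in> edge e \<Longrightarrow> q \<in> edge e \<Longrightarrow> p + q \<in> edge e"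
  unfolding edge_def by (auto simp flip: zpow_add)

lemma edge_uminus [simp]: "- p \<in> edge e \<longleftrightarrow> p \<in> edge e"
proof -
  have "- p \<in> edge e" if "p \<in> edge e" for p
    using that unfolding edge_def by (auto simp flip: zpow_minus)
  from this[of p] this[of "- p"] show ?thesis by auto
qed

lemma edge_add_left_iff: "p \<in> edge e \<Longrightarrow> p + q \<in> edge e \<longleftrightarrow> q \<in> edge e"
  using edge_add[of "- p" e "p + q"] by (auto simp flip: add.assoc)

lemma edge_False_iff: "p \<in> edge False \<longleftrightarrow> (\<exists>k. p = zpow (gen m) k)"
  by (auto simp: edge_def)

lemma zpow_mem_edge: "zpow (gen m) k \<in> edge e \<longleftrightarrow> (e \<longrightarrow> even k)"
  by (auto simp: edge_def)

lemma carry_zpow: "carry e (zpow (gen m) k) = zpow (gen m) (if e then k div 2 else 2 * k)"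
  by (simp add: carry_def)

lemma carry_mem: "carry e p \<in> edge (\<not> e)"
  by (auto simp: carry_def zpow_mem_edge)

lemma carry_0 [simp]: "carry e 0 = 0"
  using carry_zpow[of e 0] by simp

lemma carry_add:
  assumes "p \<in> edge e" "q \<in> edge e"
  shows "carry e (p + q) = carry e p + carry e q"
proof -
  obtain j k where "p = zpow (gen m) j" "q = zpow (gen m) k" "e \<longrightarrow> even j" "e \<longrightarrow> even k"
    using assms by (auto simp: edge_def)
  then show ?thesis
    by (auto simp: carry_zpow algebra_simps simp flip: zpow_add)
qed

lemma edge_stable:
  assumes "p \<in> edge e"
  shows "p + stable e = stable e + carry e p"
proof -
  obtain k where k: "p = zpow (gen m) k" "e \<longrightarrow> even k"
    using assms by (auto simp: edge_def)
  show ?thesis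
  proof (cases e)
    case True
    then show ?thesis
      using k conj_zpow_double[OF gen_rel, of m "k div 2"] by (simp add: carry_zpow stable_def)
  next
    case False
    have "gen (Suc m) + zpow (gen m) k = zpow (gen m) (2 * k) + gen (Suc m)"
      by (rule conj_zpow_double[OF gen_rel])
    then have "zpow (gen m) k = - gen (Suc m) + (zpow (gen m) (2 * k) + gen (Suc m))"
      by (metis add.assoc add_0 left_minus)
    then have "zpow (gen m) k + - gen (Suc m) = - gen (Suc m) + zpow (gen m) (2 * k)"
      by (simp only: add.assoc right_minus add_0_right)
    then show ?thesis
      using k False by (simp add: carry_zpow stable_def)
  qed
qed

section \<open>Coset representatives and the action of the base on normal forms\<close>

definition rep :: "bool \<Rightarrow> tower \<Rightarrow> tower" where
  "rep e b = (if b \<in> edge e then 0 else (SOME r. - r + b \<in> edge e))"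

lemma rep_coset: "- rep e b + b \<in> edge e"
proof (cases "b \<in> edge e")
  case False
  have "- b + b \<in> edge e" by simp
  then have "- (SOME r. - r + b \<in> edge e) + b \<in> edge e" by (rule someI)
  then show ?thesis using False by (simp add: rep_def)
qed (simp add: rep_def)

lemma rep_eqI:
  assumes "- a + b \<in> edge e"
  shows "rep e a = rep e b"
proof -
  have *: "r + b \<in> edge e" if "r + a \<in> edge e" "- a + b \<in> edge e" for r a b
  proof -
    have "r + a + (- a + b) \<in> edge e" using that by (rule edge_add)
    then show ?thesis by (simp add: add.assoc minus_add_cancel add_minus_cancel)
  qed
  have "- b + a \<in> edge e"
    using assms edge_uminus[of "- a + b" e] by (simp add: minus_add)
  then have eq: "r + a \<in> edge e \<longleftrightarrow> r + b \<in> edge e" for r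
    using *[of r a b] *[of r b a] assms by blast
  show ?thesis
    using eq[of 0] eq by (simp add: rep_def)
qed

lemma rep_rep [simp]: "rep e (rep e b) = rep e b"
  by (rule rep_eqI[OF rep_coset])

lemma rep_eq_0_iff: "rep e b = 0 \<longleftrightarrow> b \<in> edge e"
  using rep_coset[of e b] by (auto simp: rep_def)

text \<open>Left multiplication by \<open>g\<close>: the representative of the first coset stays,
  the rest is carried through the stable letter, and what emerges behind the last letter is
  returned. As \<open>rep\<close> is 0 on the edge group, a pinch in a normal form shows as a base
  element 0.\<close>

fun push :: "tower \<Rightarrow> syllables \<Rightarrow> syllables \<times> tower" where
  "push g [] = ([], g)"
| "push g ((r, e) # l) =
    (let r' = rep e (g + r); (l', g') = push (carry e (- r' + (g + r))) l in ((r', e) # l', g'))"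

definition normal :: "syllables \<Rightarrow> bool" where
  "normal l \<longleftrightarrow> (\<forall>(r, e)\<in>set l. rep e r = r) \<and> successively (\<lambda>x y. \<not> (snd x \<noteq> snd y \<and> fst y = 0)) l"

lemma push_add:
  "fst (push (g + h) l) = fst (push g (fst (push h l))) \<and>
   snd (push (g + h) l) = snd (push g (fst (push h l))) + snd (push h l)"
proof (induction l arbitrary: g h)
  case (Cons x l)
  obtain r e where x: "x = (r, e)" by (cases x)
  define r1 where "r1 = rep e (h + r)"
  define p1 where "p1 = - r1 + (h + r)"
  have p1: "p1 \<in> edge e"
    unfolding p1_def r1_def by (rule rep_coset)
  define r2 where "r2 = rep e (g + r1)"
  define p2 where "p2 = - r2 + (g + r1)"
  have p2: "p2 \<in> edge e"
    unfolding p2_def r2_def by (rule rep_coset)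
  have "- (g + r1) + (g + h + r) = p1"
    by (simp only: p1_def minus_add add.assoc minus_add_cancel)
  then have "rep e (g + h + r) = r2"
    using rep_eqI[of "g + r1" "g + h + r" e] p1 r2_def by simp
  moreover have "- r2 + (g + h + r) = p2 + p1"
    by (simp add: p1_def p2_def add.assoc)
  ultimately show ?case
    using Cons.IH[of "carry e p2" "carry e p1"] p1 p2
    by (simp add: x Let_def case_prod_unfold carry_add flip: r1_def p1_def r2_def p2_def)
qed simp

lemma push_0: "normal l \<Longrightarrow> push 0 l = (l, 0)"
proof (induction l)
  case (Cons x l)
  then have "normal l"
    by (cases l) (auto simp: normal_def)
  then show ?case
    using Cons by (cases x) (auto simp: normal_def)
qed simp

lemma map_snd_push: "map snd (fst (push g l)) = map snd l"
proof (induction l arbitrary: g)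
  case (Cons x l)
  then show ?case by (cases x) (simp add: Let_def case_prod_unfold)
qed simp

lemma normal_push: "normal l \<Longrightarrow> normal (fst (push g l))"
proof (induction l arbitrary: g)
  case (Cons x l)
  obtain r e where x: "x = (r, e)" by (cases x)
  define r1 where "r1 = rep e (g + r)"
  define p1 where "p1 = carry e (- r1 + (g + r))"
  have push_x: "fst (push g (x # l)) = (r1, e) # fst (push p1 l)"
    by (simp add: x Let_def case_prod_unfold r1_def p1_def)
  show ?case
  proof (cases l)
    case Nil
    then show ?thesis unfolding push_x by (simp add: normal_def r1_def)
  next
    case (Cons y l')
    obtain r2 e2 where y: "y = (r2, e2)" by (cases y)
    have "normal l" using Cons.prems Cons by (auto simp: normal_def)
    then have IH: "normal (fst (push p1 l))" by (rule Cons.IH)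
    obtain l2 where l2: "fst (push p1 l) = (rep e2 (p1 + r2), e2) # l2"
      by (simp add: Cons y Let_def case_prod_unfold)
    \<comment> \<open>What is carried through \<open>stable e\<close> lies in
      \<open>edge (\<not> e)\<close>. In front of a letter of opposite sign it therefore cannot move
      a base element into or out of the edge group, and pushing creates no pinch.\<close>
    have "e2 = e" if "p1 + r2 \<in> edge e2"
    proof (rule ccontr)
      assume "e2 \<noteq> e"
      then have "p1 \<in> edge e2"
        unfolding p1_def using carry_mem[of e] by (cases e; cases e2) auto
      then have "rep e2 r2 = 0"
        using that by (simp add: edge_add_left_iff rep_eq_0_iff)
      then show False
        using Cons.prems \<open>e2 \<noteq> e\<close> by (auto simp: normal_def Cons x y)
    qed
    then show ?thesis
      using IH unfolding push_x l2 by (auto simp: normal_def r1_def rep_eq_0_iff)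
  qed
qed (simp add: normal_def)

text \<open>The second component is the base element behind the last stable letter. Lists that are
  not normal stay fixed, so that the map is a bijection of the whole type.\<close>

definition act :: "tower \<Rightarrow> syllables \<times> tower \<Rightarrow> syllables \<times> tower" where
  "act g x = (if normal (fst x) then (fst (push g (fst x)), snd (push g (fst x)) + snd x) else x)"

lemma act_add: "act (g + h) x = act g (act h x)"
  by (auto simp: act_def normal_push push_add add.assoc)

lemma act_0: "act 0 x = x"
  by (simp add: act_def push_0)

lemma act_act_uminus: "act g (act (- g) x) = x"
  by (simp add: act_0 flip: act_add)

lemma act_uminus_act: "act (- g) (act g x) = x"
  by (simp add: act_0 flip: act_add)

text \<open>Left multiplication by \<open>stable e\<close>: the letter cancels an opposite first
  letter preceded by 0 and is otherwise put in front.\<close>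

fun toggle_list :: "bool \<Rightarrow> syllables \<Rightarrow> syllables" where
  "toggle_list e [] = [(0, e)]"
| "toggle_list e ((r, e') # l) = (if e' \<noteq> e \<and> r = 0 then l else (0, e) # (r, e') # l)"

lemma normal_ConsD: "normal (x # l) \<Longrightarrow> normal l"
  by (cases l) (auto simp: normal_def)

lemma normal_toggle_list: "normal l \<Longrightarrow> normal (toggle_list e l)"
  by (cases "(e, l)" rule: toggle_list.cases)
    (auto simp: normal_def rep_eq_0_iff successively_Cons)

lemma toggle_list_toggle_list: "normal l \<Longrightarrow> toggle_list e (toggle_list (\<not> e) l) = l"
proof (cases l)
  case (Cons x l')
  obtain r e' where x: "x = (r, e')" by (cases x)
  assume "normal l"
  then show ?thesis
    unfolding Cons x by (cases l') (auto simp: normal_def)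
qed simp

definition toggle :: "bool \<Rightarrow> syllables \<times> tower \<Rightarrow> syllables \<times> tower" where
  "toggle e x = (if normal (fst x) then (toggle_list e (fst x), snd x) else x)"

lemma toggle_toggle: "toggle e (toggle (\<not> e) x) = x"
  by (simp add: toggle_def normal_toggle_list toggle_list_toggle_list)

text \<open>The relation between stable letter and base, as an identity of bijections. An element of
  \<open>edge False\<close> neither creates nor destroys the leading t^-1 with base element 0 on
  which \<open>toggle_list\<close> branches.\<close>

lemma toggle_act:
  assumes "p \<in> edge True"
  shows "act p (toggle True x) = toggle True (act (carry True p) x)"
proof (cases "normal (fst x)")
  case True
  let ?q = "carry True p"
  have q: "?q \<in> edge False" using carry_mem[of True p] by simp
  have carry_q: "carry False ?q = p"
    using assms by (auto simp: edge_def carry_zpow)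
  obtain l b where x: "x = (l, b)" by (cases x)
  show ?thesis
  proof (cases "\<exists>l'. l = (0, False) # l'")
    case True
    then obtain l' where l: "l = (0, False) # l'" by blast
    have "rep False ?q = 0" using q by (simp add: rep_eq_0_iff)
    moreover have "normal l'"
      using \<open>normal (fst x)\<close> x l normal_ConsD by auto
    ultimately show ?thesis
      using \<open>normal (fst x)\<close> normal_push[of l "?q"]
      by (simp add: x l act_def toggle_def Let_def case_prod_unfold carry_q)
  next
    case False
    then have tl: "toggle_list True l = (0, True) # l"
      by (cases "(True, l)" rule: toggle_list.cases) auto
    have "toggle_list True (fst (push ?q l)) = (0, True) # fst (push ?q l)"
    proof (cases l)
      case (Cons y l')
      obtain r e where y: "y = (r, e)" by (cases y)
      have "rep False (?q + r) \<noteq> 0" if "\<not> e"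
      proof
        assume "rep False (?q + r) = 0"
        then have "rep False r = 0"
          using q by (simp add: rep_eq_0_iff edge_add_left_iff)
        then show False
          using \<open>normal (fst x)\<close> False that by (auto simp: x Cons y normal_def)
      qed
      then show ?thesis by (auto simp: Cons y Let_def case_prod_unfold)
    qed simp
    moreover have "normal ((0, True) # l)" "normal ((0, True) # fst (push ?q l))"
      using normal_toggle_list[of l True] normal_toggle_list[OF normal_push[of l ?q], of True]
        \<open>normal (fst x)\<close> tl calculation x by auto
    moreover have "rep True p = 0" using assms by (simp add: rep_eq_0_iff)
    ultimately show ?thesis
      using \<open>normal (fst x)\<close>
      by (simp add: x act_def toggle_def tl normal_push Let_def case_prod_unfold)
  qed
qed (auto simp: act_def toggle_def)

text \<open>Britton's lemma, in the form that equal elements have reduced forms with the same exponents: act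
  on the empty normal form.\<close>

theorem reduced_unique_exponents:
  assumes "reduced us" "base us" "b \<in> H m" "reduced vs" "base vs" "c \<in> H m"
    and "ev us + b = ev vs + c"
  shows "map snd us = map snd vs"
proof -
  define f where "f i = Bijection (if i \<le> m then act (gen i) else toggle True)" for i
  have f_act: "app (f i) = act (gen i)" if "i \<le> m" for i
    unfolding f_def using that act_act_uminus act_uminus_act
    by (auto intro!: app_Bijection bijI_inverse[of "act (- gen i)"])
  have f_toggle: "app (f (Suc m)) = toggle True"
    unfolding f_def using toggle_toggle[of True] toggle_toggle[of False]
    by (auto intro!: app_Bijection bijI_inverse[of "toggle False"])
  have rel: "f (Suc i) + f i = f i + f i + f (Suc i)" if "i < Suc m" for i
  proof (rule bijection_eqI)
    fix x
    show "app (f (Suc i) + f i) x = app (f i + f i + f (Suc i)) x"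
    proof (cases "i = m")
      case True
      have "carry True (gen m + gen m) = gen m" "gen m + gen m \<in> edge True"
        using carry_zpow[of True 2] zpow_mem_edge[of 2 True] by (simp_all add: zpow_2)
      then show ?thesis
        using True toggle_act[of "gen m + gen m" x] by (simp add: f_act f_toggle act_add)
    next
      case False
      then show ?thesis
        using that gen_rel[of i] by (simp add: f_act flip: act_add add.assoc)
    qed
  qed
  have "infinite (UNIV :: (syllables \<times> tower) set)"
    by (simp add: finite_prod infinite_UNIV_listI)
  then obtain F :: "nat \<Rightarrow> ((syllables \<times> tower) \<times> int) bijection" where F: "tower_family F"
    "\<And>i x k. i < Suc m \<Longrightarrow> app (F i) (x, k) = (app (f i) x, k)"
    "\<And>x k. app (F (Suc m)) (x, k) = (app (f (Suc m)) x, k + 1)"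
    using tower_family_extension[of "Suc m" f, OF _ rel] by blast
  let ?h = "tower_hom F"
  have hom_base: "fst (app (?h g) p) = act g (fst p)" if g: "g \<in> H m" for g p
  proof -
    obtain w where w: "w \<in> words (BS_gens m)" "g = val w"
      using g by (auto simp: H_def)
    have "fst (app (?h (val w)) p) = act (val w) (fst p)" for p
      using w(1)
    proof (induction w)
      case Nil
      then show ?case by (simp add: val_Nil tower_hom_0 F act_0)
    next
      case (Cons a w)
      obtain i b where a: "a = (i, b)" by (cases a)
      then have i: "i \<le> m" using Cons.prems by (simp add: BS_gens_def)
      have pos: "fst (app (F i) q) = act (gen i) (fst q)" for q
        using i F(2)[of i "fst q" "snd q"] by (simp add: f_act)
      have neg: "fst (app (- F i) q) = act (- gen i) (fst q)" for q
        using pos[of "app (- F i) q"] by (simp add: act_uminus_act)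
      show ?case
        using Cons a by (simp add: val_Cons tower_hom_add tower_hom_uminus tower_hom_gen F pos neg act_add)
    qed
    then show ?thesis by (simp add: w)
  qed
  have hom_toggle: "fst (app (?h (stable e)) p) = toggle e (fst p)" for e p
  proof -
    have pos: "fst (app (?h (gen (Suc m))) p) = toggle True (fst p)" for p
      using F(3)[of "fst p" "snd p"] by (simp add: tower_hom_gen F f_toggle)
    have neg: "fst (app (- ?h (gen (Suc m))) p) = toggle False (fst p)"
      using pos[of "app (- ?h (gen (Suc m))) p"] toggle_toggle[of False "fst (app (- ?h (gen (Suc m))) p)"]
      by simp
    show ?thesis
      using pos neg by (cases e) (auto simp: stable_def tower_hom_uminus F)
  qed
  \<comment> \<open>The representative of the first base element belongs to the claim: through it,
    admissibility shows that the next stable letter does not cancel in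
    \<open>toggle_list\<close>.\<close>
  have main: "\<exists>l d. fst (app (?h (ev ws + b)) (([], 0), 0)) = (l, d) \<and> normal l \<and> map snd l = map snd ws \<and>
      (ws \<noteq> [] \<longrightarrow> fst (hd l) = rep (snd (hd ws)) (fst (hd ws)))"
    if "reduced ws" "base ws" "b \<in> H m" for ws b
    using that
  proof (induction ws)
    case Nil
    then show ?case by (auto simp: hom_base act_def normal_def)
  next
    case (Cons x ws)
    obtain g e where x: "x = (g, e)" by (cases x)
    have red: "reduced ws" "base ws"
      using Cons.prems by (cases ws; auto simp: reduced_def base_def)+
    then obtain l d where l: "fst (app (?h (ev ws + b)) (([], 0), 0)) = (l, d)" "normal l"
      "map snd l = map snd ws" "ws \<noteq> [] \<longrightarrow> fst (hd l) = rep (snd (hd ws)) (fst (hd ws))"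
      using Cons by blast
    have "toggle_list e l = (0, e) # l"
    proof (cases ws)
      case (Cons y ws')
      then obtain r l' where l': "l = (r, snd y) # l'"
        using l(3) by (cases l) auto
      then have r: "r = rep (snd y) (fst y)" using l(4) Cons by auto
      have "admissible x y"
        using Cons.prems(1) by (simp add: reduced_def Cons)
      then have "\<not> (snd y \<noteq> e \<and> r = 0)"
        by (auto simp: r x admissible_def rep_eq_0_iff)
      then show ?thesis by (simp add: l')
    qed (use l(3) in simp)
    then have T: "toggle e (l, d) = ((0, e) # l, d)" "normal ((0, e) # l)"
      using l(2) normal_toggle_list[of l e] by (auto simp: toggle_def)
    have "g \<in> H m" using Cons.prems(2) x by (simp add: base_def)
    then have "fst (app (?h (ev (x # ws) + b)) (([], 0), 0)) = act g ((0, e) # l, d)"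
      using T(1) l(1) by (simp add: x tower_hom_add F hom_base hom_toggle add.assoc)
    moreover have "fst (hd (fst (push g ((0, e) # l)))) = rep e g"
      by (simp add: Let_def case_prod_unfold)
    ultimately show ?case
      using T(2) l(3) normal_push[OF T(2), of g] map_snd_push[of g "(0, e) # l"]
      by (simp add: act_def x del: push.simps)
  qed
  show ?thesis
    using main[OF assms(1-3)] main[OF assms(4-6)] assms(7) by auto
qed

end

section \<open>Reduced forms and syllable length\<close>

context hnn_level
begin

lemma ev_append [simp]: "ev (us @ vs) = ev us + ev vs"
  by (induction us) (auto simp: add.assoc)

lemma base_simps [simp]:
  "base []" "base (x # ws) \<longleftrightarrow> fst x \<in> H m \<and> base ws" "base (us @ vs) \<longleftrightarrow> base us \<and> base vs"
  by (auto simp: base_def)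

lemma reduced_simps [simp]:
  "reduced []" "reduced [x]" "reduced (x # y # ws) \<longleftrightarrow> admissible x y \<and> reduced (y # ws)"
  by (auto simp: reduced_def)

lemma reduced_ConsD: "reduced (x # ws) \<Longrightarrow> reduced ws"
  by (cases ws) auto

lemma reduced_append_iff:
  "reduced (us @ vs) \<longleftrightarrow>
    reduced us \<and> reduced vs \<and> (us = [] \<or> vs = [] \<or> admissible (last us) (hd vs))"
  by (auto simp: reduced_def successively_append_iff)

lemma ev_mem [simp]: "base ws \<Longrightarrow> ev ws \<in> H (Suc m)"
  by (induction ws) auto

definition size_sum :: "syllables \<Rightarrow> nat" where
  "size_sum ws = sum_list (map (\<lambda>x. len m (fst x)) ws)"

lemma size_sum_simps [simp]:
  "size_sum [] = 0" "size_sum (x # ws) = len m (fst x) + size_sum ws"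
  "size_sum (us @ vs) = size_sum us + size_sum vs"
  by (simp_all add: size_sum_def)

lemma stable_add_stable_Not [simp]: "stable e + stable (\<not> e) = 0" "stable (\<not> e) + stable e = 0"
  by (simp_all add: stable_Not)

lemma pinch:
  assumes "p \<in> edge e"
  shows "stable (\<not> e) + p + stable e = carry e p"
  using edge_stable[OF assms] by (simp add: add.assoc stable_Not)

lemma pinch_left:
  assumes "p \<in> edge e"
  shows "stable (\<not> e) + (p + (stable e + x)) = carry e p + x"
  using arg_cong[OF pinch[OF assms], of "\<lambda>y. y + x"] by (simp add: add.assoc)

text \<open>In \<open>H m\<close> the length of a power of s is the absolute value of its exponent,
  \<open>exponent_sum\<close> giving the lower bound. So doubling the exponent does no worse than
  double the length.\<close>

lemma len_carry:
  assumes "p \<in> edge e"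
  shows "len m (carry e p) \<le> 2 * len m p"
proof -
  have "\<bar>exponent_sum m p\<bar> \<le> int (len m p)"
    using assms edge_mem exponent_sum_le by blast
  then have "nat \<bar>if e then exponent_sum m p div 2 else 2 * exponent_sum m p\<bar> \<le> 2 * len m p"
    by auto
  then show ?thesis
    unfolding carry_def using len_zpow_gen[of m m] order.trans by blast
qed

lemma carry_mem_H [simp]: "carry e p \<in> H m"
  using carry_mem edge_mem by blast

text \<open>Admissibility looks only at the second of two base elements, so changing the first one
  of a list keeps it reduced. An empty list has no syllable to take \<open>g\<close>; then the tail
  takes it.\<close>

lemma absorb_left:
  assumes "base us" "g \<in> H m" "c \<in> H m"
  obtains vs d where "g + ev us + c = ev vs + d" "base vs" "d \<in> H m" "map snd vs = map snd us"
    "tl vs = tl us" "us \<noteq> [] \<Longrightarrow> vs = (g + fst (hd us), snd (hd us)) # tl us \<and> d = c"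
    "reduced us \<Longrightarrow> reduced vs" "size_sum vs + len m d \<le> len m g + size_sum us + len m c"
proof (cases us)
  case Nil
  then show ?thesis
    using assms that[of "[]" "g + c"] len_add[of g m c] by simp
next
  case (Cons x us')
  obtain b e where x: "x = (b, e)" by (cases x)
  have "reduced ((g + b, e) # us')" if "reduced us"
    using that Cons x by (cases us') (auto simp: admissible_def)
  moreover have "len m (g + b) \<le> len m g + len m b" "g + b \<in> H m"
    using assms Cons x len_add[of g m b] by simp_all
  ultimately show ?thesis
    using assms Cons x by (intro that[of "(g + b, e) # us'" c]) (simp_all add: add.assoc)
qed

text \<open>A pinch may double the length of the base element it releases
  (\<open>len_carry\<close>). Adding one syllable in front causes at most one pinch, hence one
  factor 2 for each syllable.\<close>

lemma reduce:
  assumes "base ws" "c \<in> H m"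
  obtains us d where "ev ws + c = ev us + d" "reduced us" "base us" "d \<in> H m"
    "length us \<le> length ws" "size_sum us + len m d \<le> 2 ^ length ws * (size_sum ws + len m c)"
proof -
  have "\<exists>us d. ev ws + c = ev us + d \<and> reduced us \<and> base us \<and> d \<in> H m \<and>
    length us \<le> length ws \<and> size_sum us + len m d \<le> 2 ^ length ws * (size_sum ws + len m c)"
    using assms
  proof (induction ws)
    case Nil
    then show ?case by (intro exI[of _ "[]"] exI[of _ c]) simp
  next
    case (Cons x ws)
    obtain b e where x: "x = (b, e)" by (cases x)
    obtain us d where us: "ev ws + c = ev us + d" "reduced us" "base us" "d \<in> H m"
      "length us \<le> length ws" "size_sum us + len m d \<le> 2 ^ length ws * (size_sum ws + len m c)"
      using Cons by auto
    have b: "b \<in> H m" using Cons.prems x by simp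
    show ?case
    proof (cases "reduced (x # us)")
      case True
      have "len m b + (size_sum us + len m d) \<le> 2 ^ Suc (length ws) * len m b + 2 ^ Suc (length ws) * (size_sum ws + len m c)"
        using us(6) by (intro add_mono) auto
      then show ?thesis
        using True us b x by (intro exI[of _ "x # us"] exI[of _ d]) (simp add: algebra_simps)
    next
      case False
      then obtain y us' where y: "us = y # us'" "\<not> admissible x y"
        using us(2) by (cases us) auto
      obtain b' e' where y': "y = (b', e')" by (cases y)
      have e: "e = (\<not> e')" and b': "b' \<in> edge e'"
        using y by (auto simp: admissible_def x y')
      let ?g = "b + carry e' b'"
      have "ev (x # ws) + c = b + stable e + (ev us + d)"
        by (simp add: x add.assoc us(1))
      also have "\<dots> = b + (stable (\<not> e') + b' + stable e') + (ev us' + d)"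
        by (simp add: y y' e add.assoc)
      also have "\<dots> = ?g + ev us' + d"
        by (simp add: pinch_left[OF b'] add.assoc)
      finally have eq: "ev (x # ws) + c = ?g + ev us' + d" .
      have base_us': "base us'" "reduced us'" using us y reduced_ConsD by auto
      obtain vs d' where vs: "?g + ev us' + d = ev vs + d'" "base vs" "d' \<in> H m"
        "map snd vs = map snd us'" "reduced us' \<Longrightarrow> reduced vs"
        "size_sum vs + len m d' \<le> len m ?g + size_sum us' + len m d"
        using absorb_left[OF base_us'(1), of ?g d] b us(4) by (metis H_add carry_mem_H)
      have len_vs: "length vs = length us'" using vs(4) map_eq_imp_length_eq by blast
      have "len m ?g \<le> len m b + 2 * len m b'"
        using len_add[of b m "carry e' b'"] b len_carry[OF b'] by simp
      then have "size_sum vs + len m d' \<le> len m b + 2 * (size_sum us + len m d)"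
        using vs(6) by (simp add: y y')
      also have "\<dots> \<le> 2 ^ Suc (length ws) * len m b + 2 * (2 ^ length ws * (size_sum ws + len m c))"
        using us(6) by (intro add_mono) auto
      finally have "size_sum vs + len m d' \<le> 2 ^ length (x # ws) * (size_sum (x # ws) + len m c)"
        by (simp add: x algebra_simps)
      then show ?thesis
        using len_vs eq vs us(5) base_us' by (intro exI[of _ vs] exI[of _ d']) (simp add: y)
    qed
  qed
  then show ?thesis using that by blast
qed

lemma word_syllables:
  assumes "w \<in> words (BS_gens (Suc m))"
  shows "\<exists>ws c. val w = ev ws + c \<and> base ws \<and> c \<in> H m \<and> length ws + size_sum ws + len m c \<le> length w"
  using assms
proof (induction w)
  case Nil
  then show ?case by (intro exI[of _ "[]"] exI[of _ 0]) (simp add: val_Nil)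
next
  case (Cons a w)
  obtain i e where a: "a = (i, e)" by (cases a)
  obtain ws c where ws: "val w = ev ws + c" "base ws" "c \<in> H m"
    "length ws + size_sum ws + len m c \<le> length w"
    using Cons by auto
  show ?case
  proof (cases "i = Suc m")
    case True
    then have "val (a # w) = ev ((0, e) # ws) + c"
      by (simp add: a val_Cons ws stable_def add.assoc)
    then show ?thesis
      using ws by (intro exI[of _ "(0, e) # ws"] exI[of _ c]) simp
  next
    case False
    let ?g = "if e then gen i else - gen i"
    have i: "i \<le> m" using Cons.prems a False by (simp add: BS_gens_def)
    then have g: "?g \<in> H m" "len m ?g \<le> 1"
      using len_gen[of i m] by simp_all
    obtain vs d where vs: "?g + ev ws + c = ev vs + d" "base vs" "d \<in> H m" "map snd vs = map snd ws"
      "size_sum vs + len m d \<le> len m ?g + size_sum ws + len m c"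
      using absorb_left[OF ws(2) g(1) ws(3)] by metis
    have "length vs = length ws" using vs(4) map_eq_imp_length_eq by blast
    then show ?thesis
      using vs ws g(2) by (intro exI[of _ vs] exI[of _ d]) (simp add: a val_Cons add.assoc)
  qed
qed

lemma reduced_form:
  assumes "g \<in> H (Suc m)"
  obtains us d where "g = ev us + d" "reduced us" "base us" "d \<in> H m"
    "length us \<le> len (Suc m) g" "size_sum us + len m d \<le> 4 ^ len (Suc m) g"
proof -
  let ?n = "len (Suc m) g"
  obtain w where w: "w \<in> words (BS_gens (Suc m))" "val w = g" "length w = ?n"
    using len_attained[OF assms] .
  obtain ws c where ws: "g = ev ws + c" "base ws" "c \<in> H m" "length ws + size_sum ws + len m c \<le> ?n"
    using word_syllables[OF w(1)] w by auto
  obtain us d where us: "ev ws + c = ev us + d" "reduced us" "base us" "d \<in> H m"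
    "length us \<le> length ws" "size_sum us + len m d \<le> 2 ^ length ws * (size_sum ws + len m c)"
    using reduce[OF ws(2,3)] .
  note us(6)
  \<comment> \<open>One factor \<open>2 ^ ?n\<close> for the pinches, and one as a crude bound for
    the size, which is at most \<open>?n\<close>.\<close>
  also have "2 ^ length ws * (size_sum ws + len m c) \<le> 2 ^ ?n * 2 ^ ?n"
  proof (rule mult_le_mono)
    show "2 ^ length ws \<le> (2 :: nat) ^ ?n"
      using ws(4) by (intro power_increasing) auto
    have "?n < 2 ^ ?n" by (rule less_exp)
    then show "size_sum ws + len m c \<le> 2 ^ ?n"
      using ws(4) by linarith
  qed
  also have "\<dots> = 4 ^ ?n"
    by (simp flip: power_mult_distrib)
  finally show ?thesis
    using us ws that[of us d] by simp
qed

text \<open>A reduced form of a base element has no stable letter, so the size bound of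
  \<open>reduced_form\<close> is a bound for the element itself.\<close>

lemma len_distortion:
  assumes "g \<in> H m"
  shows "len m g \<le> 4 ^ len (Suc m) g"
proof -
  obtain us d where us: "g = ev us + d" "reduced us" "base us" "d \<in> H m"
    "size_sum us + len m d \<le> 4 ^ len (Suc m) g"
    using reduced_form[of g] assms H_Suc by metis
  have "ev us + d = ev [] + g"
    by (simp flip: us(1))
  then have "map snd us = map snd ([] :: syllables)"
    by (rule reduced_unique_exponents[OF us(2-4) _ _ assms, rotated -1]) simp_all
  then have "us = []" by simp
  then have "g = d" using us(1) by simp
  then show ?thesis using us(5) \<open>us = []\<close> by simp
qed

section \<open>Syllable length\<close>

definition syllable_length :: "tower \<Rightarrow> nat" where
  "syllable_length g = (LEAST k. \<exists>ws c. base ws \<and> c \<in> H m \<and> g = ev ws + c \<and> length ws = k)"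

lemma syllable_length_le:
  "base ws \<Longrightarrow> c \<in> H m \<Longrightarrow> syllable_length (ev ws + c) \<le> length ws"
  unfolding syllable_length_def by (rule Least_le) blast

lemma syllable_length_attained:
  assumes "g \<in> H (Suc m)"
  obtains us d where "g = ev us + d" "reduced us" "base us" "d \<in> H m" "length us = syllable_length g"
proof -
  have "\<exists>k ws c. base ws \<and> c \<in> H m \<and> g = ev ws + c \<and> length ws = k"
    using reduced_form[OF assms] by blast
  then have "\<exists>ws c. base ws \<and> c \<in> H m \<and> g = ev ws + c \<and> length ws = syllable_length g"
    unfolding syllable_length_def by (rule LeastI_ex)
  then obtain ws c where ws: "base ws" "c \<in> H m" "g = ev ws + c" "length ws = syllable_length g"
    by blast
  obtain us d where us: "ev ws + c = ev us + d" "reduced us" "base us" "d \<in> H m" "length us \<le> length ws"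
    using reduce[OF ws(1,2)] by metis
  then have "length us = syllable_length g"
    using ws syllable_length_le[of us d] by simp
  then show ?thesis
    using us ws that by metis
qed

lemma syllable_length_reduced:
  assumes "reduced ws" "base ws" "c \<in> H m"
  shows "syllable_length (ev ws + c) = length ws"
proof -
  obtain us d where us: "ev ws + c = ev us + d" "reduced us" "base us" "d \<in> H m"
    "length us = syllable_length (ev ws + c)"
    using syllable_length_attained[of "ev ws + c"] assms by (metis H_Suc H_add ev_mem)
  then have "map snd ws = map snd us"
    using assms by (intro reduced_unique_exponents[of ws c us d])
  then show ?thesis
    using us map_eq_imp_length_eq by metis
qed

lemma syllable_length_base [simp]: "c \<in> H m \<Longrightarrow> syllable_length c = 0"
  using syllable_length_reduced[of "[]" c] by simp

lemma syllable_length_add: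
  assumes "g \<in> H (Suc m)" "h \<in> H (Suc m)"
  shows "syllable_length (g + h) \<le> syllable_length g + syllable_length h"
proof -
  obtain us c where us: "g = ev us + c" "base us" "c \<in> H m" "length us = syllable_length g"
    using syllable_length_attained[OF assms(1)] .
  obtain vs d where vs: "h = ev vs + d" "base vs" "d \<in> H m" "length vs = syllable_length h"
    using syllable_length_attained[OF assms(2)] .
  obtain vs' d' where vs': "c + ev vs + d = ev vs' + d'" "base vs'" "d' \<in> H m" "map snd vs' = map snd vs"
    using absorb_left[OF vs(2) us(3) vs(3)] by metis
  have "g + h = ev us + (c + ev vs + d)"
    by (simp add: us(1) vs(1) add.assoc)
  also have "\<dots> = ev (us @ vs') + d'"
    unfolding vs'(1) by (simp add: add.assoc)
  finally show ?thesis
    using syllable_length_le[of "us @ vs'" d'] us vs vs' map_eq_imp_length_eq[OF vs'(4)] by simp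
qed

text \<open>The end letters are recorded to decide later whether products with an inverse are
  reduced where the factors meet.\<close>

lemma inverse_syllables:
  assumes "base ws" "reduced ws"
  obtains l c where "- ev ws = ev l + c" "base l" "reduced l" "c \<in> H m" "length l = length ws"
    "ws \<noteq> [] \<Longrightarrow> hd l = (0, \<not> snd (last ws)) \<and> snd (last l) = (\<not> snd (hd ws)) \<and> c = - fst (hd ws)"
proof -
  have "\<exists>l c. - ev ws = ev l + c \<and> base l \<and> reduced l \<and> c \<in> H m \<and> length l = length ws \<and>
    (ws \<noteq> [] \<longrightarrow> hd l = (0, \<not> snd (last ws)) \<and> snd (last l) = (\<not> snd (hd ws)) \<and> c = - fst (hd ws))"
    using assms
  proof (induction ws)
    case Nil
    then show ?case by (intro exI[of _ "[]"] exI[of _ 0]) simp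
  next
    case (Cons x ws)
    obtain b e where x: "x = (b, e)" by (cases x)
    have red: "base ws" "reduced ws" "b \<in> H m"
      using Cons.prems reduced_ConsD x by auto
    show ?case
    proof (cases ws)
      case Nil
      then show ?thesis
        using red by (intro exI[of _ "[(0, \<not> e)]"] exI[of _ "- b"])
          (simp add: x stable_Not minus_add)
    next
      case (Cons y ws')
      obtain b' e' where y: "y = (b', e')" by (cases y)
      obtain l c where l: "- ev ws = ev l + c" "base l" "reduced l" "c \<in> H m" "length l = length ws"
        "hd l = (0, \<not> snd (last ws))" "snd (last l) = (\<not> e')" "c = - b'"
        using Cons.IH[OF red(1,2)] Cons y by auto
      have "admissible x y"
        using Cons.prems(2) Cons by simp
      then have "admissible (last l) (c, \<not> e)"
        using l(7,8) by (cases e; cases e') (auto simp: admissible_def x y)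
      then have "reduced (l @ [(c, \<not> e)])"
        using l(3) by (simp add: reduced_append_iff)
      moreover have "- ev (x # ws) = ev (l @ [(c, \<not> e)]) + - b"
        by (simp add: x minus_add l(1) stable_Not add.assoc del: add_uminus_conv_diff)
      moreover have "l \<noteq> []" using l(5) Cons by auto
      ultimately show ?thesis
        using l red Cons by (intro exI[of _ "l @ [(c, \<not> e)]"] exI[of _ "- b"]) (simp add: x)
    qed
  qed
  then show ?thesis using that by blast
qed

lemma syllable_length_uminus [simp]:
  assumes "g \<in> H (Suc m)"
  shows "syllable_length (- g) = syllable_length g"
proof -
  have *: "syllable_length (- g) \<le> syllable_length g" if "g \<in> H (Suc m)" for g
  proof -
    obtain us d where us: "g = ev us + d" "reduced us" "base us" "d \<in> H m" "length us = syllable_length g"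
      using syllable_length_attained[OF \<open>g \<in> H (Suc m)\<close>] .
    obtain l c where l: "- ev us = ev l + c" "base l" "c \<in> H m" "length l = length us"
      using inverse_syllables[OF us(3,2)] by metis
    have "syllable_length (- d) = 0" "syllable_length (ev l + c) \<le> length us"
      using us l syllable_length_le[of l c] by simp_all
    moreover have "- g = - d + (ev l + c)"
      by (simp add: us(1) minus_add l(1))
    ultimately show ?thesis
      using syllable_length_add[of "- d" "ev l + c"] us(4,5) l by simp
  qed
  show ?thesis
    using *[OF assms] *[of "- g"] assms by simp
qed

lemma syllable_length_conj:
  assumes "c \<in> H (Suc m)" "g \<in> H (Suc m)"
  shows "syllable_length (c + g - c) \<le> 2 * syllable_length c + syllable_length g"
  using syllable_length_add[of "c + g" "- c"] syllable_length_add[of c g] assms by simp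

section \<open>Double cosets of the stable letter\<close>

lemma zpow_Suc: "zpow g (int (Suc n)) = g + zpow g (int n)" for g :: "'a::group_add"
  by (simp add: add.commute flip: zpow_add_1)

lemma zpow_Suc_right: "zpow g (int (Suc n)) = zpow g (int n) + g" for g :: "'a::group_add"
  using zpow_add[of g "int n" 1] by (simp add: add.commute)

lemma ev_replicate_True: "ev (replicate n (0, True)) = zpow (gen (Suc m)) (int n)"
  by (induction n) (simp_all add: stable_def zpow_Suc del: of_nat_Suc)

lemma ev_replicate_False: "ev (replicate n (0, False)) = - zpow (gen (Suc m)) (int n)"
  by (induction n) (simp_all add: stable_def zpow_Suc_right minus_add del: of_nat_Suc add_uminus_conv_diff)

lemma reduced_replicate [simp]: "reduced (replicate n (0, e))"
proof (induction n)
  case (Suc n)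
  then show ?case by (cases n) (auto simp: admissible_def)
qed simp

lemma base_replicate [simp]: "base (replicate n (0, e))"
  by (induction n) auto

lemma stable_power_conj:
  "zpow (gen (Suc m)) (int n) + zpow (gen m) y = zpow (gen m) (2 ^ n * y) + zpow (gen (Suc m)) (int n)"
proof (induction n)
  case (Suc n)
  have "zpow (gen (Suc m)) (int (Suc n)) + zpow (gen m) y =
      gen (Suc m) + zpow (gen m) (2 ^ n * y) + zpow (gen (Suc m)) (int n)"
    by (simp only: zpow_Suc add.assoc Suc)
  also have "\<dots> = zpow (gen m) (2 ^ Suc n * y) + (gen (Suc m) + zpow (gen (Suc m)) (int n))"
    by (simp add: conj_zpow_double[OF gen_rel] add.assoc mult.assoc)
  finally show ?case by (simp only: zpow_Suc)
qed simp

text \<open>The equation says without division that p and q have a power of 2 as quotient or are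
  both 0. That power gives r, which is thus logarithmic in p and q; the summand 1 covers p = q = 0,
  where r is 0.\<close>

lemma stable_power_connects:
  assumes "q * 2 ^ i = p * 2 ^ j"
  obtains r where "zpow (gen (Suc m)) r + zpow (gen m) p = zpow (gen m) q + zpow (gen (Suc m)) r"
    "2 ^ nat \<bar>r\<bar> \<le> \<bar>p\<bar> + \<bar>q\<bar> + 1"
proof -
  let ?t = "gen (Suc m)" and ?s = "gen m"
  consider "p = 0" "q = 0" | "p \<noteq> 0" "q \<noteq> 0" "i \<le> j" | "p \<noteq> 0" "q \<noteq> 0" "j \<le> i"
    using assms by fastforce
  then show ?thesis
  proof cases
    case 1
    then show ?thesis using that[of 0] by simp
  next
    case 2
    define d where "d = j - i"
    have "2 ^ j = 2 ^ i * (2 :: int) ^ d" using 2 by (simp add: d_def flip: power_add)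
    then have q: "q = 2 ^ d * p" using assms by simp
    have "(2 :: int) ^ d * 1 \<le> 2 ^ d * \<bar>p\<bar>" using 2 by (intro mult_left_mono) auto
    also have "\<dots> = \<bar>q\<bar>" by (simp add: q abs_mult)
    finally have "(2 :: int) ^ nat \<bar>int d\<bar> \<le> \<bar>p\<bar> + \<bar>q\<bar> + 1" by simp
    then show ?thesis
      using that[of "int d"] stable_power_conj[of d p, folded q] by blast
  next
    case 3
    define d where "d = i - j"
    have "2 ^ i = 2 ^ j * (2 :: int) ^ d" using 3 by (simp add: d_def flip: power_add)
    then have p: "p = 2 ^ d * q" using assms by (simp add: mult.commute)
    have "zpow ?t (int d) + (zpow ?s q + zpow ?t (- int d)) = zpow ?t (int d) + zpow ?s q + zpow ?t (- int d)"
      by (simp only: add.assoc)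
    also have "\<dots> = zpow ?s p + (zpow ?t (int d) + zpow ?t (- int d))"
      by (simp only: stable_power_conj p add.assoc)
    also have "\<dots> = zpow ?t (int d) + (zpow ?t (- int d) + zpow ?s p)"
      by (simp add: zpow_minus add.assoc[symmetric])
    finally have "zpow ?t (- int d) + zpow ?s p = zpow ?s q + zpow ?t (- int d)"
      by simp
    moreover have "(2 :: int) ^ d * 1 \<le> 2 ^ d * \<bar>q\<bar>" using 3 by (intro mult_left_mono) auto
    then have "(2 :: int) ^ d \<le> \<bar>p\<bar>" by (simp add: p abs_mult)
    then have "(2 :: int) ^ nat \<bar>- int d\<bar> \<le> \<bar>p\<bar> + \<bar>q\<bar> + 1" by simp
    ultimately show ?thesis
      using that[of "- int d"] by blast
  qed
qed

text \<open>Multiply by t as long as it cancels a letter of \<open>bs\<close>; this stops after at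
  most \<open>length bs\<close> steps, and then no further power of t on the left cancels
  anything.\<close>

lemma left_strip:
  assumes "reduced bs" "base bs" "c \<in> H m"
  shows "\<exists>i bs' c'. i \<le> length bs \<and> zpow (gen (Suc m)) (int i) + (ev bs + c) = ev bs' + c' \<and> base bs' \<and>
    c' \<in> H m \<and> length bs' \<le> length bs \<and> (\<forall>n. reduced (replicate n (0, True) @ bs'))"
  using assms
proof (induction "length bs" arbitrary: bs c)
  case 0
  then show ?case by (intro exI[of _ 0] exI[of _ bs] exI[of _ c]) simp
next
  case (Suc k)
  then obtain b e bs1 where bs: "bs = (b, e) # bs1"
    by (cases bs) auto
  show ?case
  proof (cases "admissible (0, True) (b, e)")
    case True
    then have "reduced (replicate n (0, True) @ bs)" for n
      using Suc.prems by (cases "n = 0") (auto simp: reduced_append_iff bs)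
    then show ?thesis
      using Suc.prems by (intro exI[of _ 0] exI[of _ bs] exI[of _ c]) simp
  next
    case False
    then have e: "\<not> e" "b \<in> edge False" by (auto simp: admissible_def)
    have "reduced bs1" "base bs1" using Suc.prems reduced_ConsD by (auto simp: bs)
    then obtain vs d where vs: "carry False b + ev bs1 + c = ev vs + d" "base vs" "d \<in> H m"
      "map snd vs = map snd bs1" "reduced vs"
      using absorb_left[of bs1 "carry False b" c] Suc.prems(3) by (metis carry_mem_H)
    have len: "length vs = length bs1" using vs(4) map_eq_imp_length_eq by blast
    obtain i bs' c' where IH: "i \<le> length vs" "zpow (gen (Suc m)) (int i) + (ev vs + d) = ev bs' + c'"
      "base bs'" "c' \<in> H m" "length bs' \<le> length vs" "\<forall>n. reduced (replicate n (0, True) @ bs')"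
      using Suc.hyps(1)[of vs d] Suc.hyps(2) vs len by (auto simp: bs)
    have "gen (Suc m) + (ev bs + c) = stable True + (b + (stable False + (ev bs1 + c)))"
      using e by (simp add: bs add.assoc) (simp add: stable_def)
    also have "\<dots> = ev vs + d"
      using pinch_left[OF e(2)] by (simp add: vs(1)[symmetric] add.assoc)
    finally have "zpow (gen (Suc m)) (int (Suc i)) + (ev bs + c) = ev bs' + c'"
      using IH(2) by (simp only: zpow_Suc_right add.assoc)
    then show ?thesis
      using IH len by (intro exI[of _ "Suc i"] exI[of _ bs'] exI[of _ c']) (simp add: bs)
  qed
qed

lemma syllable_length_minus_power:
  assumes "reduced W" "base W" "w \<in> H m"
    and "q = 0 \<or> W = [] \<or> \<not> (snd (last W) \<and> w \<in> edge False)"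
  shows "syllable_length (ev W + w - zpow (gen (Suc m)) (int q)) = length W + q"
proof (cases q)
  case 0
  then show ?thesis using assms syllable_length_reduced[of W w] by simp
next
  case (Suc q')
  let ?L = "W @ (w, False) # replicate q' (0, False)"
  have "reduced ((w, False) # replicate q' (0, False))"
    using reduced_replicate[of q' False] by (cases q') (auto simp: admissible_def)
  moreover have "W = [] \<or> admissible (last W) (w, False)"
    using assms(4) Suc by (auto simp: admissible_def)
  ultimately have "reduced ?L"
    using assms by (auto simp: reduced_append_iff)
  then have "syllable_length (ev ?L + 0) = length ?L"
    using assms by (intro syllable_length_reduced) simp_all
  moreover have "ev ?L + 0 = ev W + w - zpow (gen (Suc m)) (int q)"
    by (simp add: Suc ev_replicate_False stable_def zpow_Suc_right minus_add add.assoc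
        del: of_nat_Suc add_uminus_conv_diff flip: add_uminus_conv_diff)
  ultimately show ?thesis by (simp add: Suc)
qed

text \<open>The power t^-q on the right either stops cancelling before it meets t^n, which then
  survives in the reduced form, or it can consume \<open>bs\<close> up to a power of s. In the
  second case all letters of \<open>bs\<close> are t, and moving the powers of s to the left gives
  the form s^y t^k.\<close>

lemma right_strip:
  assumes "reduced (replicate n (0, True) @ bs)" "base bs" "w \<in> H m"
  shows "n \<le> syllable_length (zpow (gen (Suc m)) (int n) + (ev bs + w) - zpow (gen (Suc m)) (int q)) \<or>
    (\<exists>y. ev bs + w = zpow (gen m) y + zpow (gen (Suc m)) (int (length bs)))"
  using assms
proof (induction bs arbitrary: w q rule: rev_induct)
  case Nil
  show ?case
  proof (cases "w \<in> edge False")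
    case True
    then show ?thesis by (auto simp: edge_False_iff)
  next
    case False
    then show ?thesis
      using Nil syllable_length_minus_power[of "replicate n (0, True)" w q]
      by (simp add: ev_replicate_True)
  qed
next
  case (snoc x bs)
  obtain b e where x: "x = (b, e)" by (cases x)
  let ?t = "gen (Suc m)"
  have eq: "ev (replicate n (0, True) @ bs @ [x]) + w = zpow ?t (int n) + (ev (bs @ [x]) + w)"
    by (simp add: ev_replicate_True add.assoc)
  show ?case
  proof (cases "q \<noteq> 0 \<and> e \<and> w \<in> edge False")
    case False
    then have "syllable_length (ev (replicate n (0, True) @ bs @ [x]) + w - zpow ?t (int q)) = n + Suc (length bs) + q"
      using snoc.prems syllable_length_minus_power[of "replicate n (0, True) @ bs @ [x]" w q]
      by (auto simp: x)
    then show ?thesis unfolding eq by simp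
  next
    case True
    then obtain q' where q: "q = Suc q'" by (cases q) auto
    let ?c = "carry False w"
    have t_w: "?t + w = ?c + ?t"
      using pinch[of w False] True by (simp add: stable_def) (metis diff_add_cancel)
    then have w_t: "?t + w - ?t = ?c" by simp
    have red: "reduced (replicate n (0, True) @ bs)"
      using snoc.prems(1) reduced_append_iff[of "replicate n (0, True) @ bs" "[x]"] by simp
    have b: "b + ?c \<in> H m" using snoc.prems(2) x by simp
    have eq1: "ev (bs @ [x]) + w = ev bs + (b + ?c) + ?t"
      using True t_w by (simp add: x stable_def add.assoc)
    have "zpow ?t (int n) + (ev (bs @ [x]) + w) - zpow ?t (int q) =
        zpow ?t (int n) + (ev bs + (b + ?c)) - zpow ?t (int q')"
      unfolding eq1 q zpow_Suc_right by (simp add: add.assoc minus_add diff_conv_add_uminus del: add_uminus_conv_diff)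
    moreover have "ev (bs @ [x]) + w = zpow (gen m) y + zpow ?t (int (length (bs @ [x])))"
      if "ev bs + (b + ?c) = zpow (gen m) y + zpow ?t (int (length bs))" for y
      unfolding eq1 that length_append_singleton zpow_Suc_right by (simp only: add.assoc)
    ultimately show ?thesis
      using snoc.IH[OF red _ b, of q'] snoc.prems(2) by auto
  qed
qed

text \<open>Let M be the total length of b and c. The exponent sum keeps p and q within M of each
  other, which settles negative q. Otherwise strip b to b' and let n be what remains of p. Unless
  t^n survives in c = t^n b' t^-q, \<open>right_strip\<close> gives b' = s^y t^k, where y is nonzero
  as b is not a power of t, and c is s^(2^n y) times a power of t. So s^(2^n y) has length at most 3
  M in \<open>H (Suc m)\<close>; distortion limits its exponent to 4^(3 M), hence n to 6 M.\<close>

lemma double_coset_bound_nonneg: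
  assumes b: "b \<in> H (Suc m)" and c: "c \<in> H (Suc m)" and notin: "b \<notin> range (zpow (gen (Suc m)))"
    and eq: "zpow (gen (Suc m)) (int p) + b = c + zpow (gen (Suc m)) q"
  shows "p \<le> 7 * (len (Suc m) b + len (Suc m) c)"
proof -
  let ?t = "gen (Suc m)" and ?s = "gen m"
  let ?M = "len (Suc m) b + len (Suc m) c"
  have "exponent_sum (Suc m) (zpow ?t (int p) + b) = exponent_sum (Suc m) (c + zpow ?t q)"
    using eq by simp
  then have "int p + exponent_sum (Suc m) b = exponent_sum (Suc m) c + q"
    using b c by (simp add: exponent_sum_add)
  then have pq: "\<bar>int p - q\<bar> \<le> int ?M"
    using exponent_sum_le[OF b] exponent_sum_le[OF c] by linarith
  show ?thesis
  proof (cases "q < 0")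
    case True
    then have "int p \<le> int ?M" using pq by linarith
    then show ?thesis by simp
  next
    case False
    then obtain q' where q: "q = int q'" by (metis nonneg_int_cases not_less)
    obtain bs b0 where bs: "b = ev bs + b0" "reduced bs" "base bs" "b0 \<in> H m" "length bs \<le> len (Suc m) b"
      using reduced_form[OF b] by metis
    obtain i bs' b' where strip: "i \<le> length bs" "zpow ?t (int i) + b = ev bs' + b'" "base bs'" "b' \<in> H m"
      "length bs' \<le> length bs" "\<And>n. reduced (replicate n (0, True) @ bs')"
      using left_strip[OF bs(2-4)] bs(1) by blast
    show ?thesis
    proof (cases "p \<le> i")
      case True
      then have "p \<le> len (Suc m) b" using strip(1) bs(5) by simp
      then show ?thesis by simp
    next
      case False
      define n where "n = p - i"
      have p: "p = n + i" using False by (simp add: n_def)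
      have "zpow ?t (int p) + b = zpow ?t (int n) + (ev bs' + b')"
        using zpow_add[of ?t "int n" "int i"] strip(2) by (simp add: p add.assoc)
      then have c_eq: "c = zpow ?t (int n) + (ev bs' + b') - zpow ?t (int q')"
        using eq q by (metis add_diff_cancel)
      consider "n \<le> syllable_length c" | y where "ev bs' + b' = zpow ?s y + zpow ?t (int (length bs'))"
        using right_strip[OF strip(6,3,4), of n q'] c_eq by blast
      then show ?thesis
      proof cases
        case 1
        obtain cs c0 where cs: "c = ev cs + c0" "reduced cs" "base cs" "c0 \<in> H m" "length cs \<le> len (Suc m) c"
          using reduced_form[OF c] by metis
        have "syllable_length c \<le> len (Suc m) c"
          using syllable_length_le[OF cs(3,4)] cs(1,5) by simp
        then have "p \<le> ?M" using 1 p strip(1) bs(5) by simp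
        then show ?thesis by simp
      next
        case 2
        let ?k = "length bs'"
        have "y \<noteq> 0"
        proof
          assume "y = 0"
          then have "zpow ?t (int i) + b = zpow ?t (int ?k)"
            using 2 strip(2) by simp
          then have "b = zpow ?t (- int i) + zpow ?t (int ?k)"
            by (metis minus_add_cancel zpow_minus)
          then show False
            using notin by (simp flip: zpow_add)
        qed
        have "c = zpow ?s (2 ^ n * y) + zpow ?t (int n) + zpow ?t (int ?k) - zpow ?t (int q')"
          unfolding c_eq 2 by (simp add: stable_power_conj add.assoc flip: add.assoc)
        also have "\<dots> = zpow ?s (2 ^ n * y) + zpow ?t (int n + int ?k - int q')"
          by (simp add: zpow_add zpow_diff add.assoc add_diff_eq)
        finally have "zpow ?s (2 ^ n * y) = c - zpow ?t (int n + int ?k - int q')"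
          by simp
        then have "len (Suc m) (zpow ?s (2 ^ n * y)) \<le> len (Suc m) c + len (Suc m) (zpow ?t (int n + int ?k - int q'))"
          using len_diff[OF c] by simp
        also have "\<dots> \<le> len (Suc m) c + nat \<bar>int n + int ?k - int q'\<bar>"
          by (intro add_left_mono len_zpow_gen) simp
        also have "\<dots> \<le> 3 * ?M"
        proof -
          have "\<bar>int n + int ?k - int q'\<bar> \<le> int ?M + int (len (Suc m) b)"
            using pq strip(1,5) bs(5) unfolding p q by linarith
          then have "nat \<bar>int n + int ?k - int q'\<bar> \<le> ?M + len (Suc m) b"
            by (simp add: nat_le_iff)
          then show ?thesis by simp
        qed
        finally have "len (Suc m) (zpow ?s (2 ^ n * y)) \<le> 3 * ?M" .
        have "int (2 ^ n) \<le> \<bar>2 ^ n * y\<bar>"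
          using \<open>y \<noteq> 0\<close> by (simp add: abs_mult)
        also have "\<dots> \<le> int (len m (zpow ?s (2 ^ n * y)))"
          using exponent_sum_le[of "zpow ?s (2 ^ n * y)" m] by simp
        finally have "2 ^ n \<le> len m (zpow ?s (2 ^ n * y))"
          by linarith
        also have "\<dots> \<le> 4 ^ len (Suc m) (zpow ?s (2 ^ n * y))"
          by (intro len_distortion) simp
        also have "\<dots> \<le> 4 ^ (3 * ?M)"
          using \<open>len (Suc m) (zpow ?s (2 ^ n * y)) \<le> 3 * ?M\<close> by (intro power_increasing) auto
        also have "\<dots> = 2 ^ (6 * ?M)"
          using power_mult[of "2 :: nat" 2 "3 * ?M"] by simp
        finally have "n \<le> 6 * ?M"
          by (simp only: power_increasing_iff[of "2 :: nat"])
        then have "p \<le> 6 * ?M + len (Suc m) b" using p strip(1) bs(5) by simp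
        then show ?thesis by simp
      qed
    qed
  qed
qed

text \<open>For negative p the equation is solved for c, so that b and c change places and the
  exponent becomes -p.\<close>

theorem double_coset_bound:
  assumes b: "b \<in> H (Suc m)" and c: "c \<in> H (Suc m)" and notin: "b \<notin> range (zpow (gen (Suc m)))"
    and eq: "zpow (gen (Suc m)) p + b = c + zpow (gen (Suc m)) q"
  shows "nat \<bar>p\<bar> \<le> 7 * (len (Suc m) b + len (Suc m) c)"
proof (cases "p \<ge> 0")
  case True
  then show ?thesis
    using double_coset_bound_nonneg[OF b c notin, of "nat p" q] eq by simp
next
  case False
  let ?t = "gen (Suc m)"
  have b_eq: "b = zpow ?t (- p) + (c + zpow ?t q)"
    using eq by (metis minus_add_cancel zpow_minus)
  have eq': "zpow ?t (int (nat (- p))) + c = b + zpow ?t (- q)"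
    using False by (simp add: b_eq add.assoc flip: zpow_add)
  have "c \<notin> range (zpow ?t)"
  proof
    assume "c \<in> range (zpow ?t)"
    then obtain k where "c = zpow ?t k" by blast
    then show False using notin b_eq by (simp flip: zpow_add)
  qed
  then show ?thesis
    using double_coset_bound_nonneg[OF c b _ eq'] False by (simp add: add.commute)
qed

section \<open>Cyclic reduction and elliptic elements\<close>

text \<open>Reducedness of \<open>vs @ vs\<close> covers the seam where the end of the cyclic word
  meets its beginning. The first alternative describes the elliptic elements, the second the
  hyperbolic ones.\<close>

definition cyclically_reduced :: "nat \<Rightarrow> nat \<Rightarrow> tower \<Rightarrow> bool" where
  "cyclically_reduced n k u \<longleftrightarrow> (u \<in> H m \<and> len m u \<le> k) \<or>
     (\<exists>vs. u = ev vs \<and> base vs \<and> vs \<noteq> [] \<and> reduced (vs @ vs) \<and> length vs \<le> n \<and> size_sum vs \<le> k)"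

lemma cyclically_reduced_mono:
  "cyclically_reduced n k u \<Longrightarrow> n \<le> n' \<Longrightarrow> k \<le> k' \<Longrightarrow> cyclically_reduced n' k' u"
  unfolding cyclically_reduced_def by (elim disjE exE; force)

text \<open>Conjugating by the tail moves it to the front. A pinch at the seam is then resolved by
  conjugating with the last stable letter, which removes two syllables.\<close>

lemma cyclic_reduction:
  assumes "reduced us" "base us" "c \<in> H m"
  shows "\<exists>h\<in>H (Suc m). \<exists>u. h + (ev us + c) = u + h \<and>
    len (Suc m) h \<le> 2 ^ length us * (size_sum us + len m c + 1) \<and>
    cyclically_reduced (length us) (2 ^ length us * (size_sum us + len m c)) u"
  using assms
proof (induction "length us" arbitrary: us c rule: less_induct)
  case less
  let ?N = "size_sum us + len m c"
  have N: "?N \<le> 2 ^ length us * ?N" by simp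
  show ?case
  proof (cases us)
    case Nil
    then show ?thesis
      using less.prems by (intro bexI[of _ 0] exI[of _ c]) (auto simp: cyclically_reduced_def)
  next
    case (Cons x us')
    obtain vs d where "c + ev us + 0 = ev vs + d" "base vs" "d \<in> H m" "map snd vs = map snd us"
      "us \<noteq> [] \<Longrightarrow> vs = (c + fst (hd us), snd (hd us)) # tl us \<and> d = 0" "reduced us \<Longrightarrow> reduced vs"
      "size_sum vs + len m d \<le> len m c + size_sum us + len m 0"
      using absorb_left[of us c 0] less.prems by (metis H_0)
    then have vs: "c + ev us = ev vs" "base vs" "map snd vs = map snd us" "vs \<noteq> []" "reduced vs"
      "size_sum vs \<le> ?N"
      using Cons less.prems by auto
    have len_vs: "length vs = length us"
      using vs(3) map_eq_imp_length_eq by blast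
    have conj_c: "c + (ev us + c) = ev vs + c"
      by (simp add: add.assoc flip: vs(1))
    have len_c: "len (Suc m) c \<le> len m c"
      using less.prems by (intro len_mono) auto
    show ?thesis
    proof (cases "reduced (vs @ vs)")
      case True
      have "len (Suc m) c \<le> 2 ^ length us * (?N + 1)"
        using len_c N by (simp only: distrib_left)
      moreover have "size_sum vs \<le> 2 ^ length us * ?N"
        using vs(6) N by linarith
      ultimately show ?thesis
        using conj_c vs len_vs less.prems True
        by (intro bexI[of _ c] exI[of _ "ev vs"]) (auto simp: cyclically_reduced_def)
    next
      case False
      then have nadm: "\<not> admissible (last vs) (hd vs)"
        using vs(4,5) by (auto simp: reduced_append_iff)
      obtain b1 e1 rest where rest: "vs = (b1, e1) # rest"
        using vs(4) by (cases vs) auto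
      \<comment> \<open>A syllable is always admissible after itself, so a pinch at the seam
        involves two different syllables.\<close>
      have "rest \<noteq> []" using nadm by (auto simp: rest admissible_def)
      then obtain mid bk ek where mid: "vs = (b1, e1) # mid @ [(bk, ek)]"
        unfolding rest by (cases rest rule: rev_cases) auto
      have e: "ek = (\<not> e1)" "b1 \<in> edge e1"
        using nadm by (auto simp: mid admissible_def)
      have red_mid: "reduced mid" "base mid"
        using vs(2,5) reduced_ConsD[of "(b1, e1)" "mid @ [(bk, ek)]"] by (auto simp: mid reduced_append_iff)
      have bk: "bk \<in> H m" using vs(2) by (simp add: mid)
      obtain ws d where ws: "carry e1 b1 + ev mid + bk = ev ws + d" "base ws" "d \<in> H m"
        "map snd ws = map snd mid" "reduced ws"
        "size_sum ws + len m d \<le> len m (carry e1 b1) + size_sum mid + len m bk"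
        using absorb_left[OF red_mid(2), of "carry e1 b1" bk] bk red_mid(1) by (metis carry_mem_H)
      have len_ws: "length ws + 2 = length us"
        using map_eq_imp_length_eq[OF ws(4)] len_vs by (simp add: mid)
      have size_ws: "size_sum ws + len m d \<le> 2 * ?N"
        using ws(6) len_carry[OF e(2)] vs(6) by (simp add: mid)
      have conj_ws: "stable ek + ev vs = ev ws + d + stable ek"
        using e by (simp add: mid pinch_left add.assoc flip: ws(1))
      obtain h u where IH: "h \<in> H (Suc m)" "h + (ev ws + d) = u + h"
        "len (Suc m) h \<le> 2 ^ length ws * (size_sum ws + len m d + 1)"
        "cyclically_reduced (length ws) (2 ^ length ws * (size_sum ws + len m d)) u"
        using less.hyps[of ws d] ws(2,3,5) len_ws by auto
      let ?h = "h + stable ek + c"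
      have "?h + (ev us + c) = h + (stable ek + ev vs) + c"
        by (simp add: add.assoc conj_c)
      also have "\<dots> = h + (ev ws + d) + stable ek + c"
        by (simp add: conj_ws add.assoc)
      also have "\<dots> = u + ?h"
        unfolding IH(2) by (simp add: add.assoc)
      finally have conj_h: "?h + (ev us + c) = u + ?h" .
      \<comment> \<open>Two syllables less free a factor 4: one factor 2 pays for the doubled size,
        the rest for \<open>stable ek\<close> and \<open>c\<close> in the conjugator.\<close>
      have pow: "(2::nat) ^ length us = 4 * 2 ^ length ws"
        using len_ws by (simp flip: len_ws add: power_add)
      have "2 ^ length ws * (size_sum ws + len m d) \<le> 2 ^ length ws * (2 * ?N)"
        using size_ws by (rule mult_le_mono2)
      also have "\<dots> \<le> 2 ^ length us * ?N"
        by (simp add: pow)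
      finally have size: "2 ^ length ws * (size_sum ws + len m d) \<le> 2 ^ length us * ?N" .
      have "len (Suc m) (stable ek) \<le> 1"
        using len_gen[of "Suc m" "Suc m"] by (simp add: stable_def)
      then have "len (Suc m) ?h \<le> len (Suc m) h + 1 + len m c"
        using len_add[of "h + stable ek" "Suc m" c] len_add[of h "Suc m" "stable ek"] IH(1) less.prems(3) len_c
        by simp
      also have "\<dots> \<le> 2 ^ length ws * (2 * ?N + 1) + 2 ^ length ws + 2 ^ length ws * ?N"
      proof (intro add_mono)
        have "2 ^ length ws * (size_sum ws + len m d + 1) \<le> 2 ^ length ws * (2 * ?N + 1)"
          using size_ws by (intro mult_le_mono2) simp
        then show "len (Suc m) h \<le> 2 ^ length ws * (2 * ?N + 1)"
          using IH(3) by linarith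
        have "?N \<le> 2 ^ length ws * ?N" by simp
        then show "len m c \<le> 2 ^ length ws * ?N" by linarith
      qed simp
      also have "\<dots> \<le> 2 ^ length us * (?N + 1)"
        by (simp add: pow algebra_simps)
      finally have len_h: "len (Suc m) ?h \<le> 2 ^ length us * (?N + 1)" .
      have "cyclically_reduced (length us) (2 ^ length us * ?N) u"
        using IH(4) size len_ws by (intro cyclically_reduced_mono[OF IH(4)]) auto
      then show ?thesis
        using conj_h len_h IH(1) less.prems(3) by (intro bexI[of _ ?h] exI[of _ u]) auto
    qed
  qed
qed

text \<open>If c + u - c lay outside the edge group of the last letter of the conjugator, then v
  would have a reduced form with stable letters. So u is conjugate in the base to a power of s.
  Passing the letter doubles or halves its exponent, and the shortened conjugator is left to the
  induction.\<close>

lemma elliptic_conjugate_list: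
  assumes "reduced gs" "base gs" "c \<in> H m" "u \<in> H m" "v \<in> H m"
    and "ev gs + c + u = v + (ev gs + c)"
  shows "(\<exists>d\<in>H m. d + u = v + d) \<or>
    (\<exists>d\<in>H m. \<exists>d'\<in>H m. \<exists>p q. \<exists>i j::nat. d + u = zpow (gen m) p + d \<and> d' + v = zpow (gen m) q + d' \<and>
      q * 2 ^ i = p * 2 ^ j)"
  using assms
proof (induction gs arbitrary: c u rule: rev_induct)
  case Nil
  then show ?case by auto
next
  case (snoc x gs)
  obtain b e where x: "x = (b, e)" by (cases x)
  let ?s = "gen m"
  define w where "w = c + u - c"
  have w: "w \<in> H m" using snoc.prems by (simp add: w_def)
  have c_u: "c + u = w + c" by (simp add: w_def)
  let ?gs = "gs @ [x]"
  have "ev ?gs + (c + u) = v + ev ?gs + c"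
    using snoc.prems(6) by (simp add: add.assoc)
  then have gs_w: "ev ?gs + w = v + ev ?gs"
    unfolding c_u by (simp only: add.assoc[symmetric] add_right_cancel)
  then have v_eq: "v = ev ?gs + w + - ev ?gs"
    by simp
  have "w \<in> edge (\<not> e)"
  proof (rule ccontr)
    assume not_edge: "w \<notin> edge (\<not> e)"
    obtain l d where l: "- ev ?gs = ev l + d" "base l" "reduced l" "d \<in> H m" "length l = length ?gs"
      "hd l = (0, \<not> snd (last ?gs))"
      using inverse_syllables[OF snoc.prems(2,1)] by blast
    then obtain l' where l': "l = (0, \<not> e) # l'"
      by (cases l) (auto simp: x)
    let ?L = "?gs @ (w, \<not> e) # l'"
    have "reduced ((w, \<not> e) # l')"
      using l(3) unfolding l' by (cases l') (auto simp: admissible_def)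
    then have "reduced ?L"
      using snoc.prems(1) not_edge reduced_append_iff[of ?gs "(w, \<not> e) # l'"] by (simp add: x admissible_def)
    then have "syllable_length (ev ?L + d) = length ?L"
      using snoc.prems(2) l(2,4) w by (intro syllable_length_reduced) (simp_all add: l')
    moreover have "ev ?L + d = v"
      unfolding v_eq l(1) by (simp add: l' x add.assoc)
    ultimately show False
      using snoc.prems(5) by simp
  qed
  then obtain p where p: "w = zpow ?s p" "\<not> e \<longrightarrow> even p"
    by (auto simp: edge_def)
  define p' where "p' = (if e then 2 * p else p div 2)"
  have carry: "carry (\<not> e) w = zpow ?s p'"
    by (simp add: p carry_zpow p'_def)
  have pp': "p' * 2 ^ (if e then 0 else 1) = p * 2 ^ (if e then 1 else 0)"
    using p(2) by (auto simp: p'_def)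
  have "ev gs + b + zpow ?s p' = ev ?gs + w + stable (\<not> e)"
    using pinch[OF \<open>w \<in> edge (\<not> e)\<close>] by (simp add: x carry add.assoc)
  also have "\<dots> = v + (ev ?gs + stable (\<not> e))"
    by (simp only: gs_w add.assoc)
  also have "\<dots> = v + (ev gs + b)"
    by (simp add: x add.assoc)
  finally have conj: "ev gs + b + zpow ?s p' = v + (ev gs + b)" .
  have red: "reduced gs" "base gs" "b \<in> H m"
    using snoc.prems by (auto simp: reduced_append_iff x)
  have u_p: "c + u = zpow ?s p + c" using c_u p by simp
  from snoc.IH[OF red _ snoc.prems(5) conj] consider
    d where "d \<in> H m" "d + zpow ?s p' = v + d"
    | d d' p'' q and i j :: nat where "d \<in> H m" "d' \<in> H m" "d + zpow ?s p' = zpow ?s p'' + d"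
      "d' + v = zpow ?s q + d'" "q * 2 ^ i = p'' * 2 ^ j"
    by auto
  then show ?case
  proof cases
    case 1
    have "zpow ?s p' = - d + v + d"
      using 1(2) by (metis add.assoc minus_add_cancel)
    then have "- d + v = zpow ?s p' + - d"
      by (simp only: add.assoc right_minus add_0_right)
    then show ?thesis
      using 1(1) snoc.prems(3) u_p pp' by (intro disjI2) (metis H_uminus)
  next
    case 2
    \<comment> \<open>\<open>exponent_sum m\<close> is invariant under conjugation in the base, so
      two powers of s conjugate there are equal.\<close>
    have "exponent_sum m (d + zpow ?s p') = exponent_sum m (zpow ?s p'' + d)"
      using 2(3) by simp
    then have "p'' = p'"
      using 2(1) by (simp add: exponent_sum_add)
    have "q * 2 ^ (i + (if e then 0 else 1)) = p' * 2 ^ (if e then 0 else 1) * 2 ^ j"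
      using 2(5) \<open>p'' = p'\<close> by (simp add: power_add)
    also have "\<dots> = p * 2 ^ (j + (if e then 1 else 0))"
      unfolding pp' by (simp add: power_add)
    finally have "q * 2 ^ (i + (if e then 0 else 1)) = p * 2 ^ (j + (if e then 1 else 0))" .
    then show ?thesis
      using 2 snoc.prems(3) u_p by blast
  qed
qed

lemma elliptic_conjugate:
  assumes "g \<in> H (Suc m)" "u \<in> H m" "v \<in> H m" "g + u = v + g"
  obtains d where "d \<in> H m" "d + u = v + d"
  | d d' p q and i j :: nat where "d \<in> H m" "d' \<in> H m" "d + u = zpow (gen m) p + d"
    "d' + v = zpow (gen m) q + d'" "q * 2 ^ i = p * 2 ^ j"
proof -
  obtain gs c where "g = ev gs + c" "reduced gs" "base gs" "c \<in> H m"
    using reduced_form[OF assms(1)] by metis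
  then show ?thesis
    using elliptic_conjugate_list[of gs c u v] assms that by blast
qed

section \<open>Hyperbolic elements\<close>

lemma len_ev:
  "base ws \<Longrightarrow> len (Suc m) (ev ws) \<le> size_sum ws + length ws"
proof (induction ws)
  case (Cons x ws)
  obtain b e where x: "x = (b, e)" by (cases x)
  have b: "b \<in> H m" "base ws" using Cons.prems x by auto
  have "len (Suc m) (stable e) \<le> 1"
    using len_gen[of "Suc m" "Suc m"] by (simp add: stable_def)
  moreover have "len (Suc m) b \<le> len m b"
    using b by (intro len_mono) auto
  ultimately show ?case
    using len_add[of "b + stable e" "Suc m" "ev ws"] len_add[of b "Suc m" "stable e"] b Cons.IH
    by (simp add: x)
qed simp

lemma reduced_concat_replicate:
  assumes "reduced (vs @ vs)"
  shows "reduced (concat (replicate n vs))"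
proof (induction n)
  case (Suc n)
  have "concat (replicate n vs) = [] \<or> hd (concat (replicate n vs)) = hd vs"
    by (cases n) (auto simp: hd_append)
  then show ?case
    using Suc assms by (auto simp: reduced_append_iff)
qed simp

lemma base_concat_replicate: "base vs \<Longrightarrow> base (concat (replicate n vs))"
  by (induction n) auto

lemma ev_concat_replicate: "ev (concat (replicate n vs)) = zpow (ev vs) (int n)"
  by (induction n) (simp_all add: zpow_Suc del: of_nat_Suc)

text \<open>Conjugates by g of base elements have syllable length at most twice that of g, while the
  n-th power of \<open>ev vs\<close> has n times the length of \<open>vs\<close>; n is the first
  number beyond that bound.\<close>

lemma elliptic_not_hyperbolic:
  assumes "u \<in> H m" "base vs" "vs \<noteq> []" "reduced (vs @ vs)" "g \<in> H (Suc m)"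
  shows "g + u \<noteq> ev vs + g"
proof
  assume "g + u = ev vs + g"
  then have conj: "g + u - g = ev vs" by simp
  define n where "n = 2 * syllable_length g + 1"
  have "g + zpow u (int n) - g = ev (concat (replicate n vs)) + 0"
    by (simp only: conj_zpow conj ev_concat_replicate add_0_right)
  moreover have "syllable_length (ev (concat (replicate n vs)) + 0) = n * length vs"
    using assms(2) reduced_concat_replicate[OF assms(4)]
    by (subst syllable_length_reduced)
      (auto simp: base_concat_replicate length_concat sum_list_replicate)
  moreover have "syllable_length (g + zpow u (int n) - g) \<le> 2 * syllable_length g"
    using syllable_length_conj[of g "zpow u (int n)"] assms by simp
  moreover have "n \<le> n * length vs" using assms(3) by (cases vs) auto
  ultimately show False by (simp add: n_def)
qed

lemma reduced_Cons: "reduced (x # us) \<longleftrightarrow> us = [] \<or> admissible x (hd us) \<and> reduced us"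
  by (auto simp: reduced_def successively_Cons)

lemma reduced_cycle:
  assumes "reduced ((x # us) @ (x # us))"
  shows "reduced ((us @ [x]) @ (us @ [x]))"
  using assms by (cases "us = []") (auto simp: reduced_append_iff reduced_Cons)

lemma reduced_cycle':
  assumes "reduced ((us @ [x]) @ (us @ [x]))"
  shows "reduced ((x # us) @ (x # us))"
  using assms by (cases "us = []") (auto simp: reduced_append_iff reduced_Cons)

text \<open>Collins' lemma. If the last letter of g cancels against the beginning or the end of
  \<open>us\<close>, rotating \<open>us\<close> by one syllable shortens g. If it cancels at neither
  end, then conjugation by g lengthens \<open>us\<close> by twice the length of g, and the result
  cannot be cyclically reduced.\<close>

lemma collins:
  assumes "base us" "us \<noteq> []" "reduced (us @ us)" "base vs" "vs \<noteq> []" "reduced (vs @ vs)"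
    and "g \<in> H (Suc m)" "g + ev us = ev vs + g"
  shows "\<exists>i. \<exists>h\<in>H m. h + ev (rotate i us) = ev vs + h"
  using assms(1-3,7,8)
proof (induction "syllable_length g" arbitrary: us g rule: less_induct)
  case less
  obtain gs c where gs: "g = ev gs + c" "reduced gs" "base gs" "c \<in> H m" "length gs = syllable_length g"
    using syllable_length_attained[OF less.prems(4)] .
  have *: ?case if "ev us' + x = x + ev us" "g + - x = g'" "syllable_length g' < length gs" "x \<in> H (Suc m)"
    "us' = rotate j us" "reduced (us' @ us')" for us' x g' j
  proof -
    note hyps = that
    have "g' + ev us' + x = g' + (x + ev us)"
      by (simp only: that(1) add.assoc)
    also have "\<dots> = g + ev us"
      by (simp only: that(2)[symmetric] add.assoc minus_add_cancel)
    also have "\<dots> = ev vs + g' + x"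
      by (simp only: that(2)[symmetric] less.prems(5) add.assoc left_minus add_0_right)
    finally have "g' + ev us' = ev vs + g'" by simp
    moreover have "g' \<in> H (Suc m)"
      using less.prems(4) that(2,4) by auto
    moreover have "base us'" "us' \<noteq> []"
      using less.prems that(5) by (simp_all add: base_def)
    ultimately obtain i h where "h \<in> H m" "h + ev (rotate i us') = ev vs + h"
      using less.hyps[of g' us'] hyps(3,6) gs(5) by auto
    then show ?thesis
      unfolding that(5) rotate_rotate by blast
  qed
  show ?case
  proof (cases gs rule: rev_cases)
    case Nil
    then show ?thesis
      using less.prems(5) gs(1,4) by (intro exI[of _ 0] bexI[of _ c]) auto
  next
    case (snoc gs' z)
    obtain b e where z: "z = (b, e)" by (cases z)
    have base': "base gs'" "b \<in> H m" using gs(3) by (auto simp: snoc z)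
    obtain b1 e1 us1 where us: "us = (b1, e1) # us1"
      using less.prems(2) by (cases us) auto
    obtain us0 bk ek where us': "us = us0 @ [(bk, ek)]"
      using less.prems(2) by (cases us rule: rev_cases) auto
    have b1: "b1 \<in> H m" "base us1" using less.prems(1) by (auto simp: us)
    have bk: "bk \<in> H m" using less.prems(1) by (auto simp: us')
    consider (left) "e1 = (\<not> e)" "c + b1 \<in> edge e1" | (right) "ek = e" "c \<in> edge (\<not> e)"
      | (none) "\<not> (e1 = (\<not> e) \<and> c + b1 \<in> edge e1)" "\<not> (ek = e \<and> c \<in> edge (\<not> e))"
      by blast
    then show ?thesis
    proof cases
      case left
      let ?x = "- (b1 + stable e1)"
      have "g + - ?x = ev gs' + (b + carry e1 (c + b1))"
        using pinch[OF left(2)] left(1) by (simp add: gs(1) snoc z add.assoc)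
      moreover have "syllable_length (ev gs' + (b + carry e1 (c + b1))) < length gs"
        using syllable_length_le[of gs' "b + carry e1 (c + b1)"] base' by (simp add: snoc)
      moreover have "ev (us1 @ [(b1, e1)]) + ?x = ?x + ev us"
      proof -
        define y where "y = b1 + stable e1"
        have "ev us = y + ev us1" "ev (us1 @ [(b1, e1)]) = ev us1 + y"
          by (simp_all add: us y_def add.assoc)
        then show ?thesis
          unfolding y_def[symmetric] by (simp add: add.assoc del: add_uminus_conv_diff)
      qed
      moreover have "us1 @ [(b1, e1)] = rotate 1 us" by (simp add: us)
      moreover have "?x \<in> H (Suc m)" using b1 by simp
      moreover have "reduced ((us1 @ [(b1, e1)]) @ (us1 @ [(b1, e1)]))"
        using less.prems(3) by (intro reduced_cycle) (simp add: us)
      ultimately show ?thesis by (intro *)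
    next
      case right
      let ?x = "bk + stable ek"
      have "g + - ?x = ev gs' + (b + carry (\<not> e) c - bk)"
        using pinch_left[OF right(2), of "- bk"] right(1)
        by (simp add: gs(1) snoc z add.assoc minus_add stable_Not diff_conv_add_uminus
            del: add_uminus_conv_diff)
      moreover have "syllable_length (ev gs' + (b + carry (\<not> e) c - bk)) < length gs"
        using syllable_length_le[of gs' "b + carry (\<not> e) c - bk"] base' bk by (simp add: snoc)
      moreover have "ev ((bk, ek) # us0) + ?x = ?x + ev us"
        by (simp add: us' add.assoc)
      moreover have "(bk, ek) # us0 = rotate (length us0) us"
        using rotate_append[of us0 "[(bk, ek)]"] by (simp add: us')
      moreover have "?x \<in> H (Suc m)" using bk by simp
      moreover have "reduced (((bk, ek) # us0) @ ((bk, ek) # us0))"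
        using less.prems(3) by (intro reduced_cycle') (simp add: us')
      ultimately show ?thesis by (intro *)
    next
      case none
      have "gs \<noteq> []" by (simp add: snoc)
      then obtain l d where l: "- ev gs = ev l + d" "base l" "reduced l" "d \<in> H m" "length l = length gs"
        "hd l = (0, \<not> snd (last gs))"
        using inverse_syllables[OF gs(3,2)] snoc by blast
      then obtain l' where l': "l = (0, \<not> e) # l'"
        by (cases l) (auto simp: snoc z)
      let ?M = "(c + b1, e1) # us1"
      let ?L = "gs @ ?M @ (- c, \<not> e) # l'"
      have last: "snd (last ?M) = ek"
        using us us' by (cases us1 rule: rev_cases) auto
      have "reduced us" using less.prems(3) by (simp add: reduced_append_iff)
      then have "reduced ?M"
        by (cases us1) (auto simp: us admissible_def)
      moreover have "reduced ((- c, \<not> e) # l')"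
        using l(3) unfolding l' by (cases l') (auto simp: admissible_def)
      moreover have "admissible (last gs) (hd ?M)"
        using none(1) by (auto simp: snoc z admissible_def)
      moreover have "admissible (last ?M) (- c, \<not> e)"
        using none(2) last by (cases ek; cases e) (auto simp: admissible_def)
      ultimately have "reduced ?L"
        using gs(2) by (simp only: reduced_append_iff) (auto simp: reduced_append_iff)
      then have len_L: "syllable_length (ev ?L + d) = length ?L"
        using gs(3,4) l(2,4) b1 by (intro syllable_length_reduced) (simp_all add: l')
      have "ev ?L + d = ev gs + (c + ev us) + (- c + (ev l + d))"
        by (simp add: us l' add.assoc)
      also have "\<dots> = g + ev us - g"
        unfolding gs(1) l(1)[symmetric] by (simp only: diff_conv_add_uminus minus_add add.assoc)
      also have "\<dots> = ev vs + 0"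
        by (simp add: less.prems(5))
      finally have L: "syllable_length (ev vs + 0) = 2 * length gs + length us"
        using len_L l(5) by (simp add: us l')
      have "reduced vs" using assms(6) by (simp add: reduced_append_iff)
      then have "length vs = 2 * length gs + length us"
        using L syllable_length_reduced[of vs 0] assms(4) by simp
      \<comment> \<open>The squares give the contradiction: the square of \<open>ev vs\<close> has
        twice the length of \<open>vs\<close>, but as a conjugate of the square of
        \<open>ev us\<close> it gains only \<open>2 * length gs\<close>, not twice that.\<close>
      moreover have "2 * length vs = syllable_length (ev (vs @ vs) + 0)"
        using syllable_length_reduced[OF assms(6), of 0] assms(4) by simp
      moreover have "ev (vs @ vs) + 0 = g + (ev (us @ us) + 0) - g"
      proof -
        have "g + (ev us + ev us) = ev vs + (g + ev us)"
          using less.prems(5) add.assoc[of g "ev us" "ev us"] add.assoc[of "ev vs" g "ev us"] by simp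
        also have "\<dots> = ev vs + ev vs + g"
          by (simp only: less.prems(5) add.assoc)
        finally show ?thesis by simp
      qed
      moreover have "syllable_length (g + (ev (us @ us) + 0) - g) \<le> 2 * length gs + 2 * length us"
        using syllable_length_conj[of g "ev (us @ us) + 0"] syllable_length_le[of "us @ us" 0]
          less.prems(1,4) gs(5) by simp
      ultimately show ?thesis
        by (simp add: snoc)
    qed
  qed
qed

text \<open>If p were not in the edge group, moving \<open>ev vs\<close> to the left side would give
  a reduced form with stable letters for the base element g'. So the first syllables differ by an
  edge element, which is carried on to the remaining equation.\<close>

lemma chain_step:
  assumes "reduced (x # us)" "base (x # us)" "reduced vs" "base vs" "g \<in> H m" "g' \<in> H m"
    and "g + ev (x # us) = ev vs + g'"
  obtains y vs' p where "vs = y # vs'" "snd y = snd x" "p \<in> edge (snd x)" "g + fst x = fst y + p"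
    "carry (snd x) p + ev us = ev vs' + g'"
proof -
  obtain b e where x: "x = (b, e)" by (cases x)
  have bx: "b \<in> H m" "base us" using assms(2) by (auto simp: x)
  have "reduced ((g + b, e) # us)"
    using assms(1) by (cases us) (auto simp: admissible_def x)
  then have "map snd ((g + b, e) # us) = map snd vs"
    using assms bx by (intro reduced_unique_exponents[of _ 0 vs g']) (auto simp: x add.assoc)
  then obtain y vs' where vs: "vs = y # vs'" and y_snd: "snd y = e"
    by (cases vs) auto
  define c where "c = fst y"
  have y: "y = (c, e)" using y_snd by (simp add: c_def prod_eq_iff)
  have c: "c \<in> H m" "base vs'" using assms(4) by (auto simp: vs y)
  define p where "p = - c + g + b"
  have "p \<in> edge e"
  proof (rule ccontr)
    assume not_edge: "p \<notin> edge e"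
    obtain l d where l: "- ev vs = ev l + d" "base l" "reduced l" "d \<in> H m" "length l = length vs"
      and ends: "vs \<noteq> [] \<Longrightarrow> hd l = (0, \<not> snd (last vs)) \<and> snd (last l) = (\<not> snd (hd vs)) \<and> d = - fst (hd vs)"
      using inverse_syllables[OF assms(4,3)] by blast
    have l_last: "snd (last l) = (\<not> e)" and d: "d = - c"
      using ends by (simp_all add: vs y)
    let ?L = "l @ (p, e) # us"
    have "reduced ((p, e) # us)"
      using assms(1) by (cases us) (auto simp: admissible_def x)
    then have "reduced ?L"
      using l(3) l_last not_edge by (auto simp: reduced_append_iff admissible_def)
    then have "syllable_length (ev ?L + 0) = length ?L"
      using l(2) bx c assms(5) by (intro syllable_length_reduced) (simp_all add: p_def)
    moreover have "ev ?L + 0 = - ev vs + (g + ev (x # us))"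
      by (simp add: l(1) d p_def x add.assoc diff_conv_add_uminus del: add_uminus_conv_diff)
    then have "ev ?L + 0 = g'"
      by (simp add: assms(7))
    ultimately show False
      using assms(6) by simp
  qed
  moreover have gp: "g + b = c + p"
    by (simp add: p_def add.assoc)
  moreover have "carry e p + ev us = ev vs' + g'"
  proof -
    have "c + (stable e + (carry e p + ev us)) = c + (p + stable e) + ev us"
      using edge_stable[OF \<open>p \<in> edge e\<close>] by (simp add: add.assoc)
    also have "\<dots> = g + b + stable e + ev us"
      by (simp add: gp add.assoc)
    also have "\<dots> = c + (stable e + (ev vs' + g'))"
      using assms(7) by (simp add: x vs y add.assoc)
    finally show ?thesis by simp
  qed
  ultimately show ?thesis
    using that[of y vs' p] vs y by (simp add: x)
qed

lemma exponent_chain: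
  assumes "b \<in> H m" "c \<in> H m" "zpow (gen m) j + b = c + zpow (gen m) k"
  shows "\<bar>k - j\<bar> \<le> int (len m b + len m c)"
proof -
  have "exponent_sum m (zpow (gen m) j + b) = exponent_sum m (c + zpow (gen m) k)"
    using assms(3) by simp
  then have "j + exponent_sum m b = exponent_sum m c + k"
    using assms(1,2) by (simp add: exponent_sum_add)
  then show ?thesis
    using exponent_sum_le[OF assms(1)] exponent_sum_le[OF assms(2)] by linarith
qed

text \<open>At the first base element that is not a power of s, \<open>key\<close> bounds the
  exponent. Going back from there, each stable letter at most doubles the exponent, and each pair of
  base elements shifts it by at most their lengths.\<close>

lemma chain_bound:
  assumes "1 \<le> K"
    and key: "\<And>b c p q. b \<in> H m \<Longrightarrow> c \<in> H m \<Longrightarrow> b \<notin> range (zpow (gen m)) \<Longrightarrow>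
      zpow (gen m) p + b = c + zpow (gen m) q \<Longrightarrow> nat \<bar>p\<bar> \<le> K * (len m b + len m c)"
    and "reduced us" "base us" "reduced vs" "base vs" "g' \<in> H m"
    and "zpow (gen m) j + ev us = ev vs + g'"
    and "\<exists>x\<in>set us. fst x \<notin> range (zpow (gen m))"
  shows "nat \<bar>j\<bar> \<le> 2 ^ length us * (K * (size_sum us + size_sum vs))"
  using assms(3-)
proof (induction us arbitrary: vs j)
  case (Cons x us)
  have "zpow (gen m) j \<in> H m" by simp
  then obtain y vs' p where y: "vs = y # vs'" "snd y = snd x" "p \<in> edge (snd x)"
    "zpow (gen m) j + fst x = fst y + p" "carry (snd x) p + ev us = ev vs' + g'"
    using chain_step[OF Cons.prems(1-4) _ Cons.prems(5,6)] by blast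
  obtain k where k: "p = zpow (gen m) k" "snd x \<longrightarrow> even k"
    using y(3) by (auto simp: edge_def)
  have mem: "fst x \<in> H m" "fst y \<in> H m" "base us" "base vs'" "reduced us" "reduced vs'"
    using Cons.prems y(1) reduced_ConsD by auto
  let ?S = "len m (fst x) + len m (fst y)" and ?T = "K * (size_sum us + size_sum vs')"
  have size: "K * (size_sum (x # us) + size_sum vs) = K * ?S + ?T"
    by (simp add: y(1) algebra_simps)
  have dist: "2 ^ length (x # us) * (K * (size_sum (x # us) + size_sum vs)) =
      2 ^ length (x # us) * (K * ?S) + 2 ^ length (x # us) * ?T"
    unfolding size by (rule distrib_left)
  have pow: "K * ?S \<le> 2 ^ length (x # us) * (K * ?S)"
    by simp
  show ?case
  proof (cases "fst x \<in> range (zpow (gen m))")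
    case False
    then have "nat \<bar>j\<bar> \<le> K * ?S"
      using key[OF mem(1,2) False] y(4) k(1) by simp
    then show ?thesis
      unfolding dist using pow by linarith
  next
    case True
    define k' where "k' = (if snd x then k div 2 else 2 * k)"
    have carry: "carry (snd x) p = zpow (gen m) k'"
      by (simp add: k carry_zpow k'_def)
    have "\<exists>z\<in>set us. fst z \<notin> range (zpow (gen m))"
      using Cons.prems(7) True by auto
    then have "nat \<bar>k'\<bar> \<le> 2 ^ length us * ?T"
      using Cons.IH[OF mem(5,3,6,4) Cons.prems(5), of k'] y(5) carry by simp
    moreover have "\<bar>k\<bar> \<le> 2 * \<bar>k'\<bar>"
      using k(2) by (auto simp: k'_def)
    moreover have "\<bar>k - j\<bar> \<le> int ?S"
      using exponent_chain[OF mem(1,2)] y(4) k(1) by simp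
    moreover have "?S \<le> K * ?S" using assms(1) by simp
    ultimately have "nat \<bar>j\<bar> \<le> K * ?S + 2 * (2 ^ length us * ?T)"
      by linarith
    also have "\<dots> \<le> 2 ^ length (x # us) * (K * (size_sum (x # us) + size_sum vs))"
      unfolding dist using pow by simp
    finally show ?thesis .
  qed
qed simp

fun height :: "syllables \<Rightarrow> int" where
  "height [] = 0"
| "height (x # ws) = (if snd x then 1 else - 1) + height ws"

text \<open>Each syllable shifts the exponent by at most the lengths of its base elements and then
  halves or doubles it, so the chain is an affine map of ratio 2 ^ (- height) up to an error. The
  bound on the ratio serves the induction, where it multiplies the earlier shift.\<close>

lemma chain_affine:
  assumes "reduced us" "base us" "reduced vs" "base vs" "g' \<in> H m"
    and "zpow (gen m) j + ev us = ev vs + g'"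
  shows "\<exists>j'. g' = zpow (gen m) j' \<and>
    \<bar>real_of_int j' - 2 powi (- height us) * real_of_int j\<bar> \<le> 2 ^ length us * real (size_sum us + size_sum vs) \<and>
    2 powi (- height us) \<le> (2::real) ^ length us"
  using assms
proof (induction us arbitrary: vs j)
  case Nil
  have "vs = []"
    using reduced_unique_exponents[of "[]" "zpow (gen m) j" vs g'] Nil by simp
  then show ?case using Nil by (intro exI[of _ j]) auto
next
  case (Cons x us)
  have "zpow (gen m) j \<in> H m" by simp
  then obtain y vs' p where y: "vs = y # vs'" "snd y = snd x" "p \<in> edge (snd x)"
    "zpow (gen m) j + fst x = fst y + p" "carry (snd x) p + ev us = ev vs' + g'"
    using chain_step[OF Cons.prems(1-4) _ Cons.prems(5,6)] by blast
  obtain k where k: "p = zpow (gen m) k" "snd x \<longrightarrow> even k"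
    using y(3) by (auto simp: edge_def)
  have mem: "fst x \<in> H m" "fst y \<in> H m" "base us" "base vs'" "reduced us" "reduced vs'"
    using Cons.prems y(1) reduced_ConsD by auto
  let ?S = "len m (fst x) + len m (fst y)"
  define k' where "k' = (if snd x then k div 2 else 2 * k)"
  have carry: "carry (snd x) p = zpow (gen m) k'"
    by (simp add: k carry_zpow k'_def)
  define w :: real where "w = 2 powi (- height us)"
  define v :: real where "v = (if snd x then 1 / 2 else 2)"
  have k': "real_of_int k' = v * real_of_int k"
    using k(2) by (auto simp: k'_def v_def real_of_int_div)
  have vw: "2 powi (- height (x # us)) = v * w"
    by (simp add: v_def w_def power_int_diff power_int_add power_int_minus field_simps)
  obtain j' where j': "g' = zpow (gen m) j'"
    "\<bar>real_of_int j' - w * real_of_int k'\<bar> \<le> 2 ^ length us * real (size_sum us + size_sum vs')"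
    "w \<le> 2 ^ length us"
    using Cons.IH[OF mem(5,3,6,4) Cons.prems(5), of k'] y(5) carry unfolding w_def by auto
  have w: "0 \<le> w" "0 \<le> v" "v \<le> 2" by (simp_all add: w_def v_def)
  have vw_le: "v * w \<le> 2 ^ length (x # us)"
    using mult_mono[OF w(3) j'(3)] w by simp
  have "\<bar>k - j\<bar> \<le> int ?S"
    using exponent_chain[OF mem(1,2)] y(4) k(1) by simp
  then have kj: "\<bar>real_of_int k - real_of_int j\<bar> \<le> real ?S"
    by linarith
  have "real_of_int j' - v * w * real_of_int j =
      (real_of_int j' - w * real_of_int k') + v * w * (real_of_int k - real_of_int j)"
    by (simp add: k' algebra_simps)
  then have "\<bar>real_of_int j' - v * w * real_of_int j\<bar> \<le>
      \<bar>real_of_int j' - w * real_of_int k'\<bar> + \<bar>v * w * (real_of_int k - real_of_int j)\<bar>"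
    by linarith
  also have "\<bar>v * w * (real_of_int k - real_of_int j)\<bar> = v * w * \<bar>real_of_int k - real_of_int j\<bar>"
    using w by (simp add: abs_mult)
  also have "\<dots> \<le> 2 ^ length (x # us) * real ?S"
    using vw_le kj w by (intro mult_mono) auto
  also have "\<bar>real_of_int j' - w * real_of_int k'\<bar> \<le> 2 ^ length (x # us) * real (size_sum us + size_sum vs')"
    using j'(2) by (rule order.trans) (intro mult_right_mono, auto)
  also have "2 ^ length (x # us) * real (size_sum us + size_sum vs') + 2 ^ length (x # us) * real ?S =
      2 ^ length (x # us) * real (size_sum (x # us) + size_sum vs)"
    by (simp add: y(1) algebra_simps)
  finally have "\<bar>real_of_int j' - v * w * real_of_int j\<bar> \<le>
      2 ^ length (x # us) * real (size_sum (x # us) + size_sum vs)"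
    by simp
  then show ?case
    using j'(1) vw_le unfolding vw by blast
qed

text \<open>Here \<open>us\<close> lies in the copy of BS(1,2) generated by s and t, where a power
  of t on the left clears the denominator of the dyadic translation part.\<close>

lemma ev_powers:
  assumes "\<forall>x\<in>set us. fst x \<in> range (zpow (gen m))"
  shows "\<exists>n i. zpow (gen (Suc m)) (int n) + ev us = zpow (gen m) i + zpow (gen (Suc m)) (int n + height us)"
  using assms
proof (induction us)
  case Nil
  then show ?case by (intro exI[of _ 0]) auto
next
  case (Cons x us)
  let ?t = "gen (Suc m)" and ?s = "gen m"
  obtain k e where x: "x = (zpow ?s k, e)"
    using Cons.prems by (cases x) auto
  obtain n i where IH: "zpow ?t (int n) + ev us = zpow ?s i + zpow ?t (int n + height us)"
    using Cons by auto
  have "zpow ?t (int (Suc n)) + ev (x # us) =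
      zpow ?s (2 ^ Suc n * k) + (zpow ?t (int (Suc n)) + stable e + ev us)"
    using stable_power_conj[of "Suc n" k] by (simp only: x ev.simps add.assoc[symmetric])
  also have "zpow ?t (int (Suc n)) + stable e + ev us =
      zpow ?s (if e then 4 * i else i) + zpow ?t (int (Suc n) + height (x # us))"
  proof (cases e)
    case True
    have "zpow ?t (int (Suc n)) + stable e + ev us = zpow ?t (int 2) + (zpow ?t (int n) + ev us)"
      using zpow_add[of ?t "int 2" "int n"] zpow_add[of ?t "int (Suc n)" 1] True
      by (simp add: stable_def add.commute flip: add.assoc)
    also have "\<dots> = zpow ?s (2 ^ 2 * i) + (zpow ?t (int 2) + zpow ?t (int n + height us))"
      by (simp only: IH stable_power_conj add.assoc[symmetric])
    finally show ?thesis
      using True by (simp add: x add.assoc flip: zpow_add)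
  next
    case False
    have "zpow ?t (int (Suc n)) + stable e = zpow ?t (int n)"
      using False by (simp only: zpow_Suc_right stable_def) simp
    then show ?thesis using False IH by (simp add: x)
  qed
  finally show ?case
    by (intro exI[of _ "Suc n"] exI[of _ "2 ^ Suc n * k + (if e then 4 * i else i)"])
      (simp only: zpow_add add.assoc)
qed

text \<open>At height 0 the element is a dyadic translation, and translations commute.\<close>

lemma ev_powers_commute:
  assumes "\<forall>x\<in>set us. fst x \<in> range (zpow (gen m))" "height us = 0"
  shows "zpow (gen m) j + ev us = ev us + zpow (gen m) j"
proof -
  let ?t = "gen (Suc m)" and ?s = "gen m"
  obtain n i where n: "zpow ?t (int n) + ev us = zpow ?s i + zpow ?t (int n)"
    using ev_powers[OF assms(1)] assms(2) by auto
  have "zpow ?t (int n) + (zpow ?s j + ev us) = zpow ?s (2 ^ n * j) + (zpow ?t (int n) + ev us)"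
    by (simp only: stable_power_conj add.assoc[symmetric])
  also have "\<dots> = zpow ?s i + zpow ?s (2 ^ n * j) + zpow ?t (int n)"
    by (simp only: n zpow_commute[of ?s "2 ^ n * j" i] add.assoc[symmetric])
  also have "\<dots> = zpow ?s i + zpow ?t (int n) + zpow ?s j"
    by (simp only: stable_power_conj add.assoc)
  also have "\<dots> = zpow ?t (int n) + (ev us + zpow ?s j)"
    by (simp only: n[symmetric] add.assoc)
  finally show ?thesis by simp
qed

lemma powi_2_dist_1: "k \<noteq> 0 \<Longrightarrow> 1 / 2 \<le> \<bar>1 - 2 powi k :: real\<bar>" for k :: int
proof (cases "k > 0")
  case True
  then have "(2::real) powi 1 \<le> 2 powi k"
    by (intro power_int_increasing) auto
  then show ?thesis by simp
next
  case False
  assume "k \<noteq> 0"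
  then have "(2::real) powi k \<le> 2 powi (- 1)"
    using False by (intro power_int_increasing) auto
  then show ?thesis by simp
qed

theorem hyperbolic_conjugate:
  assumes "1 \<le> K"
    and key: "\<And>b c p q. b \<in> H m \<Longrightarrow> c \<in> H m \<Longrightarrow> b \<notin> range (zpow (gen m)) \<Longrightarrow>
      zpow (gen m) p + b = c + zpow (gen m) q \<Longrightarrow> nat \<bar>p\<bar> \<le> K * (len m b + len m c)"
    and us: "base us" "us \<noteq> []" "reduced (us @ us)" and vs: "base vs" "vs \<noteq> []" "reduced (vs @ vs)"
    and g: "g \<in> H (Suc m)" "g + ev us = ev vs + g"
  obtains c where "c \<in> H (Suc m)" "c + ev us = ev vs + c"
    "len (Suc m) c \<le> 2 ^ Suc (length us) * (K * (size_sum us + size_sum vs)) + size_sum us + length us"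
proof -
  obtain i h where h: "h \<in> H m" "h + ev (rotate i us) = ev vs + h"
    using collins[OF us vs g] by blast
  define i' where "i' = i mod length us"
  have rot: "rotate i us = drop i' us @ take i' us"
    unfolding i'_def by (rule rotate_drop_take)
  define ws where "ws = drop i' us @ take i' us"
  define x where "x = ev (take i' us)"
  have size_us: "size_sum us = size_sum (take i' us) + size_sum (drop i' us)"
    by (metis append_take_drop_id size_sum_simps(3))
  then have size_ws: "size_sum ws = size_sum us" by (simp add: ws_def)
  have set_ws: "set ws = set us" by (metis ws_def rot set_rotate)
  have length_ws: "length ws = length us" by (metis ws_def rot length_rotate)
  have base_ws: "base ws" using us(1) set_ws by (simp add: base_def)
  have "reduced us" "reduced vs" using us(3) vs(3) by (simp_all add: reduced_append_iff)
  have red_ws: "reduced ws"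
  proof -
    have "take i' us @ ws @ drop i' us = us @ us" by (simp add: ws_def)
    then have "reduced (take i' us @ ws @ drop i' us)" using us(3) by simp
    then show ?thesis by (simp add: reduced_append_iff)
  qed
  have conj_h: "h + ev ws = ev vs + h" using h(2) by (simp add: rot ws_def)
  have ev_us: "ev us = x + ev (drop i' us)"
    unfolding x_def by (metis append_take_drop_id ev_append)
  have conj_x: "- x + ev us = ev ws + - x"
    by (simp add: ws_def ev_us add.assoc flip: x_def)
  have base_take: "base (take i' us)"
    using us(1) by (auto simp: base_def dest: in_set_takeD)
  then have x: "x \<in> H (Suc m)" by (simp add: x_def)
  have "len (Suc m) x \<le> size_sum (take i' us) + length (take i' us)"
    unfolding x_def using base_take by (rule len_ev)
  also have "\<dots> \<le> size_sum us + length us" using size_us by simp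
  finally have len_x: "len (Suc m) x \<le> size_sum us + length us" .
  \<comment> \<open>One application of \<open>chain_step\<close> turns h, so far any base element,
    into a power of s; by \<open>chain_affine\<close> the element at the end of the chain, again h,
    is then a power of s too.\<close>
  obtain j where j: "h = zpow (gen m) j"
  proof -
    obtain z ws' where ws': "ws = z # ws'"
      using us(2) length_ws by (cases ws) auto
    obtain y vs' p where y: "vs = y # vs'" "p \<in> edge (snd z)" "carry (snd z) p + ev ws' = ev vs' + h"
      using chain_step[of z ws' vs h h] red_ws base_ws vs(1) \<open>reduced vs\<close> h(1) conj_h unfolding ws' by metis
    have "base ws'" "reduced ws'" "base vs'" "reduced vs'"
      using red_ws base_ws vs(1) \<open>reduced vs\<close> reduced_ConsD by (auto simp: ws' y(1))
    then show ?thesis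
      using chain_affine[of ws' vs' h "if snd z then exponent_sum m p div 2 else 2 * exponent_sum m p"]
        y(3) h(1) that unfolding carry_def by blast
  qed
  define S where "S = size_sum us + size_sum vs"
  consider (bound) "nat \<bar>j\<bar> \<le> 2 ^ Suc (length us) * (K * S)" | (commute) "h + ev ws = ev ws + h"
  proof (cases "\<exists>x\<in>set ws. fst x \<notin> range (zpow (gen m))")
    case True
    then have "nat \<bar>j\<bar> \<le> 2 ^ length ws * (K * (size_sum ws + size_sum vs))"
    proof (intro chain_bound[OF assms(1) _ red_ws base_ws \<open>reduced vs\<close> vs(1) h(1)])
      show "zpow (gen m) j + ev ws = ev vs + h" using conj_h j by simp
    qed (rule key)
    also have "\<dots> \<le> 2 ^ Suc (length us) * (K * S)"
      by (simp add: size_ws length_ws S_def)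
    finally show ?thesis by (rule bound)
  next
    case False
    show ?thesis
    proof (cases "height ws = 0")
      case True
      then show ?thesis
        using commute False j ev_powers_commute by auto
    next
      case height: False
      obtain j' where j': "h = zpow (gen m) j'"
        "\<bar>real_of_int j' - 2 powi (- height ws) * real_of_int j\<bar> \<le> 2 ^ length ws * real (size_sum ws + size_sum vs)"
        using chain_affine[OF red_ws base_ws \<open>reduced vs\<close> vs(1) h(1), of j] conj_h j by metis
      then have "j' = j" using j by simp
      have "1 / 2 * real_of_int \<bar>j\<bar> \<le> \<bar>1 - 2 powi (- height ws)\<bar> * real_of_int \<bar>j\<bar>"
        using powi_2_dist_1[of "- height ws"] height by (intro mult_right_mono) auto
      also have "\<dots> = \<bar>real_of_int j' - 2 powi (- height ws) * real_of_int j\<bar>"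
        by (simp add: \<open>j' = j\<close> left_diff_distrib flip: abs_mult)
      also have "\<dots> \<le> 2 ^ length us * real S"
        using j'(2) by (simp add: size_ws length_ws S_def)
      finally have "real_of_int \<bar>j\<bar> \<le> real (2 ^ Suc (length us) * S)"
        by simp
      then have "nat \<bar>j\<bar> \<le> 2 ^ Suc (length us) * S"
        by linarith
      also have "\<dots> \<le> 2 ^ Suc (length us) * (K * S)"
        using assms(1) by simp
      finally show ?thesis by (rule bound)
    qed
  qed
  then show ?thesis
  proof cases
    case bound
    have "h + - x + ev us = ev vs + (h + - x)"
    proof -
      have "h + - x + ev us = h + (ev ws + - x)"
        by (simp only: add.assoc conj_x)
      also have "\<dots> = ev vs + (h + - x)"
        by (simp only: conj_h add.assoc[symmetric])
      finally show ?thesis .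
    qed
    moreover have "len (Suc m) h \<le> nat \<bar>j\<bar>"
      using len_zpow_gen[of m "Suc m" j] j by simp
    then have "len (Suc m) (h + - x) \<le> 2 ^ Suc (length us) * (K * S) + size_sum us + length us"
      using len_add[of h "Suc m" "- x"] h(1) x len_x bound by simp
    ultimately show ?thesis
      using that[of "h + - x"] h(1) x by (simp add: S_def)
  next
    case commute
    then have "ev vs + h = ev ws + h"
      using conj_h by simp
    then have "- x + ev us = ev vs + - x"
      using conj_x by simp
    then show ?thesis
      using that[of "- x"] x len_x by simp
  qed
qed

end

section \<open>The Baumslag-Solitar group \<open>BS(1,2)\<close>\<close>

lemma gen_1_conj: "gen 1 + zpow (gen 0) k = zpow (gen 0) (2 * k) + gen 1"
  using conj_zpow_double[OF gen_rel[of 0], of k] by simp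

lemma gen_1_power_conj:
  "zpow (gen 1) (int n) + zpow (gen 0) k = zpow (gen 0) (2 ^ n * k) + zpow (gen 1) (int n)"
  using hnn_level.stable_power_conj[of 0 n k] by simp

text \<open>Horner's scheme in base 2: doubling costs two letters \<open>gen 1\<close> and the next
  binary digit at most one \<open>gen 0\<close>.\<close>

lemma len_zpow_gen_0_nat:
  "W < 2 ^ j \<Longrightarrow> len 1 (zpow (gen 0) (int W)) \<le> 3 * j"
proof (induction j arbitrary: W)
  case (Suc j)
  define V where "V = W div 2"
  have W: "int W = 2 * int V + int (W mod 2)" using div_mult_mod_eq[of W 2] unfolding V_def by linarith
  have "V < 2 ^ j" using Suc.prems by (simp add: V_def)
  then have IH: "len 1 (zpow (gen 0) (int V)) \<le> 3 * j" by (rule Suc.IH)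
  have "zpow (gen 0) (int W) = gen 1 + zpow (gen 0) (int V) - gen 1 + zpow (gen 0) (int (W mod 2))"
    by (simp only: W zpow_add gen_1_conj add_diff_cancel)
  then have "len 1 (zpow (gen 0) (int W)) \<le> len 1 (gen 1 + zpow (gen 0) (int V) - gen 1) +
      len 1 (zpow (gen 0) (int (W mod 2)))"
    using len_add[of "gen 1 + zpow (gen 0) (int V) - gen 1" 1] by simp
  also have "\<dots> \<le> (1 + 3 * j + 1) + 1"
  proof (rule add_mono)
    show "len 1 (gen 1 + zpow (gen 0) (int V) - gen 1) \<le> 1 + 3 * j + 1"
      using len_diff[of "gen 1 + zpow (gen 0) (int V)" 1 "gen 1"] len_add[of "gen 1" 1 "zpow (gen 0) (int V)"]
        len_gen[of 1 1] IH by simp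
    show "len 1 (zpow (gen 0) (int (W mod 2))) \<le> 1"
      using len_zpow_gen[of 0 1 "int (W mod 2)"] by simp
  qed
  finally show ?case by simp
qed simp

lemma len_zpow_gen_0:
  assumes "\<bar>W\<bar> < 2 ^ j"
  shows "len 1 (zpow (gen 0) W) \<le> 3 * j"
proof -
  have "int (nat \<bar>W\<bar>) < 2 ^ j" using assms by simp
  then have "nat \<bar>W\<bar> < 2 ^ j"
    by (metis of_nat_less_iff of_nat_numeral of_nat_power)
  then have *: "len 1 (zpow (gen 0) (int (nat \<bar>W\<bar>))) \<le> 3 * j"
    by (rule len_zpow_gen_0_nat)
  show ?thesis
  proof (cases "W \<ge> 0")
    case True
    then show ?thesis using * by simp
  next
    case False
    then have "zpow (gen 0) W = - zpow (gen 0) (int (nat \<bar>W\<bar>))"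
      by (simp flip: zpow_minus)
    then show ?thesis using * by simp
  qed
qed

text \<open>In BS(1,2), \<open>gen 0\<close> acts on the line as translation by 1 and
  \<open>gen 1\<close> as doubling. Doubling as often as the word is long makes the translation part
  integral.\<close>

lemma affine_form_word:
  assumes "w \<in> words (BS_gens 1)"
  shows "\<exists>X k. zpow (gen 1) (int (length w)) + val w = zpow (gen 0) X + zpow (gen 1) k \<and> \<bar>X\<bar> \<le> 4 ^ length w"
  using assms
proof (induction w)
  case Nil
  then show ?case by (intro exI[of _ 0]) (simp add: val_Nil)
next
  case (Cons a w)
  obtain i b where a: "a = (i, b)" by (cases a)
  let ?a = "gen 0" and ?t = "gen 1" and ?n = "length w"
  obtain X k where IH: "zpow ?t (int ?n) + val w = zpow ?a X + zpow ?t k" "\<bar>X\<bar> \<le> 4 ^ ?n"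
    using Cons by auto
  have t_IH: "?t + (zpow ?t (int ?n) + val w) = zpow ?a (2 * X) + zpow ?t (k + 1)"
    by (simp only: IH(1) gen_1_conj add.assoc[symmetric]) (simp only: add.assoc zpow_add_1[symmetric])
  have Suc_n: "zpow ?t (int (length (a # w))) = ?t + zpow ?t (int ?n)"
    by (simp only: list.size zpow_add_1[symmetric]) (simp add: add.commute)
  consider "i = 0" | "i = 1" "b" | "i = 1" "\<not> b"
    using Cons.prems a by (fastforce simp: BS_gens_def)
  then show ?case
  proof cases
    case 1
    define d :: int where "d = (if b then 1 else - 1)"
    have val: "val (a # w) = zpow ?a d + val w"
      by (simp add: a 1 val_Cons d_def)
    have "zpow ?t (int (length (a # w))) + val (a # w) =
        zpow ?a (2 ^ length (a # w) * d) + (?t + zpow ?t (int ?n) + val w)"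
      unfolding val add.assoc[symmetric] gen_1_power_conj by (simp only: Suc_n add.assoc)
    also have "\<dots> = zpow ?a (2 ^ length (a # w) * d + 2 * X) + zpow ?t (k + 1)"
      unfolding add.assoc t_IH by (simp only: zpow_add add.assoc)
    finally have eq: "zpow ?t (int (length (a # w))) + val (a # w) =
        zpow ?a (2 ^ length (a # w) * d + 2 * X) + zpow ?t (k + 1)" .
    have "\<bar>2 ^ length (a # w) * d + 2 * X\<bar> \<le> \<bar>2 ^ length (a # w) * d\<bar> + \<bar>2 * X\<bar>"
      by (rule abs_triangle_ineq)
    also have "\<dots> \<le> 2 * 2 ^ ?n + 2 * 4 ^ ?n"
      using IH(2) by (simp add: abs_mult d_def)
    also have "\<dots> \<le> 4 ^ length (a # w)"
      using power_mono[of 2 "4 :: int" ?n] by simp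
    finally show ?thesis using eq by blast
  next
    case 2
    have comm: "zpow ?t (int (length (a # w))) + ?t = ?t + zpow ?t (int (length (a # w)))"
      using zpow_commute[of ?t "int (length (a # w))" 1] by (simp only: zpow_1)
    have "zpow ?t (int (length (a # w))) + val (a # w) = zpow ?t (int (length (a # w))) + ?t + val w"
      by (simp only: a val_Cons 2 if_True add.assoc)
    also have "\<dots> = ?t + (?t + zpow ?t (int ?n) + val w)"
      unfolding comm by (simp only: Suc_n add.assoc)
    also have "\<dots> = ?t + (?t + (zpow ?t (int ?n) + val w))"
      by (simp only: add.assoc)
    also have "\<dots> = zpow ?a (4 * X) + zpow ?t (k + 1 + 1)"
      unfolding t_IH by (simp only: gen_1_conj add.assoc[symmetric])
        (simp only: add.assoc zpow_add_1[symmetric], simp)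
    finally show ?thesis
      using IH(2) by (intro exI[of _ "4 * X"] exI[of _ "k + 1 + 1"]) (simp add: abs_mult)
  next
    case 3
    have "zpow ?t (int (length (a # w))) = zpow ?t (int ?n) + ?t"
      unfolding Suc_n using zpow_commute[of ?t "int ?n" 1] by simp
    then have "zpow ?t (int (length (a # w))) + val (a # w) = zpow ?t (int ?n) + val w"
      by (simp only: a val_Cons 3 if_False add.assoc add_minus_cancel)
    then show ?thesis
      using IH by (intro exI[of _ X] exI[of _ k]) auto
  qed
qed

lemma affine_form:
  assumes "g \<in> H 1"
  obtains X k where "zpow (gen 1) (int (len 1 g)) + g = zpow (gen 0) X + zpow (gen 1) k"
    "\<bar>X\<bar> \<le> 4 ^ len 1 g"
  using len_attained[OF assms] affine_form_word by metis

lemma mersenne_dvd: "(2::int) ^ k - 1 dvd 2 ^ (k * j) - 1"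
proof (induction j)
  case (Suc j)
  have "(2::int) ^ (k * Suc j) - 1 = 2 ^ (k * j) * (2 ^ k - 1) + (2 ^ (k * j) - 1)"
    by (simp add: power_add algebra_simps)
  then show ?case using Suc by (metis dvd_add dvd_triv_right)
qed simp

lemma affine_mult:
  "zpow (gen 0) X + zpow (gen 1) (int n) + (zpow (gen 0) Y + zpow (gen 1) k) =
    zpow (gen 0) (X + 2 ^ n * Y) + zpow (gen 1) (int n + k)"
proof -
  have "zpow (gen 0) X + zpow (gen 1) (int n) + (zpow (gen 0) Y + zpow (gen 1) k) =
      zpow (gen 0) X + (zpow (gen 1) (int n) + zpow (gen 0) Y) + zpow (gen 1) k"
    by (simp only: add.assoc)
  then show ?thesis
    by (simp only: gen_1_power_conj zpow_add add.assoc)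
qed

text \<open>For \<open>k > 0\<close> the affine maps \<open>x \<mapsto> 2 ^ k x + X\<close> and \<open>x \<mapsto> 2 ^ k x + Y\<close> are conjugate by
  \<open>x \<mapsto> 2 ^ r x + W\<close> iff \<open>2 ^ r X - Y = (2 ^ k - 1) W\<close>, and \<open>r\<close> matters only modulo \<open>k\<close>.\<close>

lemma affine_conjugate:
  assumes g: "g \<in> H 1" and eq: "g + (zpow (gen 0) X + zpow (gen 1) (int k)) = zpow (gen 0) Y + zpow (gen 1) (int k) + g"
    and X: "\<bar>X\<bar> \<le> 8 ^ n" and Y: "\<bar>Y\<bar> \<le> 8 ^ n" and k: "k \<le> n"
  shows "\<exists>c\<in>H 1. c + (zpow (gen 0) X + zpow (gen 1) (int k)) = zpow (gen 0) Y + zpow (gen 1) (int k) + c \<and>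
    len 1 c \<le> 13 * n + 6"
proof -
  let ?a = "gen 0" and ?t = "gen 1"
  obtain Z0 r where Z0: "zpow ?t (int (len 1 g)) + g = zpow ?a Z0 + zpow ?t r"
    using affine_form[OF g] by metis
  \<comment> \<open>Further factors \<open>gen 1\<close> on the left make the exponent of
    \<open>gen 1\<close> on the right nonnegative as well, as \<open>affine_mult\<close>
    requires.\<close>
  define d where "d = nat \<bar>r\<bar>"
  define P where "P = d + len 1 g"
  define Z where "Z = 2 ^ d * Z0"
  have "0 \<le> int d + r" by (simp add: d_def)
  then obtain R where R: "int d + r = int R" by (rule nonneg_int_cases)
  have gZ: "zpow ?t (int P) + g = zpow ?a Z + zpow ?t (int R)"
  proof -
    have "zpow ?t (int P) + g = zpow ?t (int d) + (zpow ?a Z0 + zpow ?t r)"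
      by (simp only: P_def of_nat_add zpow_add add.assoc Z0)
    then show ?thesis
      using affine_mult[of 0 d Z0 r] R by (simp add: Z_def)
  qed
  have pow8: "\<bar>V\<bar> < 2 ^ (4 * n + 2)" if "\<bar>V\<bar> \<le> 2 ^ n * 8 ^ n + 8 ^ n" for V :: int
  proof -
    have "(8::int) ^ n \<le> 16 ^ n" by (intro power_mono) auto
    moreover have "(2::int) ^ n * 8 ^ n = 16 ^ n" by (simp flip: power_mult_distrib)
    ultimately have "\<bar>V\<bar> \<le> 2 * 16 ^ n" using that by simp
    also have "\<dots> < 4 * (16::int) ^ n" by simp
    also have "(4::int) * 16 ^ n = 2 ^ (4 * n + 2)"
      by (simp add: power_mult power_add)
    finally show ?thesis .
  qed
  have "zpow ?t (int P) + (g + (zpow ?a X + zpow ?t (int k))) = zpow ?a Z + zpow ?t (int R) + (zpow ?a X + zpow ?t (int k))"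
    by (simp only: gZ[symmetric] add.assoc)
  also have "\<dots> = zpow ?a (Z + 2 ^ R * X) + zpow ?t (int R + int k)"
    by (rule affine_mult)
  finally have lhs: "zpow ?t (int P) + (g + (zpow ?a X + zpow ?t (int k))) =
    zpow ?a (Z + 2 ^ R * X) + zpow ?t (int R + int k)" .
  have "zpow ?t (int P) + (zpow ?a Y + zpow ?t (int k) + g) =
      zpow ?a (2 ^ P * Y) + (zpow ?t (int P) + zpow ?t (int k) + g)"
    using affine_mult[of 0 P Y "int k"] by (simp add: zpow_add flip: add.assoc)
  also have "\<dots> = zpow ?a (2 ^ P * Y) + (zpow ?t (int k) + (zpow ?t (int P) + g))"
    by (simp only: zpow_commute[of ?t "int P"] add.assoc)
  also have "\<dots> = zpow ?a (2 ^ P * Y) + zpow ?t (int k) + (zpow ?a Z + zpow ?t (int R))"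
    by (simp only: gZ add.assoc)
  also have "\<dots> = zpow ?a (2 ^ P * Y + 2 ^ k * Z) + zpow ?t (int R + int k)"
    unfolding affine_mult by (simp add: add.commute)
  finally have rhs: "zpow ?t (int P) + (zpow ?a Y + zpow ?t (int k) + g) =
    zpow ?a (2 ^ P * Y + 2 ^ k * Z) + zpow ?t (int R + int k)" .
  have "Z + 2 ^ R * X = 2 ^ P * Y + 2 ^ k * Z"
    using lhs rhs eq by simp
  then have main: "2 ^ R * X - 2 ^ P * Y = (2 ^ k - 1) * Z"
    by (simp add: algebra_simps)
  have sol: ?thesis if W: "2 ^ r * X - Y = (2 ^ k - 1) * W" "r \<le> n" "\<bar>W\<bar> \<le> 2 ^ n * 8 ^ n + 8 ^ n" for W and r :: nat
  proof -
    let ?c = "zpow ?a W + zpow ?t (int r)"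
    have "W + 2 ^ r * X = Y + 2 ^ k * W"
      using W(1) by (simp add: algebra_simps)
    then have "?c + (zpow ?a X + zpow ?t (int k)) = zpow ?a Y + zpow ?t (int k) + ?c"
      unfolding affine_mult by (simp add: add.commute)
    moreover have "len 1 ?c \<le> 13 * n + 6"
      using len_add[of "zpow ?a W" 1 "zpow ?t (int r)"] len_zpow_gen_0[OF pow8[OF W(3)]]
        len_zpow_gen[of 1 1 "int r"] W(2) by simp
    ultimately show ?thesis
      by (intro bexI[of _ ?c]) auto
  qed
  show ?thesis
  proof (cases "k = 0")
    case True
    \<comment> \<open>For k = 0 both elements are translations, conjugate by a power of
      \<open>gen 1\<close> alone.\<close>
    then have "Y * 2 ^ P = X * 2 ^ R" using main by (simp add: mult.commute)
    then obtain r where r: "zpow ?t r + zpow ?a X = zpow ?a Y + zpow ?t r" "2 ^ nat \<bar>r\<bar> \<le> \<bar>X\<bar> + \<bar>Y\<bar> + 1"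
      using hnn_level.stable_power_connects[of Y P X R 0] by (metis One_nat_def)
    have "(1::int) \<le> 8 ^ n" by simp
    then have "2 ^ nat \<bar>r\<bar> \<le> 4 * (8::int) ^ n" using r(2) X Y by linarith
    also have "\<dots> = 2 ^ (3 * n + 2)" by (simp add: power_mult power_add)
    finally have "nat \<bar>r\<bar> \<le> 3 * n + 2" by (simp only: power_increasing_iff[of "2 :: int"])
    then show ?thesis
      using True r(1) len_zpow_gen[of 1 1 r] by (intro bexI[of _ "zpow ?t r"]) auto
  next
    case False
    define Q :: int where "Q = 2 ^ k - 1"
    \<comment> \<open>Multiplying \<open>main\<close> by 2 ^ (P * (k - 1)) raises the power at Y to
      2 ^ (k * P), which is 1 modulo Q. So 2 ^ T * X is congruent to Y, and T may be reduced modulo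
      k.\<close>
    define T where "T = R + P * (k - 1)"
    define r where "r = T mod k"
    have "P + P * (k - 1) = k * P"
      using False by (cases k) auto
    then have "2 ^ (P * (k - 1)) * (2 ^ R * X - 2 ^ P * Y) = 2 ^ T * X - 2 ^ (k * P) * Y"
      by (simp add: T_def power_add algebra_simps flip: power_add)
    then have dvd1: "Q dvd 2 ^ T * X - 2 ^ (k * P) * Y"
      unfolding main Q_def by (metis dvd_mult dvd_triv_left)
    have T: "T = r + k * (T div k)" by (simp add: r_def)
    have "2 ^ r * X - Y = (2 ^ T * X - 2 ^ (k * P) * Y) -
        (2 ^ (k * (T div k)) - 1) * (2 ^ r * X) + (2 ^ (k * P) - 1) * Y"
      by (subst T) (simp add: power_add algebra_simps)
    moreover have "Q dvd (2 ^ (k * (T div k)) - 1) * (2 ^ r * X)" "Q dvd (2 ^ (k * P) - 1) * Y"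
      unfolding Q_def by (intro dvd_mult2 mersenne_dvd)+
    ultimately have "Q dvd 2 ^ r * X - Y"
      using dvd1 dvd_add dvd_diff by metis
    then obtain W where W: "2 ^ r * X - Y = Q * W" by blast
    have "1 \<le> Q"
    proof -
      have "(2::int) ^ 1 \<le> 2 ^ k" using False by (intro power_increasing) auto
      then show ?thesis by (simp add: Q_def)
    qed
    have "r < k" using False by (simp add: r_def)
    then have "r \<le> n" using k by simp
    have "\<bar>W\<bar> \<le> Q * \<bar>W\<bar>"
      using mult_right_mono[OF \<open>1 \<le> Q\<close>, of "\<bar>W\<bar>"] by simp
    also have "\<dots> = \<bar>2 ^ r * X - Y\<bar>"
      using \<open>1 \<le> Q\<close> by (simp add: W abs_mult)
    also have "\<dots> \<le> 2 ^ r * \<bar>X\<bar> + \<bar>Y\<bar>"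
      using abs_triangle_ineq4[of "2 ^ r * X" Y] by (simp add: abs_mult)
    also have "\<dots> \<le> 2 ^ n * 8 ^ n + 8 ^ n"
      using X Y \<open>r \<le> n\<close> by (intro add_mono mult_mono power_increasing) auto
    finally show ?thesis
      using sol[of r W] W \<open>r \<le> n\<close> by (simp add: Q_def)
  qed
qed

text \<open>The constant stays inside \<open>E\<close>, where the exponential of the next level
  absorbs the factors it brings.\<close>

definition conj_bound :: "nat \<Rightarrow> nat \<Rightarrow> bool" where
  "conj_bound m C \<longleftrightarrow> (\<forall>g\<in>H m. \<forall>h\<in>H m. \<forall>c\<in>H m. c + g = h + c \<longrightarrow>
     (\<exists>d\<in>H m. d + g = h + d \<and> len m d \<le> E (m - 1) (C * (len m g + len m h) + C)))"

text \<open>Conjugating g and h by powers of \<open>gen 1\<close> as large as their lengths makes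
  the translation parts integral; the exponents of \<open>gen 1\<close> agree because the exponent
  sum is invariant under conjugation. Then \<open>affine_conjugate\<close> gives 13 n + 6, and the
  two powers cost another n.\<close>

lemma conj_bound_1: "conj_bound 1 15"
  unfolding conj_bound_def
proof (intro ballI impI)
  fix g h c
  assume g: "g \<in> H 1" and h: "h \<in> H 1" and c: "c \<in> H 1" and eq: "c + g = h + c"
  let ?a = "gen 0" and ?t = "gen 1"
  define n where "n = len 1 g + len 1 h"
  have pow4: "(4::int) ^ j \<le> 4 ^ n" if "j \<le> n" for j
    using that by (intro power_increasing) auto
  obtain X k where X: "zpow ?t (int (len 1 g)) + g = zpow ?a X + zpow ?t k" "\<bar>X\<bar> \<le> 4 ^ len 1 g"
    using affine_form[OF g] .
  obtain Y l where Y: "zpow ?t (int (len 1 h)) + h = zpow ?a Y + zpow ?t l" "\<bar>Y\<bar> \<le> 4 ^ len 1 h"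
    using affine_form[OF h] .
  define tg where "tg = zpow ?t (int (len 1 g))"
  define th where "th = zpow ?t (int (len 1 h))"
  have mem: "tg \<in> H 1" "th \<in> H 1" by (simp_all add: tg_def th_def)
  define k' where "k' = k - int (len 1 g)"
  define l' where "l' = l - int (len 1 h)"
  have X': "tg + g = zpow ?a X + zpow ?t k' + tg"
    using X(1) zpow_add[of ?t k' "int (len 1 g)"] by (simp add: tg_def k'_def add.assoc)
  have Y': "th + h = zpow ?a Y + zpow ?t l' + th"
    using Y(1) zpow_add[of ?t l' "int (len 1 h)"] by (simp add: th_def l'_def add.assoc)
  have XY: "\<bar>X\<bar> \<le> 4 ^ n" "\<bar>Y\<bar> \<le> 4 ^ n"
    using order.trans[OF X(2) pow4] order.trans[OF Y(2) pow4] by (simp_all add: n_def)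
  define q where "q = exponent_sum 1"
  have q_add: "q (x + y) = q x + q y" if "x \<in> H 1" "y \<in> H 1" for x y
    using that unfolding q_def by (rule exponent_sum_add)
  \<comment> \<open>\<open>gen 0\<close> is conjugate to its square, so additivity of q forces the
    value 0.\<close>
  have q_a: "q (zpow ?a V) = 0" for V
  proof -
    have "q (?t + zpow ?a V) = q (zpow ?a (2 * V) + ?t)"
      by (simp only: gen_1_conj)
    moreover have "q (zpow ?a (2 * V)) = q (zpow ?a V) + q (zpow ?a V)"
      using q_add[of "zpow ?a V" "zpow ?a V"] by (simp flip: zpow_add)
    ultimately show ?thesis using q_add[of ?t "zpow ?a V"] q_add[of "zpow ?a (2 * V)" ?t] by simp
  qed
  have q_t: "q (zpow ?t j) = j" for j
    unfolding q_def by simp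
  have "q g = k'"
    using arg_cong[OF X', of q] g mem by (simp add: q_add q_a q_t del: One_nat_def)
  moreover have "q h = l'"
    using arg_cong[OF Y', of q] h mem by (simp add: q_add q_a q_t del: One_nat_def)
  moreover have "q g = q h"
    using arg_cong[OF eq, of q] g h c by (simp add: q_add)
  ultimately have l': "l' = k'" by simp
  have "\<bar>q g\<bar> \<le> int (len 1 g)"
    unfolding q_def using g by (rule exponent_sum_le)
  then have k': "\<bar>k'\<bar> \<le> int n"
    using \<open>q g = k'\<close> by (simp add: n_def)
  let ?u = "zpow ?a X + zpow ?t k'" and ?v = "zpow ?a Y + zpow ?t k'"
  let ?c = "th + c - tg"
  have conj: "?c + ?u = ?v + ?c"
  proof -
    have "?c + ?u + tg = th + (c + g)"
      by (simp only: diff_conv_add_uminus add.assoc X'[unfolded add.assoc, symmetric] minus_add_cancel)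
    also have "\<dots> = ?v + th + c"
      using Y' unfolding eq l' by (simp flip: add.assoc)
    also have "\<dots> = ?v + ?c + tg"
      by (simp add: add.assoc)
    finally show ?thesis by simp
  qed
  have c': "?c \<in> H 1" using c mem by simp
  have "\<exists>d\<in>H 1. d + ?u = ?v + d \<and> len 1 d \<le> 13 * n + 6"
  proof (cases "k' \<ge> 0")
    case True
    have "(4::int) ^ n \<le> 8 ^ n" by (intro power_mono) auto
    then show ?thesis
      using affine_conjugate[OF c', of X "nat k'" Y n] conj True XY k' by auto
  next
    case False
    \<comment> \<open>Inverting both elements makes the exponent positive. It turns a translation
      part V into - 2 ^ K * V, which is why \<open>affine_conjugate\<close> allows 8 ^ n where the
      forms give 4 ^ n.\<close>
    define K where "K = nat (- k')"
    have inv: "- (zpow ?a V + zpow ?t k') = zpow ?a (2 ^ K * - V) + zpow ?t (int K)" for V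
      using False gen_1_power_conj[of K "- V"]
      by (simp add: K_def minus_add diff_conv_add_uminus flip: zpow_minus del: add_uminus_conv_diff)
    have conj_inv: "d + - y = - x + d \<longleftrightarrow> d + y = x + d" for d x y :: tower
    proof
      assume "d + - y = - x + d"
      then have "x + (d + - y) + y = x + (- x + d) + y" by (simp only:)
      then show "d + y = x + d" by (simp add: add.assoc del: add_uminus_conv_diff)
    next
      assume "d + y = x + d"
      then have "- x + (d + y) + - y = - x + (x + d) + - y" by (simp only:)
      then show "d + - y = - x + d" by (simp add: add.assoc del: add_uminus_conv_diff)
    qed
    have K: "K \<le> n" using k' False by (simp add: K_def)
    have bound: "\<bar>2 ^ K * - V\<bar> \<le> 8 ^ n" if "\<bar>V\<bar> \<le> 4 ^ n" for V :: int
    proof -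
      have "\<bar>2 ^ K * - V\<bar> = 2 ^ K * \<bar>V\<bar>" by (simp add: abs_mult)
      also have "\<dots> \<le> 2 ^ n * 4 ^ n"
        using that K by (intro mult_mono power_increasing) auto
      also have "\<dots> = (8::int) ^ n" by (simp flip: power_mult_distrib)
      finally show ?thesis .
    qed
    have "\<exists>d\<in>H 1. d + - ?u = - ?v + d \<and> len 1 d \<le> 13 * n + 6"
      unfolding inv
    proof (rule affine_conjugate[OF c' _ bound[OF XY(1)] bound[OF XY(2)] K])
      show "?c + (zpow ?a (2 ^ K * - X) + zpow ?t (int K)) =
          zpow ?a (2 ^ K * - Y) + zpow ?t (int K) + ?c"
        unfolding inv[symmetric] conj_inv by (rule conj)
    qed
    then show ?thesis unfolding conj_inv .
  qed
  then obtain d where d: "d \<in> H 1" "d + ?u = ?v + d" "len 1 d \<le> 13 * n + 6"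
    by blast
  let ?d = "- th + d + tg"
  have "th + (?d + g) = d + (tg + g)"
    by (simp add: add.assoc)
  also have "\<dots> = d + ?u + tg"
    by (simp only: X' add.assoc)
  also have "\<dots> = ?v + d + tg"
    by (simp only: d(2))
  also have "\<dots> = ?v + th + ?d"
    by (simp add: add.assoc)
  also have "\<dots> = th + (h + ?d)"
    by (simp only: Y'[unfolded l', symmetric] add.assoc[of th h])
  finally have "?d + g = h + ?d" by simp
  moreover have "len 1 ?d \<le> E (1 - 1) (15 * (len 1 g + len 1 h) + 15)"
  proof -
    have "len 1 tg \<le> len 1 g" "len 1 th \<le> len 1 h"
      using len_zpow_gen[of 1 1 "int (len 1 g)"] len_zpow_gen[of 1 1 "int (len 1 h)"]
      by (simp_all add: tg_def th_def)
    then have "len 1 ?d \<le> 14 * n + 6"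
      using len_add[of "- th + d" 1 tg] len_add[of "- th" 1 d] mem d by (simp add: n_def)
    then show ?thesis by (simp add: n_def)
  qed
  ultimately show "\<exists>d\<in>H 1. d + g = h + d \<and> len 1 d \<le> E (1 - 1) (15 * (len 1 g + len 1 h) + 15)"
    using d mem by (intro bexI[of _ ?d]) auto
qed

section \<open>The upper bound\<close>

lemma le_E: "n \<le> E k n"
proof (induction k)
  case (Suc k)
  moreover have "E k n < 2 ^ E k n" by (rule less_exp)
  ultimately have "n \<le> 2 ^ E k n" by linarith
  then show ?case by simp
qed simp

lemma E_mono: "a \<le> b \<Longrightarrow> E k a \<le> E k b"
  by (induction k) auto

lemma E_shift: "E k (2 ^ n) = E (Suc k) n"
  by (induction k) auto

text \<open>Gathers the lengths of several conjugators in one value of \<open>E\<close>. The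
  arguments are positive because 2 ^ 0 + 2 ^ b exceeds 2 ^ (0 + b).\<close>

lemma E_add:
  assumes "1 \<le> a" "1 \<le> b"
  shows "E k a + E k b \<le> E k (a + b)"
proof (induction k)
  case (Suc k)
  let ?x = "E k a" and ?y = "E k b"
  have "1 \<le> ?x" "1 \<le> ?y" using assms le_E[of a k] le_E[of b k] by linarith+
  then obtain x y where xy: "?x = Suc x" "?y = Suc y" by (metis Suc_le_D One_nat_def)
  have "(1::nat) \<le> 2 ^ x" "(1::nat) \<le> 2 ^ y" by simp_all
  then have "(2::nat) ^ x + 2 ^ y \<le> 2 * (2 ^ x * 2 ^ y)"
    by (metis add_mono mult_2 mult_le_mono mult.right_neutral mult_1 le_refl)
  then have "(2::nat) ^ ?x + 2 ^ ?y \<le> 2 ^ (?x + ?y)"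
    unfolding xy by (simp add: power_add)
  also have "\<dots> \<le> 2 ^ E k (a + b)" using Suc by (intro power_increasing) auto
  finally show ?case by simp
qed simp

lemma conj_bound_Suc:
  assumes m: "1 \<le> m" and C: "conj_bound m C"
  shows "conj_bound (Suc m) (6 * C + 110)"
  unfolding conj_bound_def
proof (intro ballI impI)
  interpret hnn_level m .
  \<comment> \<open>As m is at least 1, the base is itself one of the HNN extensions, and
    \<open>double_coset_bound\<close> one level down concerns its top generator.\<close>
  have key: "nat \<bar>p\<bar> \<le> 7 * (len m b + len m c)"
    if "b \<in> H m" "c \<in> H m" "b \<notin> range (zpow (gen m))" "zpow (gen m) p + b = c + zpow (gen m) q" for b c p q
    using hnn_level.double_coset_bound[of b "m - 1" c p q] that m by simp
  fix g h \<gamma>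
  assume g: "g \<in> H (Suc m)" and h: "h \<in> H (Suc m)" and \<gamma>: "\<gamma> \<in> H (Suc m)" and eq: "\<gamma> + g = h + \<gamma>"
  define n where "n = len (Suc m) g + len (Suc m) h"
  \<comment> \<open>A reduced form has size at most 4 ^ n, and cyclic reduction multiplies this by
    at most 2 ^ n, which gives M; the hyperbolic bound brings another 2 ^ n, which gives Q.\<close>
  define M :: nat where "M = 8 ^ n"
  define Q :: nat where "Q = 16 ^ n"
  have nM: "n \<le> M"
    using less_exp[of n] power_mono[of "2 :: nat" 8 n] by (simp add: M_def)
  have MQ: "M \<le> Q" "2 ^ n * M = Q" "1 \<le> M"
    by (simp_all add: M_def Q_def power_mono flip: power_mult_distrib)
  have cyc: "\<exists>a\<in>H (Suc m). \<exists>u. a + x = u + a \<and> len (Suc m) a \<le> 2 * M \<and>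
      cyclically_reduced n M u"
    if x: "x \<in> H (Suc m)" "len (Suc m) x \<le> n" for x
  proof -
    obtain us d where us: "x = ev us + d" "reduced us" "base us" "d \<in> H m"
      "length us \<le> len (Suc m) x" "size_sum us + len m d \<le> 4 ^ len (Suc m) x"
      using reduced_form[OF x(1)] .
    let ?N = "size_sum us + len m d"
    have len_us: "length us \<le> n" using us(5) x(2) by simp
    have "2 ^ length us * ?N \<le> 2 ^ n * 4 ^ n"
    proof (rule mult_le_mono)
      show "2 ^ length us \<le> (2 :: nat) ^ n" using len_us by (intro power_increasing) auto
      have "(4 :: nat) ^ len (Suc m) x \<le> 4 ^ n" using x(2) by (intro power_increasing) auto
      then show "?N \<le> 4 ^ n" using us(6) by linarith
    qed
    also have "\<dots> = M" by (simp add: M_def flip: power_mult_distrib)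
    finally have N: "2 ^ length us * ?N \<le> M" .
    have "2 ^ length us \<le> (8 :: nat) ^ n"
      using len_us order.trans[OF power_increasing[of "length us" n "2 :: nat"] power_mono[of 2 8 n]] by simp
    then have N1: "2 ^ length us * (?N + 1) \<le> 2 * M"
      using N unfolding distrib_left M_def by simp
    obtain a u where a: "a \<in> H (Suc m)" "a + (ev us + d) = u + a"
      "len (Suc m) a \<le> 2 ^ length us * (?N + 1)"
      "cyclically_reduced (length us) (2 ^ length us * ?N) u"
      using cyclic_reduction[OF us(2-4)] by blast
    then show ?thesis
      using order.trans[OF a(3) N1] us(1) cyclically_reduced_mono[OF a(4) len_us N] by blast
  qed
  obtain a u where a: "a \<in> H (Suc m)" "a + g = u + a" "len (Suc m) a \<le> 2 * M"
    "cyclically_reduced n M u"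
    using cyc[OF g] by (auto simp: n_def)
  obtain b v where b: "b \<in> H (Suc m)" "b + h = v + b" "len (Suc m) b \<le> 2 * M"
    "cyclically_reduced n M v"
    using cyc[OF h] by (auto simp: n_def)
  have g_eq: "g = - a + u + a"
    using a(2) by (metis add.assoc minus_add_cancel)
  have h_eq: "h = - b + v + b"
    using b(2) by (metis add.assoc minus_add_cancel)
  define \<delta> where "\<delta> = b + \<gamma> - a"
  have \<delta>: "\<delta> \<in> H (Suc m)" using a(1) b(1) \<gamma> by (simp add: \<delta>_def)
  have conj: "\<delta> + u = v + \<delta>"
  proof -
    have "\<delta> + u + a = b + (\<gamma> + g)"
      by (simp only: \<delta>_def diff_conv_add_uminus add.assoc g_eq)
    also have "\<dots> = v + \<delta> + a"
      unfolding eq h_eq \<delta>_def by (simp add: add.assoc)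
    finally show ?thesis by simp
  qed
  \<comment> \<open>Two values of \<open>E\<close> for two base conjugators, one taking each element
    to a power of \<open>gen m\<close>. The hyperbolic case needs 28 Q + 2 M. The summand 1 keeps
    the argument positive for \<open>E_add\<close>.\<close>
  let ?B = "2 * E (m - 1) (2 * C * M + C + 1) + 31 * Q"
  have "\<exists>d\<in>H (Suc m). d + u = v + d \<and> len (Suc m) d \<le> ?B"
  proof -
    consider (ell) "u \<in> H m" "len m u \<le> M" "v \<in> H m" "len m v \<le> M"
      | (hyp) us vs where "u = ev us" "base us" "us \<noteq> []" "reduced (us @ us)" "length us \<le> n" "size_sum us \<le> M"
        "v = ev vs" "base vs" "vs \<noteq> []" "reduced (vs @ vs)" "length vs \<le> n" "size_sum vs \<le> M"
      | (mix1) vs where "u \<in> H m" "v = ev vs" "base vs" "vs \<noteq> []" "reduced (vs @ vs)"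
      | (mix2) us where "v \<in> H m" "u = ev us" "base us" "us \<noteq> []" "reduced (us @ us)"
      using a(4) b(4) unfolding cyclically_reduced_def by blast
    then show ?thesis
    proof cases
      case hyp
      obtain d where d: "d \<in> H (Suc m)" "d + ev us = ev vs + d"
        "len (Suc m) d \<le> 2 ^ Suc (length us) * (7 * (size_sum us + size_sum vs)) + size_sum us + length us"
      proof (rule hyperbolic_conjugate[of 7 us vs \<delta>])
        show "nat \<bar>p\<bar> \<le> 7 * (len m b + len m c)"
          if "b \<in> H m" "c \<in> H m" "b \<notin> range (zpow (gen m))" "zpow (gen m) p + b = c + zpow (gen m) q"
          for b c p q
          using that by (rule key)
      qed (use hyp \<delta> conj that in auto)
      note d(3)
      also have "2 ^ Suc (length us) * (7 * (size_sum us + size_sum vs)) + size_sum us + length us \<le>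
          2 ^ Suc n * (7 * (M + M)) + M + M"
        using hyp nM by (intro add_mono mult_le_mono power_increasing) auto
      also have "\<dots> \<le> ?B"
        using MQ by simp
      finally show ?thesis using d hyp by blast
    next
      case mix1
      then show ?thesis using elliptic_not_hyperbolic[of u vs \<delta>] \<delta> conj by simp
    next
      case mix2
      have "- \<delta> + v = u + - \<delta>"
        using conj by (metis add.assoc minus_add_cancel add.right_neutral right_minus)
      then show ?thesis using elliptic_not_hyperbolic[of v us "- \<delta>"] mix2 \<delta> by simp
    next
      case ell
      have IH: "\<exists>d\<in>H m. d + x = y + d \<and> len (Suc m) d \<le> E (m - 1) (2 * C * M + C + 1)"
        if xy: "x \<in> H m" "y \<in> H m" "c \<in> H m" "c + x = y + c" "len m x \<le> M" "len m y \<le> M" for x y c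
      proof -
        obtain d where d: "d \<in> H m" "d + x = y + d" "len m d \<le> E (m - 1) (C * (len m x + len m y) + C)"
          using C xy unfolding conj_bound_def by blast
        have "C * (len m x + len m y) \<le> C * (2 * M)"
          using xy by (intro mult_le_mono2) simp
        also have "\<dots> = 2 * C * M" by simp
        finally have "C * (len m x + len m y) + C \<le> 2 * C * M + C + 1" by linarith
        then have "E (m - 1) (C * (len m x + len m y) + C) \<le> E (m - 1) (2 * C * M + C + 1)"
          by (rule E_mono)
        then show ?thesis
          using d len_mono[of m "Suc m" d] by (intro bexI[of _ d]) auto
      qed
      from elliptic_conjugate[OF \<delta> ell(1,3) conj] show ?thesis
      proof cases
        case (1 d)
        obtain d1 where "d1 \<in> H m" "d1 + u = v + d1" "len (Suc m) d1 \<le> E (m - 1) (2 * C * M + C + 1)"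
          using IH[OF ell(1,3) 1(1,2) ell(2,4)] by blast
        then show ?thesis by (intro bexI[of _ d1]) auto
      next
        case (2 d d' p q i j)
        have size: "nat \<bar>p\<bar> \<le> M" if "x \<in> H m" "c \<in> H m" "c + x = zpow (gen m) p + c" "len m x \<le> M" for x c p
        proof -
          have "exponent_sum m (c + x) = exponent_sum m (zpow (gen m) p + c)" using that(3) by simp
          then have "exponent_sum m x = p" using that(1,2) by (simp add: exponent_sum_add)
          then show ?thesis using exponent_sum_le[OF that(1)] that(4) by linarith
        qed
        have p: "nat \<bar>p\<bar> \<le> M" and q: "nat \<bar>q\<bar> \<le> M"
          using size[OF ell(1) 2(1,3) ell(2)] size[OF ell(3) 2(2,4) ell(4)] by simp_all
        have len_p: "len m (zpow (gen m) p) \<le> M" "len m (zpow (gen m) q) \<le> M"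
          using len_zpow_gen[of m m p] len_zpow_gen[of m m q] p q by simp_all
        obtain d1 where d1: "d1 \<in> H m" "d1 + u = zpow (gen m) p + d1"
          "len (Suc m) d1 \<le> E (m - 1) (2 * C * M + C + 1)"
          using IH[OF ell(1) _ 2(1,3) ell(2) len_p(1)] by auto
        obtain d2 where d2: "d2 \<in> H m" "d2 + v = zpow (gen m) q + d2"
          "len (Suc m) d2 \<le> E (m - 1) (2 * C * M + C + 1)"
          using IH[OF ell(3) _ 2(2,4) ell(4) len_p(2)] by auto
        obtain r where r: "zpow (gen (Suc m)) r + zpow (gen m) p = zpow (gen m) q + zpow (gen (Suc m)) r"
          "2 ^ nat \<bar>r\<bar> \<le> \<bar>p\<bar> + \<bar>q\<bar> + 1"
          using stable_power_connects[OF 2(5)] .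
        have "int (nat \<bar>r\<bar>) < 2 ^ nat \<bar>r\<bar>" by (rule of_nat_less_two_power)
        then have r_le: "nat \<bar>r\<bar> \<le> 2 * M" using r(2) p q by linarith
        let ?d = "- d2 + zpow (gen (Suc m)) r + d1"
        have "d2 + (?d + u) = zpow (gen (Suc m)) r + (d1 + u)"
          by (simp add: add.assoc)
        also have "\<dots> = zpow (gen m) q + zpow (gen (Suc m)) r + d1"
          by (simp only: d1(2) r(1)[symmetric] add.assoc)
        also have "\<dots> = zpow (gen m) q + d2 + ?d"
          by (simp add: add.assoc)
        also have "\<dots> = d2 + (v + ?d)"
          by (simp only: d2(2)[symmetric] add.assoc)
        finally have "?d + u = v + ?d" by simp
        moreover have "len (Suc m) (zpow (gen (Suc m)) r) \<le> 2 * M"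
          using order.trans[OF len_zpow_gen r_le] by simp
        then have "len (Suc m) ?d \<le> 2 * E (m - 1) (2 * C * M + C + 1) + 2 * M"
          using len_add[of "- d2 + zpow (gen (Suc m)) r" "Suc m" d1] len_add[of "- d2" "Suc m" "zpow (gen (Suc m)) r"]
            d1 d2 by simp
        then have "len (Suc m) ?d \<le> ?B" using MQ(1) by simp
        ultimately show ?thesis
          using d1(1) d2(1) by (intro bexI[of _ ?d]) auto
      qed
    qed
  qed
  then obtain d where d: "d \<in> H (Suc m)" "d + u = v + d" "len (Suc m) d \<le> ?B" by blast
  let ?d = "- b + d + a"
  have "b + (?d + g) = d + (a + g)"
    by (simp add: add.assoc)
  also have "\<dots> = v + d + a"
    by (simp only: a(2) d(2) add.assoc[symmetric])
  also have "\<dots> = v + b + ?d"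
    by (simp add: add.assoc)
  also have "\<dots> = b + (h + ?d)"
    by (simp only: b(2)[symmetric] add.assoc)
  finally have "?d + g = h + ?d" by simp
  moreover have "len (Suc m) ?d \<le> E m ((6 * C + 110) * n + (6 * C + 110))"
  proof -
    let ?Z = "2 * C * M + C + 1"
    have "len (Suc m) ?d \<le> ?B + 4 * M"
      using len_add[of "- b + d" "Suc m" a] len_add[of "- b" "Suc m" d] a(1,3) b(1,3) d(1,3) by simp
    also have "\<dots> \<le> E (m - 1) ?Z + E (m - 1) ?Z + E (m - 1) (35 * Q)"
      using le_E[of "35 * Q" "m - 1"] MQ(1) by simp
    also have "\<dots> \<le> E (m - 1) (?Z + ?Z) + E (m - 1) (35 * Q)"
      by (intro add_mono E_add) auto
    also have "\<dots> \<le> E (m - 1) (?Z + ?Z + 35 * Q)"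
      using MQ by (intro E_add) auto
    also have "\<dots> \<le> E (m - 1) (2 ^ ((6 * C + 110) * n + (6 * C + 110)))"
    proof (intro E_mono)
      have "C * M \<le> C * Q" "C \<le> C * Q" "1 \<le> Q"
        using MQ by simp_all
      then have "4 * (C * M) + 2 * C + 2 + 35 * Q \<le> 6 * (C * Q) + 40 * Q"
        by linarith
      then have "?Z + ?Z + 35 * Q \<le> (6 * C + 40) * Q"
        by (simp only: distrib_right mult.assoc)
      also have "\<dots> \<le> 2 ^ (6 * C + 40) * 2 ^ (4 * n)"
        using less_exp[of "6 * C + 40"] by (intro mult_le_mono) (auto simp: Q_def power_mult)
      also have "\<dots> = 2 ^ (6 * C + 40 + 4 * n)"
        by (simp add: power_add)
      also have "\<dots> \<le> 2 ^ ((6 * C + 110) * n + (6 * C + 110))"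
        by (intro power_increasing) (auto simp: algebra_simps)
      finally show "?Z + ?Z + 35 * Q \<le> 2 ^ ((6 * C + 110) * n + (6 * C + 110))" .
    qed
    also have "\<dots> = E m ((6 * C + 110) * n + (6 * C + 110))"
      using m by (simp add: E_shift del: E.simps)
    finally show ?thesis .
  qed
  ultimately show "\<exists>d\<in>H (Suc m). d + g = h + d \<and>
      len (Suc m) d \<le> E (Suc m - 1) ((6 * C + 110) * (len (Suc m) g + len (Suc m) h) + (6 * C + 110))"
    using a(1) b(1) d(1) by (intro bexI[of _ ?d]) (auto simp: n_def)
qed

theorem conj_bound_exists: "1 \<le> m \<Longrightarrow> \<exists>C. conj_bound m C"
proof (induction m rule: nat_induct_at_least)
  case base
  then show ?case using conj_bound_1 by blast
next
  case (Suc m)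
  then show ?case using conj_bound_Suc by blast
qed

lemma CL_upper:
  assumes "1 \<le> m"
  shows "BS_CL m \<preceq> E (m - 1)"
proof -
  obtain C where C: "conj_bound m C"
    using conj_bound_exists[OF assms] by blast
  let ?C = "C + 1"
  have "BS_CL m n \<le> ?C * E (m - 1) (?C * n + ?C) + ?C * n + ?C" for n
  proof -
    have "BS_CL m n \<le> E (m - 1) (?C * n + ?C)"
    proof (rule CL_BS_le)
      fix g h c
      assume *: "g \<in> H m" "h \<in> H m" "c \<in> H m" "c + g = h + c" "len m g + len m h \<le> n"
      then obtain d where d: "d \<in> H m" "d + g = h + d" "len m d \<le> E (m - 1) (C * (len m g + len m h) + C)"
        using C unfolding conj_bound_def by blast
      have "C * (len m g + len m h) \<le> C * n"
        using *(5) by (rule mult_le_mono2)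
      then have "C * (len m g + len m h) + C \<le> ?C * n + ?C"
        unfolding distrib_right by linarith
      then have "E (m - 1) (C * (len m g + len m h) + C) \<le> E (m - 1) (?C * n + ?C)"
        by (rule E_mono)
      then show "\<exists>c'\<in>H m. c' + g = h + c' \<and> len m c' \<le> E (m - 1) (?C * n + ?C)"
        using d by (meson order.trans)
    qed
    then show ?thesis by simp
  qed
  then show ?thesis
    unfolding growth_le_def by (intro exI[of _ ?C]) simp
qed

section \<open>The lower bound\<close>

definition int_dist :: "real \<Rightarrow> real" where
  "int_dist x = \<bar>x - of_int (round x)\<bar>"

lemma int_dist_le: "int_dist x \<le> \<bar>x - of_int k\<bar>"
  unfolding int_dist_def by (subst (1 2) abs_minus_commute) (rule round_diff_minimal)

lemma int_dist_add: "int_dist (x + y) \<le> int_dist x + int_dist y"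
  using int_dist_le[of "x + y" "round x + round y"] unfolding int_dist_def by simp

lemma int_dist_uminus: "int_dist (- x) = int_dist x"
proof -
  have "int_dist (- x) \<le> int_dist x" for x
    using int_dist_le[of "- x" "- round x"] unfolding int_dist_def by simp
  from this[of x] this[of "- x"] show ?thesis by simp
qed

lemma int_dist_of_int [simp]: "int_dist (of_int k) = 0"
  by (simp add: int_dist_def)

text \<open>A subadditive function that is at most 1 on powers of 2, hence a lower bound for the number of signed
  powers of 2 in any expression of its argument.\<close>

definition digit_weight :: "nat \<Rightarrow> real \<Rightarrow> real" where
  "digit_weight N x = (\<Sum>i=1..N. int_dist (x / 4 ^ i))"

lemma digit_weight_add: "digit_weight N (x + y) \<le> digit_weight N x + digit_weight N y"
  unfolding digit_weight_def sum.distrib[symmetric]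
  by (intro sum_mono) (simp add: add_divide_distrib int_dist_add)

lemma digit_weight_uminus: "digit_weight N (- x) = digit_weight N x"
  by (simp add: digit_weight_def int_dist_uminus)

lemma powi_2_int: "0 \<le> k \<Longrightarrow> (2::real) powi k = of_int (2 ^ nat k)"
  by (simp add: power_int_def)

text \<open>Only negative exponents k - 2 i contribute, and their terms decrease by a factor 4.
  Subtracting the last power closes the induction: the new term is a quarter of it, and the next
  remainder another quarter.\<close>

lemma digit_weight_power_strong:
  "digit_weight N (2 powi k) \<le> (if 2 * int N \<le> k then 0 else 1 - 2 powi (k - 2 * int N))"
proof (induction N)
  case 0
  have "(2::real) powi k \<le> 2 powi 0" if "k < 0"
    using that by (intro power_int_increasing) auto
  then show ?case by (auto simp: digit_weight_def)
next
  case (Suc N)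
  let ?e = "k - 2 * int (Suc N)"
  have quot: "(2::real) powi k / 4 ^ Suc N = 2 powi ?e"
  proof -
    have "(2::real) powi int (2 * Suc N) = 4 ^ Suc N"
      by (simp only: power_int_of_nat power_mult) simp
    then show ?thesis
      by (simp add: power_int_diff)
  qed
  have step: "digit_weight (Suc N) (2 powi k) = digit_weight N (2 powi k) + int_dist (2 powi ?e)"
    by (simp add: digit_weight_def quot del: power_Suc)
  consider "0 \<le> ?e" | "?e = - 1" | "?e = - 2" | "?e < - 2"
    by linarith
  then show ?case
  proof cases
    case 1
    then show ?thesis
      using Suc unfolding step by (simp only: powi_2_int int_dist_of_int) auto
  next
    case 2
    have e: "2 powi ?e = (1 / 2 :: real)"
      by (subst 2) (simp add: power_int_minus)
    have "int_dist (1 / 2) \<le> 1 / 2"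
      using int_dist_le[of "1 / 2" 0] by simp
    then show ?thesis using Suc 2 unfolding step e by auto
  next
    case 3
    have e: "2 powi ?e = (1 / 4 :: real)"
      by (subst 3) (simp add: power_int_minus)
    have "int_dist (1 / 4) \<le> 1 / 4"
      using int_dist_le[of "1 / 4" 0] by simp
    then show ?thesis using Suc 3 unfolding step e by auto
  next
    case 4
    have "int_dist (2 powi ?e) \<le> 2 powi ?e"
      using int_dist_le[of "2 powi ?e" 0] by simp
    moreover have "(2::real) powi (k - 2 * int N) = 4 * 2 powi ?e"
    proof -
      have "(2::real) powi (?e + 2) = 2 powi ?e * 2 powi 2"
        by (rule power_int_add) simp
      then show ?thesis by (simp add: algebra_simps)
    qed
    moreover have "digit_weight N (2 powi k) \<le> 1 - 2 powi (k - 2 * int N)"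
      using Suc 4 by simp
    moreover have "(0::real) \<le> 2 powi ?e" by simp
    ultimately have "digit_weight (Suc N) (2 powi k) \<le> 1 - 2 powi ?e"
      unfolding step by linarith
    then show ?thesis using 4 by simp
  qed
qed

lemma digit_weight_power: "digit_weight N (2 powi k) \<le> 1"
proof -
  have "(0::real) \<le> 2 powi (k - 2 * int N)" by simp
  then have "(if 2 * int N \<le> k then 0 else 1 - 2 powi (k - 2 * int N)) \<le> (1::real)"
    by simp
  then show ?thesis
    using digit_weight_power_strong order.trans by blast
qed

text \<open>Divided by 4 ^ i, the number has the fractional part (1 - 4 ^ (- i)) / 3, which lies
  between 1/4 and 1/3, so each of the N terms is at least 1/4.\<close>

lemma digit_weight_repunit:
  "real N / 4 \<le> digit_weight N ((4 ^ N - 1) / 3)"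
proof -
  have "1 / 4 \<le> int_dist ((4 ^ N - 1) / 3 / 4 ^ i)" if i: "i \<in> {1..N}" for i
  proof -
    define r :: real where "r = 1 / 3 - 1 / (3 * 4 ^ i)"
    have "\<exists>k. (4 ^ j - 1) / 3 = real_of_int k" for j
    proof (induction j)
      case (Suc j)
      then obtain k where k: "(4 ^ j - 1) / 3 = real_of_int k" by blast
      have "(4 ^ Suc j - 1) / 3 = 4 * ((4 ^ j - 1) / 3) + (1::real)" by (simp add: field_simps)
      then show ?case
        unfolding k by (intro exI[of _ "4 * k + 1"]) simp
    qed (auto intro: exI[of _ 0])
    then obtain k where k: "(4 ^ (N - i) - 1) / 3 = real_of_int k" by blast
    have "4 ^ N = (4::real) ^ (N - i) * 4 ^ i"
      using i by (simp flip: power_add)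
    then have x: "(4 ^ N - 1) / 3 / 4 ^ i = real_of_int k + r"
      by (simp add: r_def field_simps flip: k)
    have "(4::real) ^ 1 \<le> 4 ^ i" using i by (intro power_increasing) auto
    then have r: "1 / 4 \<le> r" "r \<le> 1 / 3"
      by (simp_all add: r_def field_simps)
    have "1 / 4 \<le> \<bar>r - of_int j\<bar>" for j
    proof (cases "j \<le> 0")
      case True
      then show ?thesis using r by simp
    next
      case False
      then have "1 \<le> real_of_int j" by simp
      then show ?thesis using r by linarith
    qed
    from this[of "round (real_of_int k + r) - k"] show ?thesis
      unfolding x int_dist_def by (simp add: algebra_simps)
  qed
  then have "(\<Sum>i=1..N. 1 / 4) \<le> digit_weight N ((4 ^ N - 1) / 3)"
    unfolding digit_weight_def by (rule sum_mono)
  then show ?thesis by simp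
qed

text \<open>The tower acts on the real-valued functions on itself: \<open>gen 0\<close> adds \<open>bump\<close>, the other generators
  translate the argument. The relations hold because translation by \<open>gen 1\<close> doubles \<open>bump\<close>.\<close>

definition bump :: "tower \<Rightarrow> real" where
  "bump x = (if x \<in> range (zpow (gen 1)) then 2 powi (- exponent_sum 1 x) else 0)"

lemma bump_zpow: "bump (zpow (gen 1) j) = 2 powi (- j)"
  unfolding bump_def using exponent_sum_zpow[of 1 j] by simp

lemma bump_gen_1: "bump (- gen 1 + x) = 2 * bump x"
proof (cases "x \<in> range (zpow (gen 1))")
  case True
  then obtain j where x: "x = zpow (gen 1) j" by blast
  have "- gen 1 + x = zpow (gen 1) (j - 1)"
    unfolding x by (simp only: zpow_diff_1)
  then have "bump (- gen 1 + x) = 2 powi (1 + - j)"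
    by (simp only: bump_zpow) simp
  also have "\<dots> = 2 * 2 powi (- j)"
    by (subst power_int_add) auto
  finally show ?thesis
    unfolding x bump_zpow .
next
  case False
  have "- gen 1 + x \<notin> range (zpow (gen 1))"
  proof
    assume "- gen 1 + x \<in> range (zpow (gen 1))"
    then obtain j where "- gen 1 + x = zpow (gen 1) j" by blast
    then have "x = zpow (gen 1) (j + 1)"
      unfolding zpow_add_1 by (metis add_minus_cancel)
    then show False using False by blast
  qed
  then show ?thesis using False by (simp add: bump_def)
qed

definition affine_gen :: "nat \<Rightarrow> (tower \<Rightarrow> real) bijection" where
  "affine_gen i = Bijection (if i = 0 then (\<lambda>f x. f x + bump x) else (\<lambda>f x. f (- gen i + x)))"

lemma app_affine_gen:
  "app (affine_gen i) f = (if i = 0 then (\<lambda>x. f x + bump x) else (\<lambda>x. f (- gen i + x)))"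
proof -
  have "bij (\<lambda>f x. f x + bump x)"
    by (rule bijI_inverse[of "\<lambda>f x. f x - bump x"]) auto
  moreover have "bij (\<lambda>f x. f (- gen i + x) :: real)"
    by (rule bijI_inverse[of "\<lambda>f x. f (gen i + x)"]) (auto simp: add.assoc[symmetric])
  ultimately show ?thesis
    unfolding affine_gen_def by (subst app_Bijection) auto
qed

lemma app_uminus_affine_gen:
  "app (- affine_gen i) f = (if i = 0 then (\<lambda>x. f x - bump x) else (\<lambda>x. f (gen i + x)))"
  by (auto simp: app_minus_eq_iff app_affine_gen add.assoc[symmetric])

lemma tower_family_affine_gen: "tower_family affine_gen"
  unfolding tower_family_def
proof (intro allI bijection_eqI)
  fix i and f :: "tower \<Rightarrow> real"
  show "app (affine_gen (Suc i) + affine_gen i) f = app (affine_gen i + affine_gen i + affine_gen (Suc i)) f"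
  proof (cases "i = 0")
    case True
    then show ?thesis
      using bump_gen_1 by (auto simp: app_affine_gen)
  next
    case False
    have "- gen i + (- gen (Suc i) + x) = - gen (Suc i) + (- gen i + (- gen i + x))" for x
    proof -
      have "- (gen (Suc i) + gen i) + x = - (gen i + gen i + gen (Suc i)) + x"
        by (simp only: gen_rel)
      then show ?thesis
        by (simp only: minus_add add.assoc)
    qed
    then show ?thesis
      using False by (simp add: app_affine_gen)
  qed
qed

definition affine_value :: "tower \<Rightarrow> (tower \<Rightarrow> real) \<Rightarrow> tower \<Rightarrow> real" where
  "affine_value g = app (tower_hom affine_gen g)"

lemma affine_value_add: "affine_value (g + h) f = affine_value g (affine_value h f)"
  by (simp add: affine_value_def tower_hom_add tower_family_affine_gen)

lemma affine_value_zpow_0: "affine_value (zpow (gen 0) k) f x = f x + of_int k * bump x"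
proof (induction k rule: int_induct[where k = 0])
  case base
  then show ?case by (simp add: affine_value_def tower_hom_0 tower_family_affine_gen)
next
  case (step1 i)
  then show ?case
    by (simp add: zpow_add_1 affine_value_add)
      (simp add: affine_value_def tower_hom_gen tower_family_affine_gen app_affine_gen algebra_simps)
next
  case (step2 i)
  then show ?case
    by (simp add: zpow_diff_1 affine_value_add)
      (simp add: affine_value_def tower_hom_gen tower_hom_uminus tower_family_affine_gen
        app_uminus_affine_gen algebra_simps)
qed

lemma affine_value_gen_1: "affine_value (gen 1) f x = f (- gen 1 + x)"
  by (simp add: affine_value_def tower_hom_gen tower_family_affine_gen app_affine_gen)

text \<open>On each left coset of the powers of \<open>gen 1\<close>, the function reached from 0 is
  a multiple z of one geometric sequence. A letter other than \<open>gen 0\<close> translates the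
  coset, so \<open>h\<close> has to vary in the induction; \<open>gen 0\<close> adds a signed power
  of 2 to z on the single coset that supports \<open>bump\<close>.\<close>

lemma affine_value_word:
  "\<exists>z. (\<forall>j. affine_value (val w) (\<lambda>_. 0) (h + zpow (gen 1) j) = 2 powi (- j) * z) \<and>
     digit_weight N z \<le> real (length w)"
proof (induction w arbitrary: h)
  case Nil
  then show ?case
    using int_dist_of_int[of 0]
    by (intro exI[of _ 0]) (simp add: val_Nil affine_value_def tower_hom_0 tower_family_affine_gen digit_weight_def)
next
  case (Cons a w)
  obtain i b where a: "a = (i, b)" by (cases a)
  let ?F = "affine_value (val w) (\<lambda>_. 0)"
  show ?case
  proof (cases "i = 0")
    case False
    obtain z where z: "\<forall>j. ?F ((if b then - gen i else gen i) + h + zpow (gen 1) j) = 2 powi (- j) * z"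
      "digit_weight N z \<le> real (length w)"
      using Cons by blast
    have "affine_value (val (a # w)) (\<lambda>_. 0) x = ?F ((if b then - gen i else gen i) + x)" for x
      using False
      by (simp add: a val_Cons affine_value_add)
        (simp add: affine_value_def tower_hom_gen tower_hom_uminus tower_family_affine_gen
          app_affine_gen app_uminus_affine_gen)
    then show ?thesis
      using z by (intro exI[of _ z]) (simp add: add.assoc)
  next
    case True
    obtain z where z: "\<forall>j. ?F (h + zpow (gen 1) j) = 2 powi (- j) * z" "digit_weight N z \<le> real (length w)"
      using Cons by blast
    define s :: real where "s = (if b then 1 else - 1)"
    have val: "affine_value (val (a # w)) (\<lambda>_. 0) x = ?F x + s * bump x" for x
      by (simp add: a True val_Cons affine_value_add s_def)
        (simp add: affine_value_def tower_hom_gen tower_hom_uminus tower_family_affine_gen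
          app_affine_gen app_uminus_affine_gen)
    show ?thesis
    proof (cases "h \<in> range (zpow (gen 1))")
      case h: True
      then obtain k where k: "h = zpow (gen 1) k" by blast
      have "bump (h + zpow (gen 1) j) = 2 powi (- j) * 2 powi (- k)" for j
        unfolding k zpow_add[symmetric] bump_zpow by (simp flip: power_int_add add: add.commute)
      then have "affine_value (val (a # w)) (\<lambda>_. 0) (h + zpow (gen 1) j) = 2 powi (- j) * (z + s * 2 powi (- k))" for j
        unfolding val using z(1) by (simp add: algebra_simps)
      moreover have "digit_weight N (s * 2 powi (- k)) \<le> 1"
        using digit_weight_power[of N "- k"] by (simp add: s_def digit_weight_uminus)
      then have "digit_weight N (z + s * 2 powi (- k)) \<le> real (length (a # w))"
        using digit_weight_add[of N z "s * 2 powi (- k)"] z(2) by simp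
      ultimately show ?thesis by blast
    next
      case h: False
      have "h + zpow (gen 1) j \<notin> range (zpow (gen 1))" for j
      proof
        assume "h + zpow (gen 1) j \<in> range (zpow (gen 1))"
        then obtain k where "h + zpow (gen 1) j = zpow (gen 1) k" by blast
        then have "h = zpow (gen 1) (k - j)"
          unfolding zpow_diff by (metis add_diff_cancel)
        then show False using h by blast
      qed
      then have "bump (h + zpow (gen 1) j) = 0" for j
        by (simp add: bump_def)
      then show ?thesis
        using z by (intro exI[of _ z]) (simp add: val)
    qed
  qed
qed

text \<open>Apply both sides of the equation to the function 0 and evaluate at the point 0. On the
  left \<open>gen 1\<close> fixes that function; on the right the value is read two steps along the
  coset, where it is 4 z. So z = 4 z + (4 ^ N - 1).\<close>

theorem conjugator_lower_bound:
  assumes c: "c \<in> H m" and eq: "c + zpow (gen 1) 2 = zpow (gen 0) (4 ^ N - 1) + zpow (gen 1) 2 + c"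
  shows "real N / 4 \<le> real (len m c)"
proof -
  obtain w where w: "w \<in> words (BS_gens m)" "val w = c" "length w = len m c"
    using len_attained[OF c] .
  let ?F = "affine_value c (\<lambda>_. 0)"
  obtain z where z: "\<And>j. ?F (0 + zpow (gen 1) j) = 2 powi (- j) * z" "digit_weight N z \<le> real (len m c)"
    using affine_value_word[of w 0 N] w by auto
  have shift: "affine_value (zpow (gen 1) 2) f x = f (zpow (gen 1) (- 2) + x)" for f x
    unfolding zpow_2 zpow_minus
    by (simp only: affine_value_add affine_value_gen_1 minus_add add.assoc)
  have "?F 0 = affine_value (c + zpow (gen 1) 2) (\<lambda>_. 0) 0"
  proof -
    have "affine_value (zpow (gen 1) 2) (\<lambda>_. 0) = (\<lambda>_. 0)"
      by (rule ext) (simp only: shift)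
    then show ?thesis by (simp only: affine_value_add)
  qed
  also have "\<dots> = ?F (zpow (gen 1) (- 2)) + of_int (4 ^ N - 1) * bump 0"
    unfolding eq by (simp only: affine_value_add affine_value_zpow_0 shift add_0_right)
  finally have "z = 4 * z + (4 ^ N - 1)"
    using z(1)[of 0] z(1)[of "- 2"] bump_zpow[of 0] by simp
  then have "- z = (4 ^ N - 1) / 3" by simp
  moreover have "digit_weight N (- z) \<le> real (len m c)"
    using z(2) digit_weight_uminus[of N z] by simp
  ultimately have "digit_weight N ((4 ^ N - 1) / 3) \<le> real (len m c)"
    by (simp only:)
  then show ?thesis
    using digit_weight_repunit[of N] by linarith
qed

text \<open>Conjugation by the power of \<open>gen (Suc i)\<close> with exponent E k n raises
  \<open>gen i\<close> to 2 ^ E k n. Each level doubles the length and adds 1; with 1 added to the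
  length this is plain doubling.\<close>

lemma len_tower_power:
  "i + k \<le> m \<Longrightarrow> len m (zpow (gen i) (int (E k n))) + 1 \<le> 2 ^ k * (n + 1)"
proof (induction k arbitrary: i)
  case 0
  then show ?case using len_zpow_gen[of i m "int n"] by simp
next
  case (Suc k)
  let ?x = "zpow (gen (Suc i)) (int (E k n))"
  have "?x + zpow (gen i) 1 = zpow (gen i) (2 ^ E k n * 1) + ?x"
    by (rule hnn_level.stable_power_conj)
  then have "zpow (gen i) (int (E (Suc k) n)) = ?x + gen i - ?x"
    by simp
  moreover have "?x \<in> H m" "gen i \<in> H m" "len m (gen i) \<le> 1"
    using Suc.prems len_gen[of i m] by simp_all
  ultimately have "len m (zpow (gen i) (int (E (Suc k) n))) \<le> len m ?x + 1 + len m ?x"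
    using len_diff[of "?x + gen i" m ?x] len_add[of ?x m "gen i"] by simp
  then show ?case
    using Suc.IH[of "Suc i"] Suc.prems by simp
qed

lemma CL_lower:
  assumes "1 \<le> m"
  shows "E (m - 1) \<preceq> BS_CL m"
proof -
  \<comment> \<open>At least 8 * 2 ^ (m - 1), which the lengths of the two elements require, and at
    least 4, for the loss in \<open>N div 4\<close>.\<close>
  define D :: nat where "D = 2 ^ (m + 3)"
  have "E (m - 1) n \<le> D * BS_CL m (D * n + D) + D * n + D" for n
  proof -
    define N where "N = E (m - 1) n"
    let ?a = "gen 0" and ?t = "gen 1"
    let ?g = "zpow ?t 2" and ?h = "zpow ?a (4 ^ N - 1) + zpow ?t 2"
    let ?x = "zpow ?t (int N)"
    have mem: "?t \<in> H m" "?a \<in> H m" "?x \<in> H m" using assms by simp_all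
    have len_x: "len m ?x + 1 \<le> 2 ^ (m - 1) * (n + 1)"
      unfolding N_def using assms by (intro len_tower_power) simp
    have "(2::int) ^ (N + N) = 4 ^ N"
      by (simp add: power_add flip: power_mult_distrib)
    then have "zpow ?t (int N + int N) + ?a = zpow ?a (4 ^ N) + zpow ?t (int N + int N)"
      using gen_1_power_conj[of "N + N" 1] by simp
    then have pow: "zpow ?a (4 ^ N) = ?x + ?x + ?a - (?x + ?x)"
      unfolding zpow_add by simp
    have len_xx: "len m (?x + ?x) \<le> 2 * len m ?x"
      using len_add[OF mem(3,3)] by simp
    have len_t: "len m ?t \<le> 1" and len_a: "len m ?a \<le> 1"
      using len_gen[of 1 m] len_gen[of 0 m] assms by simp_all
    have "len m (zpow ?a (4 ^ N)) \<le> len m (?x + ?x + ?a) + len m (?x + ?x)"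
      unfolding pow using mem by (intro len_diff) auto
    also have "\<dots> \<le> 4 * len m ?x + 1"
      using len_add[of "?x + ?x" m ?a] mem len_xx len_a by simp
    finally have len_pow: "len m (zpow ?a (4 ^ N)) \<le> 4 * len m ?x + 1" .
    have len_g: "len m ?g \<le> 2"
      using len_zpow_gen[of 1 m 2] assms by simp
    have "len m (zpow ?a (4 ^ N - 1)) \<le> 4 * len m ?x + 2"
      using len_diff[of "zpow ?a (4 ^ N)" m ?a] mem len_pow len_a by (simp add: zpow_diff)
    then have len_h: "len m ?h \<le> 4 * len m ?x + 4"
      using len_add[of "zpow ?a (4 ^ N - 1)" m ?g] mem len_g by simp
    have "8 * (2 ^ (m - 1) * (n + 1)) \<le> D * (n + 1)"
    proof -
      have "8 * 2 ^ (m - 1) \<le> D"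
        using assms by (cases m) (simp_all add: D_def power_add)
      then show ?thesis by (simp only: mult.assoc[symmetric] mult_le_mono1)
    qed
    then have total: "len m ?g + len m ?h \<le> D * n + D"
      using len_x len_g len_h by simp
    have "\<exists>k. (4::int) ^ j - 1 = 3 * k" for j
    proof (induction j)
      case (Suc j)
      then obtain k where "(4::int) ^ j - 1 = 3 * k" by blast
      then show ?case by (intro exI[of _ "4 * k + 1"]) simp
    qed simp
    \<comment> \<open>The conjugator is the power of \<open>gen 0\<close> with exponent - z: moving
      the square of \<open>gen 1\<close> past it multiplies the exponent by 4, and the difference is
      3 z.\<close>
    then obtain z where z: "(4::int) ^ N - 1 = 3 * z" by blast
    have "zpow ?t (int 2) + zpow ?a z = zpow ?a (2 ^ 2 * z) + zpow ?t (int 2)"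
      by (rule gen_1_power_conj)
    then have "zpow ?a (- z) + zpow ?t 2 = zpow ?a (4 ^ N - 1) + zpow ?t 2 + zpow ?a (- z)"
    proof -
      have "zpow ?a (4 ^ N - 1) + zpow ?t 2 + zpow ?a (- z) =
          zpow ?a (3 * z) + (zpow ?t (int 2) + zpow ?a (- z))"
        by (simp add: z add.assoc)
      also have "\<dots> = zpow ?a (3 * z + 2 ^ 2 * - z) + zpow ?t (int 2)"
        by (simp only: gen_1_power_conj zpow_add add.assoc)
      finally show ?thesis by simp
    qed
    then have conj: "zpow ?a (- z) + ?g = ?h + zpow ?a (- z)" .
    have "N div 4 \<le> BS_CL m (D * n + D)"
    proof (rule CL_BS_ge[OF _ _ _ conj total])
      fix c
      assume "c \<in> H m" "c + ?g = ?h + c"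
      then have "real N / 4 \<le> real (len m c)"
        by (rule conjugator_lower_bound)
      then show "N div 4 \<le> len m c" by linarith
    qed (use mem in auto)
    then have "N \<le> 4 * BS_CL m (D * n + D) + 4"
      by linarith
    also have "\<dots> \<le> D * BS_CL m (D * n + D) + D"
    proof -
      have "4 \<le> D" by (simp add: D_def power_add)
      then show ?thesis by (intro add_mono mult_le_mono1)
    qed
    finally show ?thesis by (simp add: N_def)
  qed
  moreover have "D > 0" by (simp add: D_def)
  ultimately show ?thesis
    unfolding growth_le_def by blast
qed

theorem theorem1p3:
  fixes m :: nat
  assumes "m \<ge> 1"
  shows "CL (BS_gens m) (BS_rels m) \<simeq> (\<lambda>n. E (m - 1) n)"
  using CL_upper[OF assms] CL_lower[OF assms] by (simp add: growth_equiv_def)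

end
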